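(* For every integer $n\geqslant 4$, the minimum distance of the Fermat function field lattice $\Lambda_n$ is $d(\Lambda_n)=\sqrt{2n}$.
   Context: Let $n\geqslant 4$. $\mathcal F_n$ is the Fermat curve $X^n+Y^n=Z^n$ over $K=\mathbb C$ (a non-singular plane curve), and $F_n=\mathbb C(x,y)$ with $x^n+y^n=1$ is its function field ($x=X/Z$, $y=Y/Z$). Let $\zeta$ be a primitive $n$-th root of unity and $\varepsilon$ a primitive $n$-th root of $-1$. The set $\mathcal P$ consists of the $3n$ points of $\mathcal F_n$ having exactly one zero coordinate: $a_j=(0:\zeta^j:1)$, $b_j=(\zeta^j:0:1)$, $c_j=(\varepsilon\zeta^j:1:0)$, $j=0,\dots,n-1$; points of $\mathcal F_n$ are identified with places of $F_n$. Let $\mathcal O_{\mathcal P}^*$ be the multiplicative group of those $z\in F_n^*$ all of whose zeros and poles lie in $\mathcal P$. The lattice $\Lambda_n\subset\mathbb R^{3n}$ is the image of the homomorphism $\mathcal O_{\mathcal P}^*\to\mathbb Z^{3n}$, $z\mapsto (v_P(z))_{P\in\mathcal P}$, where $v_P$ is the discrete valuation at $P$. The minimum distance is $d(\Lambda)=\min_{0\neq v\in\Lambda}\|v\|$ (Euclidean norm). *)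

theory Defs
  imports
    "HOL-Algebra.QuotRing"
    "HOL-Computational_Algebra.Computational_Algebra"
    "HOL-Analysis.L2_Norm"
begin

section \<open>Points of the Fermat curve\<close>

text \<open>The point \<open>(a : b : c)\<close> of the complex projective plane is the set of all its triples of
  homogeneous coordinates.\<close>

type_synonym point = "(complex \<times> complex \<times> complex) set"

definition proj_point :: "complex \<Rightarrow> complex \<Rightarrow> complex \<Rightarrow> point" where
  "proj_point a b c = {(k * a, k * b, k * c) | k. k \<noteq> 0}"

definition fermat_curve :: "nat \<Rightarrow> point set" where
  "fermat_curve n = {proj_point a b c | a b c. (a, b, c) \<noteq> (0, 0, 0) \<and> a ^ n + b ^ n = c ^ n}"

definition fermat_cusps :: "nat \<Rightarrow> point set" where
  "fermat_cusps n = {P \<in> fermat_curve n. \<forall>(a, b, c) \<in> P.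
     (a = 0 \<and> b \<noteq> 0 \<and> c \<noteq> 0) \<or> (a \<noteq> 0 \<and> b = 0 \<and> c \<noteq> 0) \<or> (a \<noteq> 0 \<and> b \<noteq> 0 \<and> c = 0)}"

section \<open>The function field\<close>

text \<open>The field \<open>F\<^sub>n = \<complex>(x, y)\<close> with \<open>x\<^sup>n + y\<^sup>n = 1\<close> is the quotient of \<open>\<complex>(x)[Y]\<close> by the principal
  ideal generated by \<open>Y\<^sup>n + x\<^sup>n - 1\<close>; the type \<open>complex poly fract\<close> is \<open>\<complex>(x)\<close>.\<close>

definition const_pol :: "complex \<Rightarrow> complex poly fract poly" where
  "const_pol c = [:to_fract [:c:]:]"

definition x_pol :: "complex poly fract poly" where
  "x_pol = [:to_fract [:0, 1:]:]"

definition y_pol :: "complex poly fract poly" where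
  "y_pol = [:0, 1:]"

definition pol_ring :: "complex poly fract poly ring" where
  "pol_ring = \<lparr>carrier = UNIV, monoid.mult = (*), one = 1, zero = 0, add = (+)\<rparr>"

definition fermat_ideal :: "nat \<Rightarrow> complex poly fract poly set" where
  "fermat_ideal n = PIdl\<^bsub>pol_ring\<^esub> (x_pol ^ n + y_pol ^ n - 1)"

definition fermat_field :: "nat \<Rightarrow> complex poly fract poly set ring" where
  "fermat_field n = pol_ring Quot (fermat_ideal n)"

definition fermat_class :: "nat \<Rightarrow> complex poly fract poly \<Rightarrow> complex poly fract poly set" where
  "fermat_class n p = fermat_ideal n +>\<^bsub>pol_ring\<^esub> p"

section \<open>Discrete valuations at the points of the curve\<close>

text \<open>The value at \<open>(a, b, c)\<close> of the form of degree \<open>d\<close> whose \<open>X\<^sup>i Y\<^sup>j Z\<^bsup>d-i-j\<^esup>\<close>-coefficient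
  is \<open>f i j\<close>.\<close>

definition form_eval :: "nat \<Rightarrow> (nat \<Rightarrow> nat \<Rightarrow> 'a) \<Rightarrow> 'a \<Rightarrow> 'a \<Rightarrow> 'a \<Rightarrow> 'a::comm_ring_1" where
  "form_eval d f a b c = (\<Sum>i\<le>d. \<Sum>j\<le>d - i. f i j * a ^ i * b ^ j * c ^ (d - i - j))"

text \<open>A form as a function on the affine curve, i.e. evaluated at \<open>X = x\<close>, \<open>Y = y\<close>, \<open>Z = 1\<close>.\<close>

definition form_class :: "nat \<Rightarrow> nat \<Rightarrow> (nat \<Rightarrow> nat \<Rightarrow> complex) \<Rightarrow> complex poly fract poly set" where
  "form_class n d f = fermat_class n (form_eval d (\<lambda>i j. const_pol (f i j)) x_pol y_pol 1)"

text \<open>The local ring at \<open>P\<close> consists of the quotients \<open>G / H\<close> of two forms of the same degree with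
  \<open>H(P) \<noteq> 0\<close>.\<close>

definition local_ring :: "nat \<Rightarrow> point \<Rightarrow> complex poly fract poly set ring" where
  "local_ring n P = (fermat_field n) \<lparr>carrier := {z \<in> carrier (fermat_field n).
     \<exists>d g h. (\<forall>(a, b, c) \<in> P. form_eval d h a b c \<noteq> 0) \<and>
             z \<otimes>\<^bsub>fermat_field n\<^esub> form_class n d h = form_class n d g}\<rparr>"

text \<open>The place of \<open>F\<^sub>n\<close> identified with \<open>P\<close> is the maximal ideal of the local ring at \<open>P\<close>.\<close>

definition place_of :: "nat \<Rightarrow> point \<Rightarrow> complex poly fract poly set set" where
  "place_of n P = carrier (local_ring n P) - Units (local_ring n P)"

definition prime_element :: "nat \<Rightarrow> point \<Rightarrow> complex poly fract poly set \<Rightarrow> bool" where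
  "prime_element n P t \<longleftrightarrow>
     t \<in> carrier (local_ring n P) \<and> PIdl\<^bsub>local_ring n P\<^esub> t = place_of n P"

text \<open>For nonzero \<open>z\<close> the valuation is the exponent \<open>k\<close> in \<open>z = t\<^sup>k u\<close>, with \<open>t\<close> a prime element
  and \<open>u\<close> a unit of the local ring.  The value at \<open>z = 0\<close> is never used.\<close>

definition valuation_at :: "nat \<Rightarrow> point \<Rightarrow> complex poly fract poly set \<Rightarrow> int" where
  "valuation_at n P z = (THE k. \<exists>t u. prime_element n P t \<and> u \<in> Units (local_ring n P) \<and>
     z = (t [^]\<^bsub>fermat_field n\<^esub> k) \<otimes>\<^bsub>fermat_field n\<^esub> u)"

section \<open>The lattice\<close>

definition cuspidal_units :: "nat \<Rightarrow> complex poly fract poly set set" where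
  "cuspidal_units n = {z \<in> carrier (fermat_field n) - {\<zero>\<^bsub>fermat_field n\<^esub>}.
     \<forall>P \<in> fermat_curve n. valuation_at n P z \<noteq> 0 \<longrightarrow> P \<in> fermat_cusps n}"

text \<open>Vectors of \<open>\<real>\<^bsup>3n\<^esup>\<close> have their coordinates indexed by the \<open>3n\<close> cusps; they are represented by
  the functions that vanish outside the set of cusps.\<close>

definition fermat_lattice :: "nat \<Rightarrow> (point \<Rightarrow> real) set" where
  "fermat_lattice n =
     (\<lambda>z P. if P \<in> fermat_cusps n then real_of_int (valuation_at n P z) else 0) ` cuspidal_units n"

definition min_distance :: "'i set \<Rightarrow> ('i \<Rightarrow> real) set \<Rightarrow> real" where
  "min_distance I L = (LEAST d. \<exists>v \<in> L. v \<noteq> (\<lambda>_. 0) \<and> d = L2_set v I)"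

section \<open>Explicit coordinates of the cusps\<close>

lemma proj_point_eq_iff:
  "proj_point a b c = proj_point a' b' c' \<longleftrightarrow>
     (\<exists>k. k \<noteq> 0 \<and> a' = k * a \<and> b' = k * b \<and> c' = k * c)" (is "?L \<longleftrightarrow> ?R")
proof
  assume ?L
  have "(a', b', c') \<in> proj_point a' b' c'"
    unfolding proj_point_def by (auto intro!: exI[of _ 1])
  with \<open>?L\<close> have "(a', b', c') \<in> proj_point a b c" by simp
  then show ?R by (auto simp: proj_point_def)
next
  assume ?R
  then obtain k where k: "k \<noteq> 0" "a' = k * a" "b' = k * b" "c' = k * c" by blast
  have "\<exists>l. l \<noteq> 0 \<and> m * a = l * a' \<and> m * b = l * b' \<and> m * c = l * c'" if "m \<noteq> 0" for m
    using k that by (intro exI[of _ "m / k"]) auto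
  moreover have "\<exists>l. l \<noteq> 0 \<and> m * a' = l * a \<and> m * b' = l * b \<and> m * c' = l * c" if "m \<noteq> 0" for m
    using k that by (intro exI[of _ "m * k"]) auto
  ultimately show ?L
    unfolding proj_point_def by (intro equalityI subsetI) (simp_all, blast+)
qed

lemma roots_unity_powers:
  fixes z :: complex
  assumes "n > 0" and "z ^ n = 1" and "\<And>k. 0 < k \<Longrightarrow> k < n \<Longrightarrow> z ^ k \<noteq> 1"
  shows "inj_on (\<lambda>j. z ^ j) {..<n}" and "(\<lambda>j. z ^ j) ` {..<n} = {w. w ^ n = 1}"
proof -
  have z: "z \<noteq> 0" using assms(1,2) by (auto simp: zero_power)
  show inj: "inj_on (\<lambda>j. z ^ j) {..<n}"
  proof (rule linorder_inj_onI')
    fix i j assume ij: "i \<in> {..<n}" "j \<in> {..<n}" "i < j"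
    have "z ^ (j - i) \<noteq> 1" using ij by (intro assms(3)) auto
    then show "z ^ i \<noteq> z ^ j" using z ij by (auto simp: power_diff)
  qed
  have "(\<lambda>j. z ^ j) ` {..<n} \<subseteq> {w. w ^ n = 1}"
    using assms(2) by (auto simp flip: power_mult simp: mult.commute[of _ n] power_mult)
  moreover have "card ((\<lambda>j. z ^ j) ` {..<n}) = card {w::complex. w ^ n = 1}"
    using card_image[OF inj] card_roots_unity_eq[OF assms(1)] by simp
  ultimately show "(\<lambda>j. z ^ j) ` {..<n} = {w. w ^ n = 1}"
    using finite_roots_unity[of n, where 'a = complex] assms(1) by (intro card_subset_eq) auto
qed

lemma fermat_cusps_eq:
  fixes z e :: complex
  assumes n: "n > 0" and z: "z ^ n = 1" "\<And>k. 0 < k \<Longrightarrow> k < n \<Longrightarrow> z ^ k \<noteq> 1" and e: "e ^ n = - 1"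
  shows "fermat_cusps n = (\<lambda>j. proj_point 0 (z ^ j) 1) ` {..<n} \<union>
           (\<lambda>j. proj_point (z ^ j) 0 1) ` {..<n} \<union> (\<lambda>j. proj_point (e * z ^ j) 1 0) ` {..<n}"
    (is "_ = ?A \<union> ?B \<union> ?C")
proof -
  have root: "\<exists>j<n. w = z ^ j" if "w ^ n = 1" for w
    using roots_unity_powers(2)[OF n z] that by blast
  have zn: "(z ^ j) ^ n = 1" for j
    using z(1) by (metis mult.commute power_mult power_one)
  have z0: "z \<noteq> 0" and e0: "e \<noteq> 0" using n z(1) e by (auto simp: zero_power)
  have mem: "(a, b, c) \<in> proj_point a b c" for a b c
    unfolding proj_point_def by (auto intro!: exI[of _ 1])
  have curveI: "proj_point a b c \<in> fermat_curve n"
    if "(a, b, c) \<noteq> (0, 0, 0)" "a ^ n + b ^ n = c ^ n" for a b c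
    using that unfolding fermat_curve_def by blast
  show ?thesis
  proof (intro equalityI subsetI)
    fix P assume P: "P \<in> fermat_cusps n"
    then obtain a b c where abc: "P = proj_point a b c" "a ^ n + b ^ n = c ^ n"
      by (auto simp: fermat_cusps_def fermat_curve_def)
    have "(a = 0 \<and> b \<noteq> 0 \<and> c \<noteq> 0) \<or> (a \<noteq> 0 \<and> b = 0 \<and> c \<noteq> 0) \<or> (a \<noteq> 0 \<and> b \<noteq> 0 \<and> c = 0)"
      using P mem[of a b c] unfolding fermat_cusps_def mem_Collect_eq abc(1)
      by (elim conjE) (drule (1) bspec, simp only: prod.case)
    then consider "a = 0" "b \<noteq> 0" "c \<noteq> 0" | "a \<noteq> 0" "b = 0" "c \<noteq> 0" | "a \<noteq> 0" "b \<noteq> 0" "c = 0"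
      by blast
    then show "P \<in> ?A \<union> ?B \<union> ?C"
    proof cases
      case 1
      then have "(b / c) ^ n = 1" using abc(2) n by (simp add: power_divide zero_power)
      then obtain j where j: "j < n" "b / c = z ^ j" using root by blast
      have "P = proj_point 0 (z ^ j) 1"
        unfolding abc(1) proj_point_eq_iff using 1 by (intro exI[of _ "1 / c"]) (simp flip: j(2))
      then show ?thesis using j(1) by blast
    next
      case 2
      then have "(a / c) ^ n = 1" using abc(2) n by (simp add: power_divide zero_power)
      then obtain j where j: "j < n" "a / c = z ^ j" using root by blast
      have "P = proj_point (z ^ j) 0 1"
        unfolding abc(1) proj_point_eq_iff using 2 by (intro exI[of _ "1 / c"]) (simp flip: j(2))
      then show ?thesis using j(1) by blast
    next
      case 3
      then have "a ^ n = - (b ^ n)" using abc(2) n by (simp add: zero_power add_eq_0_iff2)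
      then have "(a / b / e) ^ n = 1" using 3 e by (simp add: power_divide power_mult_distrib)
      then obtain j where j: "j < n" "a / b / e = z ^ j" using root by blast
      have "P = proj_point (e * z ^ j) 1 0"
        unfolding abc(1) proj_point_eq_iff using 3 e0
        by (intro exI[of _ "1 / b"]) (simp flip: j(2))
      then show ?thesis using j(1) by blast
    qed
  next
    fix P assume "P \<in> ?A \<union> ?B \<union> ?C"
    then consider j where "P = proj_point 0 (z ^ j) 1" | j where "P = proj_point (z ^ j) 0 1"
      | j where "P = proj_point (e * z ^ j) 1 0" by blast
    then show "P \<in> fermat_cusps n"
    proof cases
      case 1
      have "P \<in> fermat_curve n"
        unfolding 1 by (rule curveI) (use n zn in \<open>simp_all add: zero_power\<close>)
      then show ?thesis using z0 by (auto simp: 1 fermat_cusps_def proj_point_def)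
    next
      case 2
      have "P \<in> fermat_curve n"
        unfolding 2 by (rule curveI) (use n zn in \<open>simp_all add: zero_power\<close>)
      then show ?thesis using z0 by (auto simp: 2 fermat_cusps_def proj_point_def)
    next
      case 3
      have "P \<in> fermat_curve n"
        unfolding 3 by (rule curveI) (use n zn e in \<open>simp_all add: zero_power power_mult_distrib\<close>)
      then show ?thesis using z0 e0 by (auto simp: 3 fermat_cusps_def proj_point_def)
    qed
  qed
qed

end

theory Submission
  imports Defs "HOL-Computational_Algebra.Field_as_Ring"
begin

text \<open>Embed the function field into Laurent series at \<open>(1 : 0 : 1)\<close>; the valuation at a point is
  the order along any local parametrization of the curve there.  A function without poles is
  constant: the terms \<open>f\<^sub>i(x) y\<^sup>i\<close> of \<open>z\<close> are averages of its conjugates under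
  \<open>y \<mapsto> \<zeta> y\<close>, and a term without poles is constant.

  Let \<open>z\<close> have its divisor supported on the cusps, and let \<open>\<sigma>, \<tau>, \<rho>\<close> multiply \<open>x\<close>, \<open>y\<close>,
  both by \<open>\<zeta>\<close>.  They fix the points \<open>a\<^sub>j\<close>, \<open>b\<^sub>j\<close>, \<open>c\<^sub>j\<close>, respectively, and shift the other two
  families, so \<open>(\<sigma> - 1)(\<tau> - 1)(\<rho> - 1)z\<close> (written additively) has trivial divisor and is a
  constant \<open>\<omega>\<close>.  The function \<open>(\<tau> - 1)(\<rho> - 1)z\<close> is thus an eigenfunction of \<open>\<sigma>\<close>, and comparing
  leading coefficients at the fixed points \<open>a\<^sub>j\<close> gives \<open>\<omega> = \<zeta>\<^sup>k\<close> with \<open>k\<close> the second difference of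
  the orders of \<open>z\<close> at the \<open>a\<^sub>j\<close>; likewise for \<open>b\<^sub>j\<close> and \<open>c\<^sub>j\<close>.  So modulo \<open>n\<close> the orders of \<open>z\<close>
  on each family are quadratic in \<open>j\<close> with a common leading coefficient, and an elementary estimate
  of such sequences gives \<open>\<parallel>v\<parallel>\<^sup>2 \<ge> 2n\<close>.  Equality holds for \<open>z = x\<close>.\<close>

section \<open>Evaluation homomorphisms into Laurent series\<close>

text \<open>The base point is totally ramified over the x-line: y is a local parameter there, while
  rational functions of x have order divisible by \<open>n\<close>. Hence 1, y, ..., y^(n-1) are
  independent over the rational functions of x, which identifies the image of the evaluation with
  the function field.

  Comparing a function with its image requires that neither order nor value depends on the
  parametrization.

  The estimate splits on the common leading coefficient modulo \<open>n\<close>. If it is nonzero,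
  no family is small: each contributes at least 11/16 of \<open>n\<close> when \<open>n\<close> is
  at least 7, and 4, 5, 6 are finite checks. For \<open>n = 4\<close> the congruences alone allow
  the total 6, which the vanishing degree of a principal divisor excludes. If it is zero, each
  nonzero family contributes \<open>n\<close>; a lone one has orders constant modulo
  \<open>n\<close>, and degree zero then doubles its bound.\<close>

lemma poly_map_poly_hom:
  fixes h :: "'a::comm_ring_1 \<Rightarrow> 'b::comm_ring_1"
  assumes h: "h 0 = 0" "\<And>a b. h (a + b) = h a + h b" "\<And>a b. h (a * b) = h a * h b"
  shows "poly (map_poly h (p + q)) t = poly (map_poly h p) t + poly (map_poly h q) t"
    and "poly (map_poly h (p * q)) t = poly (map_poly h p) t * poly (map_poly h q) t"
proof -
  have add: "poly (map_poly h (p + q)) t = poly (map_poly h p) t + poly (map_poly h q) t" for p q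
  proof -
    have "map_poly h (p + q) = map_poly h p + map_poly h q"
      by (intro poly_eqI) (simp add: coeff_map_poly h)
    then show ?thesis by simp
  qed
  have smult: "poly (map_poly h (smult c p)) t = h c * poly (map_poly h p) t" for c p
  proof -
    have "map_poly h (smult c p) = smult (h c) (map_poly h p)"
      by (intro poly_eqI) (simp add: coeff_map_poly h)
    then show ?thesis by simp
  qed
  show "poly (map_poly h (p + q)) t = poly (map_poly h p) t + poly (map_poly h q) t"
    by (rule add)
  show "poly (map_poly h (p * q)) t = poly (map_poly h p) t * poly (map_poly h q) t"
  proof (induction p)
    case 0
    then show ?case by simp
  next
    case (pCons a p)
    then show ?case
      by (simp add: mult_pCons_left add smult map_poly_pCons h algebra_simps)
  qed
qed

definition ev_poly :: "complex fls \<Rightarrow> complex poly \<Rightarrow> complex fls" where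
  "ev_poly u p = poly (map_poly fls_const p) u"

lemma ev_poly_hom [simp]:
  "ev_poly u (p + q) = ev_poly u p + ev_poly u q"
  "ev_poly u (p * q) = ev_poly u p * ev_poly u q"
  "ev_poly u 0 = 0" "ev_poly u 1 = 1"
  "ev_poly u [:c:] = fls_const c"
  "ev_poly u (pCons c p) = fls_const c + u * ev_poly u p"
  by (simp_all add: ev_poly_def poly_map_poly_hom fls_plus_const map_poly_pCons)

text \<open>Polynomials split over the complex numbers, so vanishing and order of
  \<open>ev_poly u p\<close> reduce to those of the differences
  \<open>u - fls_const a\<close>.\<close>

lemma ev_poly_factors:
  fixes p :: "complex poly"
  assumes "p \<noteq> 0"
  obtains A where "ev_poly u p = fls_const (lead_coeff p) * (\<Prod>a\<in>#A. u - fls_const a)"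
    "p = smult (lead_coeff p) (\<Prod>a\<in>#A. [:-a, 1:])" "size A = degree p"
proof -
  obtain A where A: "size A = degree p" "p = smult (lead_coeff p) (\<Prod>a\<in>#A. [:-a, 1:])"
    using complex_poly_decompose_multiset size_proots_complex by metis
  have "ev_poly u (\<Prod>a\<in>#A. [:-a, 1:]) = (\<Prod>a\<in>#A. u - fls_const a)"
    by (induction A) (simp_all del: mult_pCons_left)
  moreover have "ev_poly u (smult c q) = fls_const c * ev_poly u q" for c q
    using ev_poly_hom(2)[of u "[:c:]" q] by simp
  ultimately show thesis using that A by metis
qed

definition nonconst :: "complex fls \<Rightarrow> bool" where
  "nonconst u \<longleftrightarrow> (\<forall>c. u \<noteq> fls_const c)"

text \<open>The complex numbers are algebraically closed, so a nonconstant series is transcendental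
  over them. This is what extends evaluation from polynomials to rational functions.\<close>

lemma ev_poly_eq_0_iff:
  assumes "nonconst u"
  shows "ev_poly u p = 0 \<longleftrightarrow> p = 0"
proof (cases "p = 0")
  case False
  then obtain A where "ev_poly u p = fls_const (lead_coeff p) * (\<Prod>a\<in>#A. u - fls_const a)"
    using ev_poly_factors by blast
  moreover have "(\<Prod>a\<in>#A. u - fls_const a) \<noteq> 0"
    using assms by (induction A) (auto simp: nonconst_def)
  ultimately show ?thesis using False by simp
qed simp

definition ev_fract :: "complex fls \<Rightarrow> complex poly fract \<Rightarrow> complex fls" where
  "ev_fract u r = ev_poly u (fst (quot_of_fract r)) / ev_poly u (snd (quot_of_fract r))"

lemma ev_fract_Fract:
  assumes u: "nonconst u" and "q \<noteq> 0"
  shows "ev_fract u (Fract p q) = ev_poly u p / ev_poly u q"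
proof -
  obtain a b where ab: "quot_of_fract (Fract p q) = (a, b)" by fastforce
  have b: "b \<noteq> 0" using snd_quot_of_fract_nonzero[of "Fract p q"] ab by simp
  have "Fract a b = Fract p q" using Fract_quot_of_fract[of "Fract p q"] ab by simp
  then have "a * q = p * b" using b assms(2) by (simp add: eq_fract)
  then have "ev_poly u a * ev_poly u q = ev_poly u p * ev_poly u b"
    by (metis ev_poly_hom(2))
  then show ?thesis
    using b assms by (simp add: ev_fract_def ab ev_poly_eq_0_iff[OF u] field_simps)
qed

lemma ev_fract_hom:
  assumes u: "nonconst u"
  shows "ev_fract u (a + b) = ev_fract u a + ev_fract u b"
    "ev_fract u (a * b) = ev_fract u a * ev_fract u b"
    "ev_fract u 0 = 0" "ev_fract u 1 = 1" "ev_fract u (to_fract p) = ev_poly u p"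
    "ev_fract u a = 0 \<longleftrightarrow> a = 0"
proof -
  obtain p1 q1 where a: "a = Fract p1 q1" "q1 \<noteq> 0" by (cases a) auto
  obtain r s where b: "b = Fract r s" "s \<noteq> 0" by (cases b) auto
  note * = ev_poly_eq_0_iff[OF u]
  show "ev_fract u (a + b) = ev_fract u a + ev_fract u b"
    "ev_fract u (a * b) = ev_fract u a * ev_fract u b"
    using a b * by (simp_all add: ev_fract_Fract[OF u] field_simps)
  show "ev_fract u 0 = 0" "ev_fract u 1 = 1" by (simp_all add: ev_fract_def)
  show "ev_fract u (to_fract p) = ev_poly u p"
    unfolding to_fract_def by (simp add: ev_fract_Fract[OF u])
  show "ev_fract u a = 0 \<longleftrightarrow> a = 0"
    by (simp add: ev_fract_def * )
qed

definition ev :: "complex fls \<Rightarrow> complex fls \<Rightarrow> complex poly fract poly \<Rightarrow> complex fls" where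
  "ev u v p = poly (map_poly (ev_fract u) p) v"

lemma ev_hom:
  assumes u: "nonconst u"
  shows "ev u v (p + q) = ev u v p + ev u v q" "ev u v (p * q) = ev u v p * ev u v q"
    "ev u v (- p) = - ev u v p" "ev u v (p - q) = ev u v p - ev u v q"
    "ev u v 0 = 0" "ev u v 1 = 1" "ev u v [:r:] = ev_fract u r"
    "ev u v x_pol = u" "ev u v y_pol = v" "ev u v (const_pol c) = fls_const c"
    "ev u v (p ^ k) = ev u v p ^ k"
proof -
  note h = ev_fract_hom[OF u]
  show add: "ev u v (p + q) = ev u v p + ev u v q" for p q
    unfolding ev_def by (rule poly_map_poly_hom) (simp_all add: h)
  show mult: "ev u v (p * q) = ev u v p * ev u v q" for p q
    unfolding ev_def by (rule poly_map_poly_hom) (simp_all add: h)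
  show "ev u v 0 = 0" by (simp add: ev_def)
  then show uminus: "ev u v (- p) = - ev u v p" for p
    using add[of p "- p"] by (simp add: eq_neg_iff_add_eq_0 add.commute)
  show "ev u v (p - q) = ev u v p - ev u v q"
    using add[of p "- q"] uminus by simp
  show one: "ev u v 1 = 1" by (simp add: ev_def h)
  show const: "ev u v [:r:] = ev_fract u r" for r
    by (simp add: ev_def map_poly_pCons h)
  show "ev u v x_pol = u" "ev u v (const_pol c) = fls_const c"
    by (simp_all add: x_pol_def const_pol_def const h)
  show "ev u v y_pol = v"
    by (simp add: y_pol_def ev_def map_poly_pCons h)
  show "ev u v (p ^ k) = ev u v p ^ k"
    by (induction k) (simp_all add: one mult)
qed

lemma ev_sum: "nonconst u \<Longrightarrow> ev u v (sum f A) = (\<Sum>a\<in>A. ev u v (f a))"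
  by (induction A rule: infinite_finite_induct) (simp_all add: ev_hom)

lemma ev_form:
  assumes "nonconst u"
  shows "ev u v (form_eval d (\<lambda>i j. const_pol (f i j)) x_pol y_pol 1)
    = form_eval d (\<lambda>i j. fls_const (f i j)) u v 1"
  by (simp add: form_eval_def ev_sum ev_hom assms)

lemma ev_altdef:
  assumes "nonconst u" "degree p < m"
  shows "ev u v p = (\<Sum>i<m. ev_fract u (coeff p i) * v ^ i)"
proof -
  have "ev u v p = (\<Sum>i\<le>degree p. ev_fract u (coeff p i) * v ^ i)"
    using degree_map_poly[of "ev_fract u" p]
    by (simp add: ev_def poly_altdef coeff_map_poly ev_fract_hom[OF assms(1)])
  also have "\<dots> = (\<Sum>i<m. ev_fract u (coeff p i) * v ^ i)"
    using assms(2) by (intro sum.mono_neutral_left)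
      (auto simp: ev_fract_hom[OF assms(1)] coeff_eq_0 not_le)
  finally show ?thesis .
qed

lemma fps_root_exists:
  fixes a :: "complex fps"
  assumes "k > 0" "c ^ k = a $ 0" "a $ 0 \<noteq> 0"
  obtains r where "r ^ k = a" "r $ 0 = c"
proof -
  obtain k' where k: "k = Suc k'" using assms(1) by (cases k) auto
  \<comment> \<open>\<open>fps_radical\<close> expects a function that picks the root of the
    constant term; the constant function forces that root to be \<open>c\<close>.\<close>
  let ?r = "fps_radical (\<lambda>_ _. c) k a"
  have "?r ^ k = a" using power_radical[of a "\<lambda>_ _. c" k'] assms k by simp
  moreover have "?r $ 0 = c" using assms by simp
  ultimately show thesis using that by blast
qed

section \<open>The function field inside the Laurent series at the point (1 : 0 : 1)\<close>

text \<open>The term of least order is unique, so the others cannot cancel its leading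
  coefficient.\<close>

lemma sum_distinct_subdegrees_nonzero:
  fixes g :: "'b \<Rightarrow> 'a::comm_ring_1 fls"
  assumes "finite I" "I \<noteq> {}" "\<And>i. i \<in> I \<Longrightarrow> g i \<noteq> 0"
    and inj: "inj_on (\<lambda>i. fls_subdegree (g i)) I"
  shows "sum g I \<noteq> 0"
proof
  assume 0: "sum g I = 0"
  define m where "m = Min ((\<lambda>i. fls_subdegree (g i)) ` I)"
  have "m \<in> (\<lambda>i. fls_subdegree (g i)) ` I"
    unfolding m_def using assms by (intro Min_in) auto
  then obtain j where j: "j \<in> I" "m = fls_subdegree (g j)" by auto
  have "fls_nth (g i) m = 0" if "i \<in> I - {j}" for i
  proof -
    have "m \<le> fls_subdegree (g i)" unfolding m_def using assms that by (intro Min_le) auto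
    moreover have "fls_subdegree (g i) \<noteq> m" using inj_onD[OF inj, of i j] j that by auto
    ultimately show ?thesis by simp
  qed
  then have "(\<Sum>i\<in>I. fls_nth (g i) m) = fls_nth (g j) m"
    using assms j by (subst sum.remove[of _ j]) auto
  moreover have "(\<Sum>i\<in>I. fls_nth (g i) m) = fls_nth (sum g I) m"
    by (induction I rule: infinite_finite_induct) auto
  ultimately show False using 0 j assms(3)[of j] by auto
qed

section \<open>Values of power series at the origin\<close>

text \<open>Membership in the valuation ring together with the residue. A relation needs no default
  value at a pole and can be carried through an induction over forms.\<close>

definition specializes :: "complex fls \<Rightarrow> complex \<Rightarrow> bool" where
  "specializes u c \<longleftrightarrow> (\<exists>r. u = fps_to_fls r \<and> fps_nth r 0 = c)"

lemma specializes_const [simp]: "specializes (fls_const c) c"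
  unfolding specializes_def by (intro exI[of _ "fps_const c"]) simp

lemma specializes_1 [simp]: "specializes 1 1"
  using specializes_const[of 1] by simp

lemma specializes_add: "specializes u a \<Longrightarrow> specializes v b \<Longrightarrow> specializes (u + v) (a + b)"
  unfolding specializes_def by (metis fps_add_nth fps_to_fls_plus)

lemma specializes_diff: "specializes u a \<Longrightarrow> specializes v b \<Longrightarrow> specializes (u - v) (a - b)"
  unfolding specializes_def by (metis fps_sub_nth fps_to_fls_minus)

lemma specializes_mult: "specializes u a \<Longrightarrow> specializes v b \<Longrightarrow> specializes (u * v) (a * b)"
  unfolding specializes_def by (metis fls_times_fps_to_fls fps_mult_nth_0)

lemma specializes_power: "specializes u a \<Longrightarrow> specializes (u ^ k) (a ^ k)"
  by (induction k) (auto intro: specializes_mult)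

lemma specializes_iff_subdegree: "(\<exists>c. specializes u c) \<longleftrightarrow> fls_subdegree u \<ge> 0"
proof
  assume "fls_subdegree u \<ge> 0"
  then have "u = fps_to_fls (fls_regpart u)" by simp
  then show "\<exists>c. specializes u c" unfolding specializes_def by blast
qed (auto simp: specializes_def fls_subdegree_fls_to_fps_gt0)

lemma specializes_unique: "specializes u a \<Longrightarrow> specializes u b \<Longrightarrow> a = b"
  by (auto simp: specializes_def)

lemma specializes_subdegree_0:
  assumes "specializes u c" "c \<noteq> 0"
  shows "fls_subdegree u = 0" "u \<noteq> 0"
  using assms unfolding specializes_def
  by (auto simp: fls_subdegree_fls_to_fps intro!: subdegree_eq_0)

lemma specializes_0_subdegree: "specializes u 0 \<Longrightarrow> u \<noteq> 0 \<Longrightarrow> fls_subdegree u > 0"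
  by (auto simp: specializes_def fls_subdegree_fls_to_fps subdegree_pos_iff)

lemma specializes_divide:
  assumes "specializes u a" "specializes v b" "b \<noteq> 0"
  shows "specializes (u / v) (a / b)"
proof -
  have v: "fls_subdegree v = 0" "v \<noteq> 0" using specializes_subdegree_0 assms by auto
  have "fls_subdegree (inverse v) \<ge> 0" using v by simp
  then obtain c where c: "specializes (inverse v) c" using specializes_iff_subdegree by blast
  have "specializes (v * inverse v) (b * c)" by (intro specializes_mult assms c)
  then have "b * c = 1" using v specializes_unique[OF specializes_1] by simp
  then have "a / b = a * c" using assms(3) by (simp add: field_simps)
  then show ?thesis using specializes_mult[OF assms(1) c] unfolding divide_inverse[of u] by simp
qed

text \<open>The sum is the cofactor of \<open>u - a\<close> in \<open>u ^ n - a ^ n\<close>; its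
  value is the derivative of the power at \<open>a\<close>. When this is nonzero, the two
  differences have the same order.\<close>

lemma specializes_power_diff_quotient:
  assumes "specializes u a"
  shows "specializes (\<Sum>i<n. fls_const a ^ (n - Suc i) * u ^ i) (of_nat n * a ^ (n - 1))"
proof -
  have "specializes (\<Sum>i<m. fls_const a ^ (n - Suc i) * u ^ i) (\<Sum>i<m. a ^ (n - Suc i) * a ^ i)" for m
  proof (induction m)
    case 0
    show ?case using specializes_const[of 0] by simp
  next
    case (Suc m)
    show ?case unfolding sum.lessThan_Suc
      by (intro specializes_add Suc specializes_mult specializes_power specializes_const assms)
  qed
  moreover have "(\<Sum>i<n. a ^ (n - Suc i) * a ^ i) = (\<Sum>i<n. a ^ (n - 1))"
    by (intro sum.cong refl) (auto simp flip: power_add)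
  ultimately show ?thesis by (metis card_lessThan sum_constant)
qed

text \<open>The product of \<open>u - a\<close> with a unit is \<open>- (fls_X ^ n)\<close>: the map
  x is totally ramified over the \<open>n\<close>-th roots of unity.\<close>

lemma subdegree_minus_const:
  assumes u: "u ^ n = 1 - fls_X ^ n" "specializes u a" and n: "n > 0"
  shows "fls_subdegree (u - fls_const a) = int n" "u - fls_const a \<noteq> 0"
proof -
  define U where "U = (\<Sum>i<n. fls_const a ^ (n - Suc i) * u ^ i)"
  have "specializes fls_X 0" unfolding specializes_def by (intro exI[of _ fps_X]) simp
  then have "specializes (u ^ n + fls_X ^ n) (a ^ n + 0 ^ n)"
    by (intro specializes_add specializes_power u)
  then have a: "a ^ n = 1" using u n specializes_unique[OF specializes_1] by (simp add: zero_power)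
  then have "a \<noteq> 0" using n by (auto simp: zero_power)
  then have U: "fls_subdegree U = 0" "U \<noteq> 0"
    using specializes_subdegree_0[OF specializes_power_diff_quotient[OF u(2), of n]] n
      by (simp_all add: U_def)
  have "(u - fls_const a) * U = - (fls_X ^ n)"
    unfolding U_def power_diff_sumr2[symmetric] using u a by (simp flip: fls_const_power)
  then have *: "fls_subdegree ((u - fls_const a) * U) = int n" "(u - fls_const a) * U \<noteq> 0"
    by simp_all
  then show "u - fls_const a \<noteq> 0" by auto
  then show "fls_subdegree (u - fls_const a) = int n" using * U by simp
qed

lemma nonconst_of_power:
  assumes "u ^ n = 1 - fls_X ^ n" "n > 0"
  shows "nonconst u"
proof -
  have "u \<noteq> fls_const c" for c
  proof
    assume "u = fls_const c"
    then have "fls_X ^ n = fls_const (1 - c ^ n)"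
      using assms by (simp add: fls_const_power algebra_simps flip: fls_minus_const)
    then have "fls_nth (fls_X ^ n :: complex fls) n = fls_nth (fls_const (1 - c ^ n)) n" by simp
    then show False using assms(2) by simp
  qed
  then show ?thesis by (simp add: nonconst_def)
qed

section \<open>Independence of the powers of y over the rational functions of x\<close>

locale fermat =
  fixes n :: nat
  assumes n_pos: "n > 0"
begin

text \<open>In this embedding y becomes \<open>fls_X\<close>, and x becomes the root of
  \<open>1 - fls_X ^ n\<close> with value 1.\<close>

definition base_x :: "complex fls" where
  "base_x = fps_to_fls (SOME r. r ^ n = 1 - fps_X ^ n \<and> r $ 0 = 1)"

text \<open>A point of the affine curve with Laurent series coordinates. Requiring \<open>u\<close>
  to be nonconstant makes all denominators in x nonzero, so such a point is an embedding of the
  function field.\<close>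

definition curve :: "complex fls \<Rightarrow> complex fls \<Rightarrow> bool" where
  "curve u v \<longleftrightarrow> nonconst u \<and> u ^ n + v ^ n = 1"

lemma base_x: "base_x ^ n = 1 - fls_X ^ n" "specializes base_x 1"
proof -
  let ?r = "SOME r::complex fps. r ^ n = 1 - fps_X ^ n \<and> r $ 0 = 1"
  have "\<exists>r::complex fps. r ^ n = 1 - fps_X ^ n \<and> r $ 0 = 1"
    using fps_root_exists[of n 1 "1 - fps_X ^ n"] n_pos by (metis fps_X_power_nth
      diff_zero fps_one_nth fps_sub_nth less_numeral_extra(3) one_neq_zero power_one)
  then have r: "?r ^ n = 1 - fps_X ^ n \<and> ?r $ 0 = 1" by (rule someI_ex)
  show "base_x ^ n = 1 - fls_X ^ n"
    unfolding base_x_def using r by (simp flip: fps_to_fls_power fps_X_to_fls)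
  show "specializes base_x 1" using r by (auto simp: base_x_def specializes_def)
qed

lemma curve_base: "curve base_x fls_X"
  using base_x nonconst_of_power[OF base_x(1) n_pos] by (simp add: curve_def)

lemma nonconst_base: "nonconst base_x"
  using curve_base by (simp add: curve_def)

lemma subdegree_base_x_minus:
  "base_x - fls_const a \<noteq> 0" "int n dvd fls_subdegree (base_x - fls_const a)"
proof -
  show ne: "base_x - fls_const a \<noteq> 0" using nonconst_base by (auto simp: nonconst_def)
  show "int n dvd fls_subdegree (base_x - fls_const a)"
  proof (cases "a = 1")
    case False
    have "specializes (base_x - fls_const a) (1 - a)"
      by (intro specializes_diff base_x specializes_const)
    then show ?thesis using specializes_subdegree_0 False by simp
  next
    case True
    then show ?thesis using subdegree_minus_const[OF base_x n_pos] by simp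
  qed
qed

text \<open>After factoring, only \<open>base_x - 1\<close> contributes, and it has order
  \<open>n\<close>; every other \<open>base_x - fls_const a\<close> is a unit.\<close>

lemma subdegree_ev_fract_base:
  assumes "r \<noteq> 0"
  shows "int n dvd fls_subdegree (ev_fract base_x r)"
proof -
  have *: "int n dvd fls_subdegree (ev_poly base_x p)" if p: "p \<noteq> 0" for p
  proof -
    obtain A where A: "ev_poly base_x p = fls_const (lead_coeff p) * (\<Prod>a\<in>#A. base_x - fls_const a)"
      using ev_poly_factors[OF p, of base_x] by metis
    have "(\<Prod>a\<in>#A. base_x - fls_const a) \<noteq> 0 \<and>
      int n dvd fls_subdegree (\<Prod>a\<in>#A. base_x - fls_const a)"
      by (induction A) (use subdegree_base_x_minus in auto)
    then show ?thesis using p A by simp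
  qed
  obtain p q where r: "r = Fract p q" "q \<noteq> 0" by (cases r) auto
  with assms have p: "p \<noteq> 0" by (auto simp: eq_fract Zero_fract_def)
  have "fls_subdegree (ev_fract base_x r) = fls_subdegree (ev_poly base_x p) - fls_subdegree (ev_poly base_x q)"
    unfolding r ev_fract_Fract[OF nonconst_base r(2)]
    by (rule fls_divide_subdegree) (use p r in \<open>simp_all add: ev_poly_eq_0_iff nonconst_base\<close>)
  then show ?thesis using *[OF p] *[OF r(2)] by simp
qed

text \<open>The nonzero terms have orders that are pairwise distinct modulo \<open>n\<close>, since
  the factor in x contributes a multiple of \<open>n\<close> and the power of y contributes
  \<open>i\<close>. So y has degree \<open>n\<close> over the rational functions of x, with minimal
  polynomial \<open>M\<close>.\<close>

lemma powers_independent: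
  assumes "(\<Sum>i<n. ev_fract base_x (f i) * fls_X ^ i) = 0" "i < n"
  shows "f i = 0"
proof (rule ccontr)
  assume "f i \<noteq> 0"
  define I where "I = {j. j < n \<and> f j \<noteq> 0}"
  have I: "finite I" "I \<noteq> {}" using assms \<open>f i \<noteq> 0\<close> by (auto simp: I_def)
  let ?g = "\<lambda>j. ev_fract base_x (f j) * fls_X ^ j"
  have nz: "ev_fract base_x (f j) \<noteq> 0" if "j \<in> I" for j
    using that by (simp add: I_def ev_fract_hom[OF nonconst_base])
  have sub: "fls_subdegree (?g j) = fls_subdegree (ev_fract base_x (f j)) + int j" if "j \<in> I" for j
    using nz[OF that] by simp
  have "inj_on (\<lambda>j. fls_subdegree (?g j)) I"
  proof (rule inj_onI)
    fix j k assume jk: "j \<in> I" "k \<in> I" "fls_subdegree (?g j) = fls_subdegree (?g k)"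
    have "int n dvd fls_subdegree (ev_fract base_x (f j)) - fls_subdegree (ev_fract base_x (f k))"
      using jk by (intro dvd_diff subdegree_ev_fract_base) (auto simp: I_def)
    moreover have "fls_subdegree (ev_fract base_x (f j)) - fls_subdegree (ev_fract base_x (f k))
        = int k - int j"
      using jk(3) unfolding sub[OF jk(1)] sub[OF jk(2)] by linarith
    ultimately have "int n dvd int k - int j" by simp
    moreover have "\<bar>int k - int j\<bar> < int n" using jk by (auto simp: I_def)
    ultimately show "j = k" using zdvd_imp_le[of "int n" "\<bar>int k - int j\<bar>"] by fastforce
  qed
  then have "sum ?g I \<noteq> 0"
    using I nz by (intro sum_distinct_subdegrees_nonzero) auto
  moreover have "sum ?g I = sum ?g {..<n}"
    by (rule sum.mono_neutral_left) (auto simp: I_def ev_fract_hom[OF nonconst_base])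
  ultimately show False using assms by simp
qed

definition M :: "complex poly fract poly" where
  "M = x_pol ^ n + y_pol ^ n - 1"

lemma degree_M: "degree M = n"
proof -
  have "x_pol ^ n = [:(to_fract [:0, 1:]) ^ n:]"
    by (simp add: x_pol_def poly_const_pow)
  moreover have "y_pol ^ n = monom 1 n"
    by (simp add: y_pol_def monom_altdef)
  ultimately have "M = monom 1 n + [:(to_fract [:0, 1:]) ^ n - 1:]"
    by (simp add: M_def one_pCons algebra_simps)
  then show ?thesis using n_pos by (simp add: degree_add_eq_left degree_monom_eq)
qed

lemma ev_M: "curve u v \<Longrightarrow> ev u v M = 0"
  by (simp add: M_def curve_def ev_hom)

abbreviation "base_ev \<equiv> ev base_x fls_X"

lemma base_ev_small_eq_0:
  assumes "base_ev p = 0" "degree p < n"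
  shows "p = 0"
proof (rule poly_eqI)
  fix i
  show "coeff p i = coeff 0 i"
  proof (cases "i < n")
    case True
    have "(\<Sum>i<n. ev_fract base_x (coeff p i) * fls_X ^ i) = 0"
      using assms ev_altdef[OF nonconst_base assms(2)] by simp
    then show ?thesis using powers_independent True by simp
  qed (use assms(2) in \<open>simp add: coeff_eq_0\<close>)
qed

lemma M_nonzero: "M \<noteq> 0"
  using degree_M n_pos by auto

lemma degree_mod_M: "degree (p mod M) < n"
  using degree_mod_less[OF M_nonzero, of p] degree_M n_pos by auto

lemma base_ev_mod_M: "base_ev (p mod M) = base_ev p"
proof -
  have "base_ev (p div M * M + p mod M) = base_ev (p mod M)"
    unfolding ev_hom[OF nonconst_base] ev_M[OF curve_base] by simp
  then show ?thesis by (metis div_mult_mod_eq)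
qed

text \<open>Division by \<open>M\<close> reduces to degree below \<open>n\<close>, where
  independence applies. The kernel is therefore the ideal that defines the function field.\<close>

lemma base_ev_eq_0_iff: "base_ev p = 0 \<longleftrightarrow> M dvd p"
proof
  assume "base_ev p = 0"
  then have "p mod M = 0"
    using base_ev_small_eq_0[OF _ degree_mod_M] base_ev_mod_M by simp
  then show "M dvd p" by (simp add: dvd_eq_mod_eq_0)
next
  assume "M dvd p"
  then obtain q where "p = M * q" ..
  then show "base_ev p = 0" by (simp add: ev_hom nonconst_base ev_M[OF curve_base])
qed

text \<open>Euclidean descent on the degree: the remainder of \<open>M\<close> modulo
  \<open>p\<close> takes the value of a multiple of \<open>p\<close>, so an inverse of its value
  yields one for \<open>p\<close>. It is nonzero, as otherwise the cofactor of \<open>p\<close> in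
  \<open>M\<close> would be a nonzero kernel element of degree below \<open>n\<close>.\<close>

lemma base_ev_unit: "base_ev p \<noteq> 0 \<Longrightarrow> \<exists>q. base_ev p * base_ev q = 1"
proof -
  note hom = ev_hom[OF nonconst_base]
  have "\<exists>q. base_ev p * base_ev q = 1" if "base_ev p \<noteq> 0" "degree p < n" for p
    using that
  proof (induction "degree p" arbitrary: p rule: less_induct)
    case less
    have p0: "p \<noteq> 0" using less(2) hom by auto
    show ?case
    proof (cases "degree p = 0")
      case True
      then obtain c where c: "p = [:c:]" by (rule degree_eq_zeroE)
      with p0 have "c \<noteq> 0" by simp
      then have "p * [:inverse c:] = 1" by (simp add: c one_pCons)
      then show ?thesis by (metis hom(2,6))
    next
      case False
      define r where "r = M mod p"
      define s where "s = M div p"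
      have M: "M = s * p + r" by (simp add: r_def s_def)
      have eq: "base_ev r = - base_ev s * base_ev p"
        using ev_M[OF curve_base] unfolding M by (simp add: hom eq_neg_iff_add_eq_0 add.commute)
      have "r \<noteq> 0"
      proof
        assume r: "r = 0"
        then have M': "M = s * p" using M by simp
        then have s0: "s \<noteq> 0" using M_nonzero by auto
        then have "n = degree s + degree p" using degree_M M' p0 by (metis degree_mult_eq)
        then have "degree s < n" using False by simp
        moreover have "base_ev s = 0" using eq r less(2) by (simp add: hom)
        ultimately show False using base_ev_small_eq_0 s0 by blast
      qed
      then have deg: "degree r < degree p"
        using degree_mod_less[OF p0, of M] by (auto simp: r_def)
      then have "base_ev r \<noteq> 0" using base_ev_small_eq_0 \<open>r \<noteq> 0\<close> less(3) by auto
      then obtain q where "base_ev r * base_ev q = 1" using less(1)[OF deg] deg less(3) by auto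
      then have "base_ev p * base_ev (- s * q) = 1" using eq by (simp add: hom algebra_simps)
      then show ?thesis by blast
    qed
  qed
  then show "base_ev p \<noteq> 0 \<Longrightarrow> \<exists>q. base_ev p * base_ev q = 1"
    using base_ev_mod_M degree_mod_M by metis
qed

section \<open>The function field as a subfield of the Laurent series\<close>

definition K :: "complex fls set" where
  "K = range base_ev"

lemma K_closed [simp, intro]:
  shows "base_ev p \<in> K" "0 \<in> K" "1 \<in> K" "fls_const c \<in> K" "base_x \<in> K" "fls_X \<in> K"
    "z \<in> K \<Longrightarrow> w \<in> K \<Longrightarrow> z + w \<in> K" "z \<in> K \<Longrightarrow> w \<in> K \<Longrightarrow> z * w \<in> K"
    "z \<in> K \<Longrightarrow> w \<in> K \<Longrightarrow> z - w \<in> K" "z \<in> K \<Longrightarrow> - z \<in> K"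
    "z \<in> K \<Longrightarrow> inverse z \<in> K" "z \<in> K \<Longrightarrow> w \<in> K \<Longrightarrow> z / w \<in> K" "z \<in> K \<Longrightarrow> z ^ k \<in> K"
proof -
  note hom = ev_hom[OF nonconst_base, of fls_X, symmetric]
  show "base_ev p \<in> K" for p by (simp add: K_def)
  show "0 \<in> K" "1 \<in> K" "fls_const c \<in> K" "base_x \<in> K" "fls_X \<in> K"
    unfolding K_def by (metis hom(5) rangeI, metis hom(6) rangeI, metis hom(10) rangeI,
      metis hom(8) rangeI, metis hom(9) rangeI)
  show mult: "z \<in> K \<Longrightarrow> w \<in> K \<Longrightarrow> z * w \<in> K" for z w
    by (auto simp: K_def hom(2))
  show "z \<in> K \<Longrightarrow> w \<in> K \<Longrightarrow> z + w \<in> K" "z \<in> K \<Longrightarrow> w \<in> K \<Longrightarrow> z - w \<in> K" "z \<in> K \<Longrightarrow> - z \<in> K"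
    "z \<in> K \<Longrightarrow> z ^ k \<in> K"
    by (auto simp: K_def hom(1,3,4,11))
  show inv: "z \<in> K \<Longrightarrow> inverse z \<in> K" for z
  proof (cases "z = 0")
    case False
    assume "z \<in> K"
    then obtain p where p: "z = base_ev p" by (auto simp: K_def)
    then obtain q where "z * base_ev q = 1" using base_ev_unit False by auto
    then have "inverse z = base_ev q" by (rule inverse_unique)
    then show ?thesis by (simp add: K_def)
  qed (simp add: \<open>0 \<in> K\<close>)
  show "z \<in> K \<Longrightarrow> w \<in> K \<Longrightarrow> z / w \<in> K"
    using mult[OF _ inv] by (simp add: divide_inverse)
qed

lemma K_sum [intro]: "(\<And>i. i \<in> I \<Longrightarrow> f i \<in> K) \<Longrightarrow> sum f I \<in> K"
  by (induction I rule: infinite_finite_induct) auto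

text \<open>The embedding that sends x to \<open>u\<close> and y to \<open>v\<close>. The choice of
  \<open>p\<close> is immaterial on the curve: two choices differ by a multiple of \<open>M\<close>,
  which vanishes at \<open>(u, v)\<close>.\<close>

definition ext :: "complex fls \<Rightarrow> complex fls \<Rightarrow> complex fls \<Rightarrow> complex fls" where
  "ext u v z = ev u v (SOME p. base_ev p = z)"

lemma ext_base_ev:
  assumes "curve u v"
  shows "ext u v (base_ev p) = ev u v p"
proof -
  have u: "nonconst u" using assms by (simp add: curve_def)
  define q where "q = (SOME q. base_ev q = base_ev p)"
  have "base_ev q = base_ev p" unfolding q_def by (rule someI[of _ p]) simp
  then have "base_ev (q - p) = 0" by (simp add: ev_hom nonconst_base)
  then have "M dvd q - p" by (simp add: base_ev_eq_0_iff)
  then obtain s where "q - p = M * s" ..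
  then have "ev u v (q - p) = 0" using ev_M[OF assms] by (simp add: ev_hom[OF u])
  then show ?thesis by (simp add: ext_def q_def ev_hom[OF u])
qed

lemma ext_hom:
  assumes c: "curve u v"
  shows "z \<in> K \<Longrightarrow> w \<in> K \<Longrightarrow> ext u v (z + w) = ext u v z + ext u v w"
    "z \<in> K \<Longrightarrow> w \<in> K \<Longrightarrow> ext u v (z * w) = ext u v z * ext u v w"
    "z \<in> K \<Longrightarrow> w \<in> K \<Longrightarrow> ext u v (z - w) = ext u v z - ext u v w"
    "z \<in> K \<Longrightarrow> ext u v (- z) = - ext u v z"
    "ext u v 0 = 0" "ext u v 1 = 1" "ext u v (fls_const a) = fls_const a"
    "ext u v base_x = u" "ext u v fls_X = v"
    "z \<in> K \<Longrightarrow> ext u v z = 0 \<longleftrightarrow> z = 0"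
    "z \<in> K \<Longrightarrow> ext u v (inverse z) = inverse (ext u v z)"
    "z \<in> K \<Longrightarrow> w \<in> K \<Longrightarrow> ext u v (z / w) = ext u v z / ext u v w"
    "z \<in> K \<Longrightarrow> ext u v (z ^ k) = ext u v z ^ k"
    "ext u v (ev_fract base_x r) = ev_fract u r"
proof -
  have u: "nonconst u" using c by (simp add: curve_def)
  note hom = ev_hom[OF nonconst_base, of fls_X, symmetric]
  show "z \<in> K \<Longrightarrow> w \<in> K \<Longrightarrow> ext u v (z + w) = ext u v z + ext u v w"
    "z \<in> K \<Longrightarrow> w \<in> K \<Longrightarrow> ext u v (z - w) = ext u v z - ext u v w"
    "z \<in> K \<Longrightarrow> ext u v (- z) = - ext u v z"
    "z \<in> K \<Longrightarrow> ext u v (z ^ k) = ext u v z ^ k"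
    by (auto simp: K_def hom(1,3,4,11) ext_base_ev[OF c] ev_hom[OF u] simp del: ev_hom)
  show mult: "z \<in> K \<Longrightarrow> w \<in> K \<Longrightarrow> ext u v (z * w) = ext u v z * ext u v w" for z w
    by (auto simp: K_def hom(2) ext_base_ev[OF c] ev_hom[OF u])
  show zero: "ext u v 0 = 0" and one: "ext u v 1 = 1" and "ext u v (fls_const a) = fls_const a"
    "ext u v base_x = u" "ext u v fls_X = v" "ext u v (ev_fract base_x r) = ev_fract u r"
    using ext_base_ev[OF c, of 0] ext_base_ev[OF c, of 1] ext_base_ev[OF c, of "const_pol a"]
      ext_base_ev[OF c, of x_pol] ext_base_ev[OF c, of y_pol] ext_base_ev[OF c, of "[:r:]"]
    by (simp_all add: ev_hom[OF u] ev_hom[OF nonconst_base])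
  have inv: "ext u v z * ext u v (inverse z) = 1" if "z \<in> K" "z \<noteq> 0" for z
    using mult[of z "inverse z"] that one by simp
  show eq0: "ext u v z = 0 \<longleftrightarrow> z = 0" if "z \<in> K" for z
    using inv[OF that] zero by (cases "z = 0") auto
  show inverse: "ext u v (inverse z) = inverse (ext u v z)" if "z \<in> K" for z
    using inv[OF that] eq0[OF that] zero by (cases "z = 0") (auto simp: inverse_unique)
  show "z \<in> K \<Longrightarrow> w \<in> K \<Longrightarrow> ext u v (z / w) = ext u v z / ext u v w"
    by (simp add: divide_inverse mult inverse)
qed

lemma ext_sum:
  "curve u v \<Longrightarrow> (\<And>i. i \<in> I \<Longrightarrow> f i \<in> K) \<Longrightarrow> ext u v (sum f I) = (\<Sum>i\<in>I. ext u v (f i))"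
  by (induction I rule: infinite_finite_induct) (simp_all add: ext_hom K_sum)

end

section \<open>Local rings\<close>

text \<open>Forms are kept as functions instead of coefficient arrays, so that sums and products are
  pointwise and no convolution of coefficients has to be written down.\<close>

definition forms :: "nat \<Rightarrow> (complex fls \<Rightarrow> complex fls \<Rightarrow> complex fls \<Rightarrow> complex fls) set" where
  "forms d = {\<lambda>A B C. form_eval d (\<lambda>i j. fls_const (f i j)) A B C | f. True}"

lemma forms_add:
  assumes "F \<in> forms d" "G \<in> forms d"
  shows "(\<lambda>A B C. F A B C + G A B C) \<in> forms d"
proof -
  obtain f g where "F = (\<lambda>A B C. form_eval d (\<lambda>i j. fls_const (f i j)) A B C)"
    "G = (\<lambda>A B C. form_eval d (\<lambda>i j. fls_const (g i j)) A B C)"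
    using assms by (auto simp: forms_def)
  then have "(\<lambda>A B C. F A B C + G A B C)
      = (\<lambda>A B C. form_eval d (\<lambda>i j. fls_const (f i j + g i j)) A B C)"
    by (simp add: form_eval_def sum.distrib distrib_right flip: fls_plus_const)
  then show ?thesis unfolding forms_def by auto
qed

lemma forms_0: "(\<lambda>A B C. 0) \<in> forms d"
  unfolding forms_def by (auto intro!: exI[of _ "\<lambda>i j. 0"] simp: form_eval_def fun_eq_iff)

lemma forms_sum:
  "(\<And>i. i \<in> I \<Longrightarrow> F i \<in> forms d) \<Longrightarrow> (\<lambda>A B C. \<Sum>i\<in>I. F i A B C) \<in> forms d"
  by (induction I rule: infinite_finite_induct) (simp_all add: forms_0 forms_add)

lemma forms_monomial:
  assumes "i + j \<le> d"
  shows "(\<lambda>A B C. fls_const k * A ^ i * B ^ j * C ^ (d - i - j)) \<in> forms d"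
proof -
  let ?f = "\<lambda>i' j'. if i' = i \<and> j' = j then k else 0"
  have "form_eval d (\<lambda>i' j'. fls_const (?f i' j')) A B C
      = fls_const k * A ^ i * B ^ j * C ^ (d - i - j)" for A B C
  proof -
    let ?m = "fls_const k * A ^ i * B ^ j * C ^ (d - i - j)"
    have "fls_const (?f i' j') * A ^ i' * B ^ j' * C ^ (d - i' - j')
      = (if i' = i then if j' = j then ?m else 0 else 0)" for i' j' by simp
    then have "form_eval d (\<lambda>i' j'. fls_const (?f i' j')) A B C
      = (\<Sum>i'\<le>d. \<Sum>j'\<le>d - i'. if i' = i then if j' = j then ?m else 0 else 0)"
      by (simp only: form_eval_def)
    also have "\<dots> = (\<Sum>i'\<le>d. if i' = i then (\<Sum>j'\<le>d - i. if j' = j then ?m else 0) else 0)"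
      by (intro sum.cong refl) (auto intro: sum.neutral)
    also have "\<dots> = ?m" using assms by simp
    finally show ?thesis .
  qed
  then show ?thesis unfolding forms_def by (intro CollectI exI[of _ ?f]) (simp add: fun_eq_iff)
qed

lemma forms_mult:
  assumes "F \<in> forms d" "G \<in> forms e"
  shows "(\<lambda>A B C. F A B C * G A B C) \<in> forms (d + e)"
proof -
  obtain f g where FG: "F = (\<lambda>A B C. form_eval d (\<lambda>i j. fls_const (f i j)) A B C)"
    "G = (\<lambda>A B C. form_eval e (\<lambda>i j. fls_const (g i j)) A B C)"
    using assms by (auto simp: forms_def)
  have *: "(\<lambda>A B C. fls_const (f i j) * A ^ i * B ^ j * C ^ (d - i - j) *
      (fls_const (g k l) * A ^ k * B ^ l * C ^ (e - k - l))) \<in> forms (d + e)"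
    if "i \<le> d" "j \<le> d - i" "k \<le> e" "l \<le> e - k" for i j k l
  proof -
    have eq: "d + e - (i + k) - (j + l) = (d - i - j) + (e - k - l)" using that by simp
    have "(i + k) + (j + l) \<le> d + e" using that by simp
    from forms_monomial[OF this, of "f i j * g k l"] show ?thesis
      unfolding eq by (simp add: power_add mult_ac flip: fls_const_mult_const)
  qed
  show ?thesis
    unfolding FG form_eval_def sum_product sum_distrib_left sum_distrib_right
    by (intro forms_sum * ) auto
qed

lemma forms_linear:
  "(\<lambda>A B C. A) \<in> forms 1" "(\<lambda>A B C. B) \<in> forms 1" "(\<lambda>A B C. C) \<in> forms 1"
  using forms_monomial[of 1 0 1 1] forms_monomial[of 0 1 1 1] forms_monomial[of 0 0 1 1] by simp_all

lemma forms_const: "(\<lambda>A B C. fls_const k) \<in> forms 0"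
  using forms_monomial[of 0 0 0 k] by simp

lemma form_eval_homogeneous:
  "form_eval d f (l * a) (l * b) (l * c) = l ^ d * form_eval d f a b c"
proof -
  have "f i j * (l * a) ^ i * (l * b) ^ j * (l * c) ^ (d - i - j)
      = l ^ d * (f i j * a ^ i * b ^ j * c ^ (d - i - j))" if "i \<le> d" "j \<le> d - i" for i j
  proof -
    have "l ^ d = l ^ i * l ^ j * l ^ (d - i - j)"
      using that by (simp flip: power_add)
    then show ?thesis by (simp only: power_mult_distrib mult_ac)
  qed
  then show ?thesis
    unfolding form_eval_def sum_distrib_left by (intro sum.cong) auto
qed

lemma forms_homogeneous:
  "F \<in> forms d \<Longrightarrow> F (l * A) (l * B) (l * C) = l ^ d * F A B C"
  by (auto simp: forms_def form_eval_homogeneous)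

text \<open>A member of \<open>forms d\<close> carries no coefficients, so its value at a complex
  point is read off from constant series.\<close>

definition form_val ::
    "(complex fls \<Rightarrow> complex fls \<Rightarrow> complex fls \<Rightarrow> complex fls) \<Rightarrow> complex \<Rightarrow> complex \<Rightarrow> complex \<Rightarrow> complex" where
  "form_val F a b c = fls_nth (F (fls_const a) (fls_const b) (fls_const c)) 0"

text \<open>A form is built from constants and its arguments by sums and products, so any relation
  between series and numbers that respects these is inherited. Later instances of \<open>R\<close>
  are equality with a constant, specialization, membership in \<open>K\<close>, and congruence
  modulo a local parameter.\<close>

lemma form_eval_induct:
  fixes R :: "complex fls \<Rightarrow> complex \<Rightarrow> bool"
  assumes const: "\<And>k. R (fls_const k) k"
    and add: "\<And>u v a b. R u a \<Longrightarrow> R v b \<Longrightarrow> R (u + v) (a + b)"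
    and mult: "\<And>u v a b. R u a \<Longrightarrow> R v b \<Longrightarrow> R (u * v) (a * b)"
    and "R A a" "R B b" "R C c"
  shows "R (form_eval d (\<lambda>i j. fls_const (f i j)) A B C) (form_eval d f a b c)"
proof -
  have sum: "R (sum f' I) (sum g' I)" if "\<And>i. i \<in> I \<Longrightarrow> R (f' i) (g' i)"
    for f' :: "nat \<Rightarrow> complex fls" and g' I
    using that by (induction I rule: infinite_finite_induct) (use const[of 0] add in auto)
  have power: "R (u ^ k) (a ^ k)" if "R u a" for u a k
    by (induction k) (use that const[of 1] mult in auto)
  show ?thesis unfolding form_eval_def by (intro sum mult power const assms)
qed

lemma form_val_form_eval:
  "form_val (\<lambda>A B C. form_eval d (\<lambda>i j. fls_const (f i j)) A B C) a b c = form_eval d f a b c"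
  using form_eval_induct[of "\<lambda>u k. u = fls_const k" "fls_const a" a "fls_const b" b "fls_const c" c d f]
  by (simp add: form_val_def fls_plus_const)

lemma form_induct:
  fixes R :: "complex fls \<Rightarrow> complex \<Rightarrow> bool"
  assumes "F \<in> forms d"
    and "\<And>k. R (fls_const k) k"
    and "\<And>u v a b. R u a \<Longrightarrow> R v b \<Longrightarrow> R (u + v) (a + b)"
    and "\<And>u v a b. R u a \<Longrightarrow> R v b \<Longrightarrow> R (u * v) (a * b)"
    and "R A a" "R B b" "R C c"
  shows "R (F A B C) (form_val F a b c)"
proof -
  obtain f where F: "F = (\<lambda>A B C. form_eval d (\<lambda>i j. fls_const (f i j)) A B C)"
    using assms(1) by (auto simp: forms_def)
  show ?thesis unfolding F form_val_form_eval by (rule form_eval_induct) (fact assms)+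
qed

lemma form_const_eq:
  assumes "F \<in> forms d"
  shows "F (fls_const a) (fls_const b) (fls_const c) = fls_const (form_val F a b c)"
  by (rule form_induct[OF assms, where R = "\<lambda>u k. u = fls_const k"]) (simp_all add: fls_plus_const)

lemma form_val_homogeneous:
  assumes "F \<in> forms d"
  shows "form_val F (l * a) (l * b) (l * c) = l ^ d * form_val F a b c"
proof -
  obtain f where F: "F = (\<lambda>A B C. form_eval d (\<lambda>i j. fls_const (f i j)) A B C)"
    using assms(1) by (auto simp: forms_def)
  show ?thesis unfolding F form_val_form_eval by (rule form_eval_homogeneous)
qed

lemma form_val_add_mult:
  assumes "F \<in> forms d" "G \<in> forms e"
  shows "form_val (\<lambda>A B C. F A B C + G A B C) a b c = form_val F a b c + form_val G a b c"
    "form_val (\<lambda>A B C. F A B C * G A B C) a b c = form_val F a b c * form_val G a b c"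
  unfolding form_val_def[of "\<lambda>A B C. F A B C + G A B C"] form_val_def[of "\<lambda>A B C. F A B C * G A B C"]
    form_const_eq[OF assms(1)] form_const_eq[OF assms(2)] by simp_all

lemma specializes_form:
  assumes "F \<in> forms d" "specializes A a" "specializes B b" "specializes C c"
  shows "specializes (F A B C) (form_val F a b c)"
  using assms by (intro form_induct[where R = specializes]) (auto intro: specializes_add specializes_mult)

context fermat begin

lemma forms_K: "F \<in> forms d \<Longrightarrow> A \<in> K \<Longrightarrow> B \<in> K \<Longrightarrow> C \<in> K \<Longrightarrow> F A B C \<in> K"
  by (rule form_induct[where R = "\<lambda>u _. u \<in> K"]) auto

lemma ext_form:
  assumes "curve u v" "F \<in> forms d" "A \<in> K" "B \<in> K" "C \<in> K"
  shows "ext u v (F A B C) = F (ext u v A) (ext u v B) (ext u v C)"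
proof -
  obtain f where F: "F = (\<lambda>A B C. form_eval d (\<lambda>i j. fls_const (f i j)) A B C)"
    using assms by (auto simp: forms_def)
  show ?thesis
    using assms unfolding F form_eval_def by (simp add: ext_sum ext_hom K_sum)
qed

section \<open>Functions defined at a point and their values\<close>

definition lring :: "complex \<Rightarrow> complex \<Rightarrow> complex \<Rightarrow> complex fls set" where
  "lring a b c = {z \<in> K. \<exists>d. \<exists>F\<in>forms d. \<exists>G\<in>forms d.
     form_val G a b c \<noteq> 0 \<and> z * G base_x fls_X 1 = F base_x fls_X 1}"

text \<open>A branch of the curve at \<open>(a : b : c)\<close> is a point \<open>(u, v)\<close> of the affine curve with coordinates
  in the Laurent series field that specializes to \<open>(a : b : c)\<close>; the scaling by \<open>l\<close> clears the poles.\<close>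

definition branch :: "complex \<Rightarrow> complex \<Rightarrow> complex \<Rightarrow> complex fls \<Rightarrow> complex fls \<Rightarrow> bool" where
  "branch a b c u v \<longleftrightarrow> curve u v \<and> (\<exists>l. specializes (l * u) a \<and> specializes (l * v) b \<and> specializes l c)"

text \<open>This excludes branches such as those obtained by substituting the square of the
  variable, along which all orders are multiplied. Only then is the order the normalized
  valuation.\<close>

definition uniformizing :: "complex fls \<Rightarrow> complex fls \<Rightarrow> bool" where
  "uniformizing u v \<longleftrightarrow> (\<exists>z\<in>K. fls_subdegree (ext u v z) = 1)"

lemma lring_K: "z \<in> lring a b c \<Longrightarrow> z \<in> K"
  by (simp add: lring_def)

lemma lringI:
  assumes "z \<in> K" "F \<in> forms d" "G \<in> forms d" "form_val G a b c \<noteq> 0"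
    "z * G base_x fls_X 1 = F base_x fls_X 1"
  shows "z \<in> lring a b c"
  using assms unfolding lring_def by blast

text \<open>Numerator and denominator have the same degree, so the scaling that clears the poles of
  the branch cancels in the quotient.\<close>

lemma lring_branch_spec:
  assumes br: "branch a b c u v" and F: "F \<in> forms d" and G: "G \<in> forms d"
    and G0: "form_val G a b c \<noteq> 0" and z: "z \<in> K" "z * G base_x fls_X 1 = F base_x fls_X 1"
  shows "specializes (ext u v z) (form_val F a b c / form_val G a b c)"
proof -
  have cu: "curve u v" using br by (simp add: branch_def)
  obtain l where l: "specializes (l * u) a" "specializes (l * v) b" "specializes (l * 1) c"
    using br by (auto simp: branch_def)
  note sF = specializes_form[OF F l, unfolded forms_homogeneous[OF F]]
  note sG = specializes_form[OF G l, unfolded forms_homogeneous[OF G]]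
  have "ext u v (z * G base_x fls_X 1) = ext u v (F base_x fls_X 1)" using z by simp
  then have "ext u v z * G u v 1 = F u v 1"
    using ext_form[OF cu F] ext_form[OF cu G] forms_K[OF G] z(1) by (simp add: ext_hom[OF cu])
  then have "ext u v z * (l ^ d * G u v 1) = l ^ d * F u v 1" by simp
  then have "ext u v z = l ^ d * F u v 1 / (l ^ d * G u v 1)"
    by (simp only: nonzero_eq_divide_eq[OF specializes_subdegree_0(2)[OF sG G0]])
  then show ?thesis using specializes_divide[OF sF sG G0] by simp
qed

text \<open>The order of the quantifiers matters: the value belongs to the point and is shared by
  all branches there. The eigenvalue argument compares two branches through it.\<close>

lemma lring_spec:
  assumes "z \<in> lring a b c"
  shows "\<exists>e. \<forall>u v. branch a b c u v \<longrightarrow> specializes (ext u v z) e"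
  using assms lring_branch_spec unfolding lring_def by blast

lemma lring_inverse:
  assumes z: "z \<in> lring a b c" and br: "branch a b c u v" "specializes (ext u v z) e" "e \<noteq> 0"
  shows "inverse z \<in> lring a b c"
proof -
  obtain d F G where FG: "F \<in> forms d" "G \<in> forms d" "form_val G a b c \<noteq> 0" "z \<in> K"
    "z * G base_x fls_X 1 = F base_x fls_X 1" using z unfolding lring_def by blast
  have "specializes (ext u v z) (form_val F a b c / form_val G a b c)"
    by (rule lring_branch_spec) (fact br FG)+
  then have F0: "form_val F a b c \<noteq> 0" using specializes_unique br by fastforce
  have cu: "curve u v" using br by (simp add: branch_def)
  have "z \<noteq> 0" using specializes_subdegree_0(2) br(2,3) ext_hom(5)[OF cu] by metis
  then have "inverse z * F base_x fls_X 1 = G base_x fls_X 1"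
    using FG(5) by (simp add: field_simps)
  then show ?thesis by (intro lringI[OF _ FG(2,1) F0]) (use FG(4) in auto)
qed

lemma lring_add_mult:
  assumes "z \<in> lring a b c" "w \<in> lring a b c"
  shows "z + w \<in> lring a b c" "z * w \<in> lring a b c"
proof -
  obtain d F G where FG: "F \<in> forms d" "G \<in> forms d" "form_val G a b c \<noteq> 0" "z \<in> K"
    "z * G base_x fls_X 1 = F base_x fls_X 1" using assms(1) unfolding lring_def by blast
  obtain d' F' G' where FG': "F' \<in> forms d'" "G' \<in> forms d'" "form_val G' a b c \<noteq> 0" "w \<in> K"
    "w * G' base_x fls_X 1 = F' base_x fls_X 1" using assms(2) unfolding lring_def by blast
  let ?G = "\<lambda>A B C. G A B C * G' A B C"
  have G: "?G \<in> forms (d + d')" "form_val ?G a b c \<noteq> 0"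
    using FG FG' forms_mult form_val_add_mult(2) by auto
  have F: "(\<lambda>A B C. F A B C * F' A B C) \<in> forms (d + d')" using FG FG' forms_mult by auto
  have "(\<lambda>A B C. F' A B C * G A B C) \<in> forms (d + d')"
    using forms_mult[of F' d' G d] FG FG' by (simp add: add.commute)
  then have H: "(\<lambda>A B C. F A B C * G' A B C + F' A B C * G A B C) \<in> forms (d + d')"
    using FG FG' forms_mult by (intro forms_add) auto
  have "z * w * (?G base_x fls_X 1) = F base_x fls_X 1 * F' base_x fls_X 1"
    unfolding FG(5)[symmetric] FG'(5)[symmetric] by (simp add: mult_ac)
  then show "z * w \<in> lring a b c"
    by (intro lringI[OF _ F G]) (use FG(4) FG'(4) in auto)
  have "(z + w) * (?G base_x fls_X 1) = F base_x fls_X 1 * G' base_x fls_X 1 + F' base_x fls_X 1 * G base_x fls_X 1"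
    unfolding FG(5)[symmetric] FG'(5)[symmetric] by (simp add: algebra_simps)
  then show "z + w \<in> lring a b c"
    by (intro lringI[OF _ H G]) (use FG(4) FG'(4) in auto)
qed

lemma lring_const [simp]: "fls_const k \<in> lring a b c"
proof -
  have "form_val (\<lambda>A B C. fls_const 1) a b c \<noteq> 0" by (simp add: form_val_def)
  moreover have "fls_const k * fls_const 1 = fls_const k" by simp
  ultimately show ?thesis by (intro lringI[OF _ forms_const[of k] forms_const[of 1]]) auto
qed

lemma lring_0_1 [simp]: "0 \<in> lring a b c" "1 \<in> lring a b c"
  using lring_const[of 0] lring_const[of 1] by simp_all

lemma lring_uminus: "z \<in> lring a b c \<Longrightarrow> - z \<in> lring a b c"
  using lring_add_mult(2)[OF lring_const[of "-1"], of z] by simp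

lemma lring_diff: "z \<in> lring a b c \<Longrightarrow> w \<in> lring a b c \<Longrightarrow> z - w \<in> lring a b c"
  using lring_add_mult(1)[OF _ lring_uminus] by fastforce

lemma lring_power: "z \<in> lring a b c \<Longrightarrow> z ^ k \<in> lring a b c"
  by (induction k) (auto intro: lring_add_mult)

lemma lring_sum: "(\<And>i. i \<in> I \<Longrightarrow> f i \<in> lring a b c) \<Longrightarrow> sum f I \<in> lring a b c"
  by (induction I rule: infinite_finite_induct) (auto intro: lring_add_mult)

lemma base_x_nonzero: "base_x \<noteq> 0"
  using nonconst_base unfolding nonconst_def by (metis fls_const_0)

lemma linear_quotients_lring:
  shows "c \<noteq> 0 \<Longrightarrow> base_x \<in> lring a b c" "c \<noteq> 0 \<Longrightarrow> fls_X \<in> lring a b c"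
    "a \<noteq> 0 \<Longrightarrow> 1 / base_x \<in> lring a b c" "a \<noteq> 0 \<Longrightarrow> fls_X / base_x \<in> lring a b c"
proof -
  have *: "F base_x fls_X 1 / G base_x fls_X 1 \<in> lring a b c"
    if "F \<in> forms 1" "G \<in> forms 1" "form_val G a b c \<noteq> 0" "G base_x fls_X 1 \<noteq> 0" for F G
  proof -
    have "F base_x fls_X 1 / G base_x fls_X 1 * G base_x fls_X 1 = F base_x fls_X 1"
      using that by simp
    then show ?thesis by (intro lringI[OF _ that(1-3)]) (use that forms_K in auto)
  qed
  show "c \<noteq> 0 \<Longrightarrow> base_x \<in> lring a b c" "c \<noteq> 0 \<Longrightarrow> fls_X \<in> lring a b c"
    "a \<noteq> 0 \<Longrightarrow> 1 / base_x \<in> lring a b c" "a \<noteq> 0 \<Longrightarrow> fls_X / base_x \<in> lring a b c"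
    using *[OF forms_linear(1,3)] *[OF forms_linear(2,3)] *[OF forms_linear(3,1)]
      *[OF forms_linear(2,1)] base_x_nonzero by (simp_all add: form_val_def)
qed

lemma branch_linear:
  assumes "branch a b c u v"
  shows "c \<noteq> 0 \<Longrightarrow> specializes (ext u v base_x) (a / c)" "c \<noteq> 0 \<Longrightarrow> specializes (ext u v fls_X) (b / c)"
    "a \<noteq> 0 \<Longrightarrow> specializes (ext u v (1 / base_x)) (c / a)" "a \<noteq> 0 \<Longrightarrow> specializes (ext u v (fls_X / base_x)) (b / a)"
proof -
  note l = forms_linear
  note s = lring_branch_spec[OF assms]
  show "c \<noteq> 0 \<Longrightarrow> specializes (ext u v base_x) (a / c)"
    using s[OF l(1,3)] by (simp add: form_val_def)
  show "c \<noteq> 0 \<Longrightarrow> specializes (ext u v fls_X) (b / c)"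
    using s[OF l(2,3)] by (simp add: form_val_def)
  show "a \<noteq> 0 \<Longrightarrow> specializes (ext u v (1 / base_x)) (c / a)"
    using s[OF l(3,1)] base_x_nonzero by (simp add: form_val_def)
  show "a \<noteq> 0 \<Longrightarrow> specializes (ext u v (fls_X / base_x)) (b / a)"
    using s[OF l(2,1)] base_x_nonzero by (simp add: form_val_def)
qed

text \<open>Near a point with \<open>q0 \<noteq> 0\<close> the curve \<open>q\<^sup>n - q0\<^sup>n = k (p\<^sup>n - p0\<^sup>n)\<close> is a graph over the \<open>p\<close>-line,
  because \<open>q\<^sup>n - q0\<^sup>n\<close> is \<open>q - q0\<close> times a function with value \<open>n q0\<^bsup>n-1\<^esup>\<close>.\<close>

lemma chart:
  assumes p: "p \<in> lring a b c" and q: "q \<in> lring a b c"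
    and br: "branch a b c u v" "specializes (ext u v q) q0" and q0: "q0 \<noteq> 0"
    and eq: "q ^ n - fls_const q0 ^ n = fls_const k * (p ^ n - fls_const p0 ^ n)"
  shows "\<exists>w\<in>lring a b c. q - fls_const q0 = (p - fls_const p0) * w"
proof -
  define U where "U = (\<Sum>i<n. fls_const q0 ^ (n - Suc i) * q ^ i)"
  define V where "V = (\<Sum>i<n. fls_const p0 ^ (n - Suc i) * p ^ i)"
  have cu: "curve u v" using br by (simp add: branch_def)
  have UV: "U \<in> lring a b c" "V \<in> lring a b c"
    unfolding U_def V_def using p q by (auto intro!: lring_sum lring_add_mult lring_power)
  have "ext u v U = (\<Sum>i<n. fls_const q0 ^ (n - Suc i) * ext u v q ^ i)"
    unfolding U_def using lring_K[OF q] by (simp add: ext_sum[OF cu] ext_hom[OF cu])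
  then have sU: "specializes (ext u v U) (of_nat n * q0 ^ (n - 1))"
    using specializes_power_diff_quotient[OF br(2)] by simp
  have "of_nat n * q0 ^ (n - 1) \<noteq> 0" using q0 n_pos by simp
  then have Ui: "inverse U \<in> lring a b c" and U0: "U \<noteq> 0"
    using lring_inverse[OF UV(1) br(1) sU] specializes_subdegree_0(2)[OF sU] ext_hom(5)[OF cu]
      by auto
  have "(q - fls_const q0) * U = fls_const k * ((p - fls_const p0) * V)"
    using eq unfolding power_diff_sumr2 U_def V_def .
  then have "q - fls_const q0 = (p - fls_const p0) * (fls_const k * V * inverse U)"
    using U0 by (simp add: field_simps)
  moreover have "fls_const k * V * inverse U \<in> lring a b c"
    by (intro lring_add_mult UV Ui lring_const)
  ultimately show ?thesis by blast
qed

lemma base_curve_eq: "base_x ^ n + fls_X ^ n = 1"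
  using curve_base by (simp add: curve_def)

text \<open>Smoothness of the curve. The parameter is x minus its value where y is nonzero, y itself
  at the affine points with y = 0, and 1/x at infinity. In each case \<open>chart\<close> expresses
  the other coordinate through it, so the numerator of a function vanishing at the point is a
  multiple of the parameter.\<close>

lemma local_parameter:
  assumes abc: "(a, b, c) \<noteq> (0, 0, 0)" "a ^ n + b ^ n = c ^ n" and br: "branch a b c u v"
  obtains t where "t \<in> lring a b c" "t \<noteq> 0" "specializes (ext u v t) 0"
    "\<And>z. z \<in> lring a b c \<Longrightarrow> specializes (ext u v z) 0 \<Longrightarrow> \<exists>w\<in>lring a b c. z = t * w"
proof -
  have cu: "curve u v" using br by (simp add: branch_def)
  \<comment> \<open>Congruence to the constant \<open>z0\<close> modulo the ideal generated by
    \<open>t\<close>; sums and products preserve it, hence so do forms.\<close>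
  define near where "near t z z0 \<longleftrightarrow> z \<in> lring a b c \<and> (\<exists>w\<in>lring a b c. z - fls_const z0 = t * w)"
    for t z z0
  have near_const: "near t (fls_const k) k" for t k
    unfolding near_def by (auto intro!: bexI[of _ 0])
  have near_add: "near t (z + w) (z0 + w0)" if zw: "near t z z0" "near t w w0" for t z z0 w w0
  proof -
    obtain z' w' where *: "z' \<in> lring a b c" "z - fls_const z0 = t * z'"
      "w' \<in> lring a b c" "w - fls_const w0 = t * w'" using zw unfolding near_def by blast
    then have "z + w - fls_const (z0 + w0) = t * (z' + w')"
      by (simp add: algebra_simps flip: fls_plus_const)
    then show ?thesis using * zw unfolding near_def by (blast intro: lring_add_mult)
  qed
  have near_mult: "near t (z * w) (z0 * w0)" if zw: "near t z z0" "near t w w0" for t z z0 w w0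
  proof -
    obtain z' w' where *: "z' \<in> lring a b c" "z - fls_const z0 = t * z'"
      "w' \<in> lring a b c" "w - fls_const w0 = t * w'" using zw unfolding near_def by blast
    have "z * w - fls_const (z0 * w0) = z * (w - fls_const w0) + (z - fls_const z0) * fls_const w0"
      by (simp add: algebra_simps flip: fls_const_mult_const)
    also have "\<dots> = t * (z * w' + z' * fls_const w0)"
      unfolding * by (simp add: algebra_simps)
    finally show ?thesis
      using * zw unfolding near_def by (blast intro: lring_add_mult lring_const)
  qed
  have near_param: "near (p - fls_const p0) p p0" if "p \<in> lring a b c" for p p0
    unfolding near_def using that by (auto intro!: bexI[of _ 1])
  note result = that
  \<comment> \<open>Here \<open>l\<close> is the coordinate used to dehomogenize and
    \<open>l0\<close> its counterpart at the point: \<open>1\<close> and \<open>c\<close> on the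
    affine part, \<open>base_x\<close> and \<open>a\<close> at infinity.\<close>
  have key: thesis
    if t: "t \<in> lring a b c" "t \<noteq> 0" "specializes (ext u v t) 0"
      and l: "l \<in> K" "l \<noteq> 0" "l0 \<noteq> 0"
      and near: "near t (base_x / l) (a / l0)" "near t (fls_X / l) (b / l0)" "near t (1 / l) (c / l0)"
    for t l l0
  proof (rule result)
    show "t \<in> lring a b c" "t \<noteq> 0" "specializes (ext u v t) 0" by (fact t)+
    fix z assume z: "z \<in> lring a b c" "specializes (ext u v z) 0"
    obtain d F G where FG: "F \<in> forms d" "G \<in> forms d" "form_val G a b c \<noteq> 0" "z \<in> K"
      "z * G base_x fls_X 1 = F base_x fls_X 1" using z unfolding lring_def by blast
    define F' where "F' = F (base_x / l) (fls_X / l) (1 / l)"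
    define G' where "G' = G (base_x / l) (fls_X / l) (1 / l)"
    have hom: "H (base_x / l) (fls_X / l) (1 / l) = (1 / l) ^ d * H base_x fls_X 1"
      "form_val H (a / l0) (b / l0) (c / l0) = (1 / l0) ^ d * form_val H a b c" if "H \<in> forms d" for H
      using forms_homogeneous[OF that, of "1 / l" base_x fls_X 1]
        form_val_homogeneous[OF that, of "1 / l0" a b c] by simp_all
    have near_form: "near t (H (base_x / l) (fls_X / l) (1 / l)) (form_val H (a / l0) (b / l0) (c / l0))"
      if "H \<in> forms d" for H
      by (rule form_induct[where R = "near t"]) (fact that near_const near_add near_mult near)+
    have "specializes (ext u v z) (form_val F a b c / form_val G a b c)"
      by (rule lring_branch_spec) (fact br FG)+
    then have "form_val F a b c = 0" using z FG specializes_unique by fastforce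
    then have "near t F' 0" using near_form[OF FG(1)] hom(2)[OF FG(1)] by (simp add: F'_def)
    then obtain w where w: "w \<in> lring a b c" "F' = t * w" by (auto simp: near_def)
    define g where "g = (1 / l0) ^ d * form_val G a b c"
    have g: "g \<noteq> 0" using l FG by (simp add: g_def)
    have nG: "near t G' g" using near_form[OF FG(2)] hom(2)[OF FG(2)] by (simp add: G'_def g_def)
    then obtain w' where w': "w' \<in> lring a b c" "G' = fls_const g + t * w'"
      by (auto simp: near_def algebra_simps)
    obtain e where "specializes (ext u v w') e" using lring_spec[OF w'(1)] br by blast
    then have "specializes (ext u v G') (g + 0 * e)"
      unfolding w' using lring_K t(1,3) w'(1)
      by (simp add: ext_hom[OF cu] del: mult_zero_left) (intro specializes_add specializes_mult specializes_const)
    then have sG: "specializes (ext u v G') g" by simp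
    have "G' \<in> lring a b c" using nG by (simp add: near_def)
    then have Gi: "inverse G' \<in> lring a b c" using lring_inverse[OF _ br sG g] by blast
    have "G' \<noteq> 0" using specializes_subdegree_0(2)[OF sG g] ext_hom(5)[OF cu] by auto
    moreover have "z * G' = F'"
      unfolding F'_def G'_def hom(1)[OF FG(1)] hom(1)[OF FG(2)] FG(5)[symmetric] by simp
    ultimately have "z = t * (w * inverse G')" using w by (simp add: field_simps)
    then show "\<exists>w\<in>lring a b c. z = t * w" using w Gi lring_add_mult by blast
  qed
  have nc: "base_x - fls_const k \<noteq> 0" "fls_X - fls_const k \<noteq> 0" "1 / base_x - fls_const k \<noteq> 0" for k
  proof -
    show "base_x - fls_const k \<noteq> 0" by (rule subdegree_base_x_minus)
    have "fls_nth (fls_X - fls_const k) 1 \<noteq> 0" by simp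
    then show "fls_X - fls_const k \<noteq> 0" by (metis fls_zero_nth)
    show "1 / base_x - fls_const k \<noteq> 0"
    proof
      assume "1 / base_x - fls_const k = 0"
      then have "fls_const k * base_x = 1" using base_x_nonzero by (simp add: field_simps)
      then have "base_x = inverse (fls_const k)" by (simp add: inverse_unique)
      then show False using nonconst_base by (auto simp: nonconst_def fls_inverse_const)
    qed
  qed
  show ?thesis
  proof (cases "c = 0")
    case False
    note lr = linear_quotients_lring(1,2)[OF False, of a b]
    note sp = branch_linear(1,2)[OF br False]
    have affine: "fls_const (a / c) ^ n + fls_const (b / c) ^ n = 1"
    proof -
      have "(a / c) ^ n + (b / c) ^ n = 1"
        using abc False by (simp add: power_divide flip: add_divide_distrib)
      then show ?thesis by (simp add: fls_plus_const flip: fls_const_power)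
    qed
    have eqs: "fls_X ^ n = 1 - base_x ^ n" "fls_const (b / c) ^ n = 1 - fls_const (a / c) ^ n"
      using base_curve_eq affine by (simp_all add: eq_diff_eq add.commute)
    have near1: "near t (1 / 1) (c / c)" for t using near_const[of t 1] False by simp
    show ?thesis
    proof (cases "b = 0")
      case False
      have "fls_X ^ n - fls_const (b / c) ^ n = fls_const (-1) * (base_x ^ n - fls_const (a / c) ^ n)"
        using eqs by simp
      then have "\<exists>w\<in>lring a b c. fls_X - fls_const (b / c) = (base_x - fls_const (a / c)) * w"
        by (rule chart[OF lr br sp(2), rotated]) (use False \<open>c \<noteq> 0\<close> in simp)
      then have "near (base_x - fls_const (a / c)) fls_X (b / c)" using lr by (simp add: near_def)
      moreover have "specializes (ext u v (base_x - fls_const (a / c))) 0"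
        using specializes_diff[OF sp(1) specializes_const[of "a / c"]] by (simp add: ext_hom[OF cu])
      moreover have "base_x - fls_const (a / c) \<in> lring a b c" by (intro lring_diff lr lring_const)
      ultimately show thesis
        using key[of "base_x - fls_const (a / c)" 1 c] near_param[OF lr(1)] near1 nc \<open>c \<noteq> 0\<close> by simp
    next
      case True
      then have "a \<noteq> 0" using abc False n_pos by (auto simp: zero_power)
      have "base_x ^ n - fls_const (a / c) ^ n = fls_const (-1) * (fls_X ^ n - fls_const (b / c) ^ n)"
        using eqs by simp
      then have "\<exists>w\<in>lring a b c. base_x - fls_const (a / c) = (fls_X - fls_const (b / c)) * w"
        by (rule chart[OF lr(2,1) br sp(1), rotated]) (use False \<open>a \<noteq> 0\<close> in simp)
      then have "near (fls_X - fls_const (b / c)) base_x (a / c)" using lr by (simp add: near_def)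
      moreover have "specializes (ext u v (fls_X - fls_const (b / c))) 0"
        using specializes_diff[OF sp(2) specializes_const[of "b / c"]] by (simp add: ext_hom[OF cu])
      moreover have "fls_X - fls_const (b / c) \<in> lring a b c" by (intro lring_diff lr lring_const)
      ultimately show thesis
        using key[of "fls_X - fls_const (b / c)" 1 c] near_param[OF lr(2)] near1 nc \<open>c \<noteq> 0\<close> by simp
    qed
  next
    case True
    have a: "a \<noteq> 0" and b: "b \<noteq> 0" using abc True n_pos by (auto simp: zero_power)
    note lr = linear_quotients_lring(3,4)[OF a, of b c]
    note sp = branch_linear(3,4)[OF br a]
    have "(b / a) ^ n = - 1"
      using abc a True n_pos by (simp add: power_divide zero_power add_eq_0_iff field_simps)
    moreover have "(fls_X / base_x) ^ n + 1 = (1 / base_x) ^ n"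
      using base_curve_eq base_x_nonzero by (simp add: power_divide field_simps)
    ultimately have "(fls_X / base_x) ^ n - fls_const (b / a) ^ n
        = fls_const 1 * ((1 / base_x) ^ n - fls_const 0 ^ n)"
      using n_pos by (simp add: zero_power flip: fls_const_power)
    then have "\<exists>w\<in>lring a b c. fls_X / base_x - fls_const (b / a) = (1 / base_x - fls_const 0) * w"
      by (rule chart[OF lr br sp(2), rotated]) (use a b in simp)
    then have "near (1 / base_x) (fls_X / base_x) (b / a)" using lr by (simp add: near_def)
    moreover have "near (1 / base_x) (1 / base_x) (c / a)"
      using near_param[OF lr(1), of 0] True by simp
    moreover have "near (1 / base_x) (base_x / base_x) (a / a)"
      using near_const[of "1 / base_x" 1] base_x_nonzero a by simp
    ultimately show thesis
      using key[of "1 / base_x" base_x a] lr(1) sp(1) True base_x_nonzero a nc(3)[of 0] by simp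
  qed
qed

text \<open>The quotients of local functions form a field that contains the constants, and it
  contains x and y: directly on the affine part, through 1/x and y/x at infinity.\<close>

lemma K_quotient:
  assumes abc: "(a, b, c) \<noteq> (0, 0, 0)" "a ^ n + b ^ n = c ^ n" and z: "z \<in> K"
  shows "\<exists>f\<in>lring a b c. \<exists>g\<in>lring a b c. g \<noteq> 0 \<and> z = f / g"
proof -
  define Q where "Q z \<longleftrightarrow> (\<exists>f\<in>lring a b c. \<exists>g\<in>lring a b c. g \<noteq> 0 \<and> z = f / g)" for z
  have Q_lring: "Q z" if "z \<in> lring a b c" for z
    unfolding Q_def using that by (intro bexI[of _ z] bexI[of _ 1]) auto
  have Q_mult: "Q (z * w)" and Q_add: "Q (z + w)" if "Q z" "Q w" for z w
  proof -
    obtain f g f' g' where *: "f \<in> lring a b c" "g \<in> lring a b c" "g \<noteq> 0" "z = f / g"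
      "f' \<in> lring a b c" "g' \<in> lring a b c" "g' \<noteq> 0" "w = f' / g'"
      using \<open>Q z\<close> \<open>Q w\<close> unfolding Q_def by blast
    have "g * g' \<in> lring a b c" "g * g' \<noteq> 0" using * lring_add_mult by auto
    moreover have "f * f' \<in> lring a b c" "f * g' + f' * g \<in> lring a b c"
      using * lring_add_mult by auto
    moreover have "z * w = (f * f') / (g * g')" "z + w = (f * g' + f' * g) / (g * g')"
      using * by (simp_all add: field_simps)
    ultimately show "Q (z * w)" "Q (z + w)" unfolding Q_def by blast+
  qed
  have Q_inverse: "Q (inverse z)" if "Q z" for z
  proof (cases "z = 0")
    case False
    obtain f g where *: "f \<in> lring a b c" "g \<in> lring a b c" "g \<noteq> 0" "z = f / g"
      using \<open>Q z\<close> unfolding Q_def by blast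
    then have "inverse z = g / f" "f \<noteq> 0" using False by auto
    then show ?thesis using * unfolding Q_def by blast
  qed (use that in simp)
  have Q_const: "Q (fls_const k)" for k by (intro Q_lring) simp
  have Qx: "Q base_x" and Qy: "Q fls_X"
  proof -
    have "Q base_x \<and> Q fls_X"
    proof (cases "c = 0")
      case False
      then show ?thesis using Q_lring linear_quotients_lring by blast
    next
      case True
      then have "a \<noteq> 0" using abc n_pos by (auto simp: zero_power)
      then have *: "Q (1 / base_x)" "Q (fls_X / base_x)"
        using Q_lring linear_quotients_lring(3,4)[of a b c] by simp_all
      have "Q base_x" using Q_inverse[OF *(1)] by simp
      then show ?thesis using Q_mult[OF *(2) \<open>Q base_x\<close>] base_x_nonzero by simp
    qed
    then show "Q base_x" "Q fls_X" by auto
  qed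
  have "Q (ev_poly base_x p)" for p
    by (induction p) (use Q_const[of 0] Q_const Q_add Q_mult Qx in auto)
  then have Q_fract: "Q (ev_fract base_x r)" for r
    unfolding ev_fract_def divide_inverse by (intro Q_mult Q_inverse)
  have Q_sum: "Q (sum f I)" if "\<And>i. i \<in> I \<Longrightarrow> Q (f i)" for f :: "nat \<Rightarrow> _" and I
    using that by (induction I rule: infinite_finite_induct) (use Q_const[of 0] Q_add in auto)
  have Q_power: "Q (fls_X ^ k)" for k
    by (induction k) (use Q_const[of 1] Q_mult Qy in auto)
  obtain p where "z = base_ev p" using z by (auto simp: K_def)
  moreover have "Q (base_ev p)"
    unfolding ev_altdef[OF nonconst_base lessI] by (intro Q_sum Q_mult Q_fract Q_power)
  ultimately show ?thesis by (simp add: Q_def)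
qed

text \<open>Since \<open>t\<close> generates the ideal of functions vanishing at the point, every function is a power
  of \<open>t\<close> times a unit of the local ring; the order of a local function along a branch bounds the
  number of divisions by \<open>t\<close>.\<close>

theorem lring_iff:
  assumes abc: "(a, b, c) \<noteq> (0, 0, 0)" "a ^ n + b ^ n = c ^ n" and br: "branch a b c u v"
    and z: "z \<in> K"
  shows "z \<in> lring a b c \<longleftrightarrow> fls_subdegree (ext u v z) \<ge> 0"
proof
  assume "z \<in> lring a b c"
  then show "fls_subdegree (ext u v z) \<ge> 0"
    using lring_spec br specializes_iff_subdegree by metis
next
  assume nonneg: "fls_subdegree (ext u v z) \<ge> 0"
  have cu: "curve u v" using br by (simp add: branch_def)
  obtain t where t: "t \<in> lring a b c" "t \<noteq> 0" "specializes (ext u v t) 0"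
    "\<And>z. z \<in> lring a b c \<Longrightarrow> specializes (ext u v z) 0 \<Longrightarrow> \<exists>w\<in>lring a b c. z = t * w"
    using local_parameter[OF abc br] by blast
  note tK = lring_K[OF t(1)]
  have ext_t: "ext u v t \<noteq> 0" using t(2) ext_hom(10)[OF cu tK] by simp
  have t_pos: "fls_subdegree (ext u v t) > 0" using specializes_0_subdegree[OF t(3) ext_t] .
  have decomp: "\<exists>k. \<exists>w\<in>lring a b c. fls_subdegree (ext u v w) = 0 \<and> w \<noteq> 0 \<and> f = t ^ k * w"
    if "f \<in> lring a b c" "f \<noteq> 0" for f
    using that
  proof (induction "nat (fls_subdegree (ext u v f))" arbitrary: f rule: less_induct)
    case less
    obtain e where e: "specializes (ext u v f) e" using lring_spec[OF less(2)] br by blast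
    show ?case
    proof (cases "e = 0")
      case False
      then show ?thesis using specializes_subdegree_0(1)[OF e] less
        by (intro exI[of _ 0] bexI[of _ f]) auto
    next
      case True
      then obtain g where g: "g \<in> lring a b c" "f = t * g" using t(4) e less by blast
      have gK: "g \<in> K" using lring_K g by auto
      have g0: "g \<noteq> 0" using g less by auto
      then have eg: "ext u v g \<noteq> 0" using ext_hom(10)[OF cu gK] by simp
      have "fls_subdegree (ext u v f) = fls_subdegree (ext u v t) + fls_subdegree (ext u v g)"
        using g ext_t eg ext_hom(2)[OF cu tK gK] by simp
      moreover have "fls_subdegree (ext u v g) \<ge> 0"
        using lring_spec[OF g(1)] br specializes_iff_subdegree by metis
      ultimately have "nat (fls_subdegree (ext u v g)) < nat (fls_subdegree (ext u v f))"
        using t_pos by simp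
      from less(1)[OF this g(1) g0] obtain k w where "w \<in> lring a b c"
        "fls_subdegree (ext u v w) = 0" "w \<noteq> 0" "g = t ^ k * w" by blast
      then show ?thesis using g by (intro exI[of _ "Suc k"] bexI[of _ w]) auto
    qed
  qed
  show "z \<in> lring a b c"
  proof (cases "z = 0")
    case False
    obtain f g where fg: "f \<in> lring a b c" "g \<in> lring a b c" "g \<noteq> 0" "z = f / g"
      using K_quotient[OF abc z] by blast
    with False have "f \<noteq> 0" by auto
    obtain k w where w: "w \<in> lring a b c" "fls_subdegree (ext u v w) = 0" "w \<noteq> 0" "f = t ^ k * w"
      using decomp[OF fg(1) \<open>f \<noteq> 0\<close>] by blast
    obtain k' w' where w': "w' \<in> lring a b c" "fls_subdegree (ext u v w') = 0" "w' \<noteq> 0"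
      "g = t ^ k' * w'" using decomp[OF fg(2,3)] by blast
    have wK: "w \<in> K" "w' \<in> K" using lring_K w(1) w'(1) by auto
    then have ew: "ext u v w \<noteq> 0" "ext u v w' \<noteq> 0" using w w' ext_hom(10)[OF cu] by auto
    have "z * (t ^ k' * w') = t ^ k * w" using fg(4) w(4) w'(4) fg(3) by simp
    then have "ext u v (z * (t ^ k' * w')) = ext u v (t ^ k * w)" by simp
    then have "ext u v z * (ext u v t ^ k' * ext u v w') = ext u v t ^ k * ext u v w"
      using z tK wK by (simp add: ext_hom[OF cu])
    then have "fls_subdegree (ext u v z * (ext u v t ^ k' * ext u v w'))
        = fls_subdegree (ext u v t ^ k * ext u v w)" by simp
    moreover have "ext u v z \<noteq> 0" using False z ext_hom(10)[OF cu] by simp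
    ultimately have "fls_subdegree (ext u v z) + int k' * fls_subdegree (ext u v t)
        = int k * fls_subdegree (ext u v t)"
      using ext_t ew w(2) w'(2) by (simp add: fls_subdegree_pow)
    then have "int k' * fls_subdegree (ext u v t) \<le> int k * fls_subdegree (ext u v t)"
      using nonneg by linarith
    then have "k' \<le> k" using t_pos by simp
    then have "z = t ^ (k - k') * (w * inverse w')"
      unfolding fg(4) w(4) w'(4) using t(2) w'(3) by (simp add: field_simps flip: power_add)
    moreover obtain e where e: "specializes (ext u v w') e" using lring_spec[OF w'(1)] br by blast
    moreover have "e \<noteq> 0" using e w'(2) ew(2) specializes_0_subdegree by fastforce
    ultimately show ?thesis
      using lring_inverse[OF w'(1) br] t(1) w(1) by (auto intro: lring_add_mult lring_power)
  qed simp
qed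

end

section \<open>The valuation as the order along a branch\<close>

lemma pol_ring_cring: "cring pol_ring"
proof (rule cringI)
  show "abelian_group pol_ring"
    by (rule abelian_groupI) (auto simp: pol_ring_def add_ac intro!: exI[of _ "- _"])
  show "comm_monoid pol_ring"
    by (rule comm_monoidI) (auto simp: pol_ring_def mult_ac)
qed (auto simp: pol_ring_def distrib_right)

context fermat begin

lemma fermat_ideal_eq: "fermat_ideal n = {q * M | q. True}"
  by (simp add: fermat_ideal_def cgenideal_def M_def pol_ring_def)

lemma ideal_fermat: "ideal (fermat_ideal n) pol_ring"
  unfolding fermat_ideal_def
  by (rule cring.cgenideal_ideal[OF pol_ring_cring]) (simp add: pol_ring_def)

lemma fermat_class_eq: "fermat_class n p = {q * M + p | q. True}"
  by (auto simp: fermat_class_def a_r_coset_def' fermat_ideal_eq pol_ring_def)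

lemma cring_fermat_field: "cring (fermat_field n)"
  unfolding fermat_field_def by (rule ideal.quotient_is_cring[OF ideal_fermat pol_ring_cring])

lemma fermat_field_simps:
  "carrier (fermat_field n) = range (fermat_class n)"
  "fermat_class n p \<otimes>\<^bsub>fermat_field n\<^esub> fermat_class n q = fermat_class n (p * q)"
  "\<one>\<^bsub>fermat_field n\<^esub> = fermat_class n 1"
  "\<zero>\<^bsub>fermat_field n\<^esub> = fermat_class n 0"
proof -
  show "carrier (fermat_field n) = range (fermat_class n)"
    by (auto simp: fermat_field_def FactRing_def A_RCOSETS_def' fermat_class_def pol_ring_def)
  show "fermat_class n p \<otimes>\<^bsub>fermat_field n\<^esub> fermat_class n q = fermat_class n (p * q)"
    using ideal.rcoset_mult_add[OF ideal_fermat, of p q]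
    by (simp add: fermat_field_def FactRing_def fermat_class_def) (simp add: pol_ring_def)
  show "\<one>\<^bsub>fermat_field n\<^esub> = fermat_class n 1"
    by (simp add: fermat_field_def FactRing_def fermat_class_def) (simp add: pol_ring_def)
  show "\<zero>\<^bsub>fermat_field n\<^esub> = fermat_class n 0"
    by (simp add: fermat_class_eq fermat_ideal_eq fermat_field_def FactRing_def)
qed

text \<open>\<open>iota\<close> and \<open>kappa\<close> are mutually inverse translations between
  cosets and elements of \<open>K\<close>. Representatives of a coset differ by a multiple of
  \<open>M\<close>, which \<open>base_ev\<close> annihilates, so the choice does not matter.\<close>

definition iota :: "complex poly fract poly set \<Rightarrow> complex fls" where
  "iota Z = base_ev (SOME p. p \<in> Z)"

definition kappa :: "complex fls \<Rightarrow> complex poly fract poly set" where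
  "kappa z = fermat_class n (SOME p. base_ev p = z)"

lemma iota_class: "iota (fermat_class n p) = base_ev p"
proof -
  have "p \<in> fermat_class n p" unfolding fermat_class_eq by (auto intro!: exI[of _ 0])
  then have "(SOME q. q \<in> fermat_class n p) \<in> fermat_class n p" by (rule someI)
  then obtain q where "(SOME q. q \<in> fermat_class n p) = q * M + p" by (auto simp: fermat_class_eq)
  then show ?thesis by (simp add: iota_def ev_hom nonconst_base ev_M curve_base)
qed

lemma fermat_class_eq_iff: "fermat_class n p = fermat_class n q \<longleftrightarrow> base_ev p = base_ev q"
proof
  assume "base_ev p = base_ev q"
  then have "M dvd p - q" by (simp add: ev_hom nonconst_base flip: base_ev_eq_0_iff)
  then obtain s where s: "p - q = M * s" ..
  then have "p = s * M + q" "q = (- s) * M + p" by (simp_all add: algebra_simps)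
  then have "r * M + p = (r + s) * M + q" "r * M + q = (r - s) * M + p" for r
    by (simp_all add: algebra_simps)
  then show "fermat_class n p = fermat_class n q" unfolding fermat_class_eq by blast
qed (metis iota_class)

lemma iota_simps:
  assumes "Z \<in> carrier (fermat_field n)" "W \<in> carrier (fermat_field n)"
  shows "iota Z \<in> K" "iota (Z \<otimes>\<^bsub>fermat_field n\<^esub> W) = iota Z * iota W"
    "iota Z = iota W \<longleftrightarrow> Z = W" "kappa (iota Z) = Z"
proof -
  obtain p q where pq: "Z = fermat_class n p" "W = fermat_class n q"
    using assms by (auto simp: fermat_field_simps)
  show "iota Z \<in> K" by (simp add: pq iota_class)
  show "iota (Z \<otimes>\<^bsub>fermat_field n\<^esub> W) = iota Z * iota W"
    by (simp add: pq iota_class fermat_field_simps ev_hom nonconst_base)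
  show "iota Z = iota W \<longleftrightarrow> Z = W"
    by (simp add: pq iota_class fermat_class_eq_iff)
  have "base_ev (SOME p'. base_ev p' = base_ev p) = base_ev p" by (rule someI[of _ p]) simp
  then show "kappa (iota Z) = Z"
    by (simp add: kappa_def pq iota_class fermat_class_eq_iff)
qed

lemma iota_one_zero: "iota \<one>\<^bsub>fermat_field n\<^esub> = 1" "iota \<zero>\<^bsub>fermat_field n\<^esub> = 0"
  by (simp_all add: fermat_field_simps iota_class ev_hom nonconst_base)

lemma kappa: "z \<in> K \<Longrightarrow> kappa z \<in> carrier (fermat_field n)" "z \<in> K \<Longrightarrow> iota (kappa z) = z"
proof -
  show "z \<in> K \<Longrightarrow> kappa z \<in> carrier (fermat_field n)"
    by (simp add: kappa_def fermat_field_simps)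
  assume "z \<in> K"
  then have "\<exists>p. base_ev p = z" by (auto simp: K_def)
  then have "base_ev (SOME p. base_ev p = z) = z" by (rule someI_ex)
  then show "iota (kappa z) = z" by (simp add: kappa_def iota_class)
qed

text \<open>By homogeneity a form that is nonzero at one coordinate triple of the point is nonzero
  at all of them, so a fixed triple can replace the projective point.\<close>

lemma carrier_local_ring:
  "carrier (local_ring n (proj_point a b c)) = {Z \<in> carrier (fermat_field n). iota Z \<in> lring a b c}"
proof -
  have nonzero: "(\<forall>(a, b, c)\<in>proj_point a b c. form_eval d h a b c \<noteq> 0) \<longleftrightarrow> form_eval d h a b c \<noteq> 0"
    for d h
  proof -
    have "(\<forall>(a, b, c)\<in>proj_point a b c. form_eval d h a b c \<noteq> 0) \<longleftrightarrow>
        (\<forall>k. k \<noteq> 0 \<longrightarrow> form_eval d h (k * a) (k * b) (k * c) \<noteq> 0)"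
      unfolding proj_point_def by fast
    also have "\<dots> \<longleftrightarrow> form_eval d h a b c \<noteq> 0"
      unfolding form_eval_homogeneous by (metis mult_eq_0_iff one_neq_zero power_not_zero)
    finally show ?thesis .
  qed
  have "(\<exists>d g h. (\<forall>(a, b, c)\<in>proj_point a b c. form_eval d h a b c \<noteq> 0) \<and>
      Z \<otimes>\<^bsub>fermat_field n\<^esub> form_class n d h = form_class n d g) \<longleftrightarrow> iota Z \<in> lring a b c"
    if Z: "Z \<in> carrier (fermat_field n)" for Z
  proof -
    have fc: "form_class n d h \<in> carrier (fermat_field n)"
      "iota (form_class n d h) = form_eval d (\<lambda>i j. fls_const (h i j)) base_x fls_X 1" for d h
      by (simp_all add: form_class_def fermat_field_simps iota_class ev_form nonconst_base)
    have "Z \<otimes>\<^bsub>fermat_field n\<^esub> form_class n d h \<in> carrier (fermat_field n)" for d h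
      using Z by (auto simp: fermat_field_simps form_class_def)
    then have *: "Z \<otimes>\<^bsub>fermat_field n\<^esub> form_class n d h = form_class n d g \<longleftrightarrow>
      iota Z * form_eval d (\<lambda>i j. fls_const (h i j)) base_x fls_X 1
        = form_eval d (\<lambda>i j. fls_const (g i j)) base_x fls_X 1" for d g h
      using iota_simps(2)[OF Z fc(1)] iota_simps(3)[OF _ fc(1)] fc(2) by metis
    have ex: "(\<exists>F\<in>forms d. Q F) \<longleftrightarrow>
        (\<exists>f. Q (\<lambda>A B C. form_eval d (\<lambda>i j. fls_const (f i j)) A B C))" for d Q
      unfolding forms_def by blast
    show ?thesis
      unfolding nonzero * lring_def mem_Collect_eq ex form_val_form_eval
      using iota_simps(1)[OF Z Z] by blast
  qed
  then show ?thesis unfolding local_ring_def by auto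
qed

lemma local_ring_ops [simp]:
  "x \<otimes>\<^bsub>local_ring n P\<^esub> y = x \<otimes>\<^bsub>fermat_field n\<^esub> y" "\<one>\<^bsub>local_ring n P\<^esub> = \<one>\<^bsub>fermat_field n\<^esub>"
  by (simp_all add: local_ring_def)

text \<open>By \<open>lring_iff\<close> the local ring is the valuation ring of the order along the
  branch: units have order 0, and the place consists of zero and the functions of positive order. A
  function of order 1 exists by \<open>un\<close>, so prime elements are those of order 1 and the
  exponent in the definition is the order.\<close>

theorem valuation_at_eq:
  assumes abc: "(a, b, c) \<noteq> (0, 0, 0)" "a ^ n + b ^ n = c ^ n" and br: "branch a b c u v"
    and un: "uniformizing u v" and z: "z \<in> K" "z \<noteq> 0"
  shows "valuation_at n (proj_point a b c) (kappa z) = fls_subdegree (ext u v z)"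
proof -
  let ?F = "fermat_field n" and ?R = "local_ring n (proj_point a b c)"
  let ?v = "\<lambda>Z. fls_subdegree (ext u v (iota Z))"
  interpret F: cring ?F by (rule cring_fermat_field)
  have cu: "curve u v" using br by (simp add: branch_def)
  note eh = ext_hom[OF cu]
  have iK: "iota Z \<in> K" if "Z \<in> carrier ?F" for Z using iota_simps(1) that by blast
  have zero: "iota Z = 0 \<longleftrightarrow> Z = \<zero>\<^bsub>?F\<^esub>" if "Z \<in> carrier ?F" for Z
    using iota_simps(3)[OF that F.zero_closed] iota_one_zero by simp
  have one: "iota Z = 1 \<longleftrightarrow> Z = \<one>\<^bsub>?F\<^esub>" if "Z \<in> carrier ?F" for Z
    using iota_simps(3)[OF that F.one_closed] iota_one_zero by simp
  have v_mult: "?v (Z \<otimes>\<^bsub>?F\<^esub> W) = ?v Z + ?v W"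
    if "Z \<in> carrier ?F" "W \<in> carrier ?F" "iota Z \<noteq> 0" "iota W \<noteq> 0" for Z W
    using that iK iota_simps(2) by (simp add: eh)
  have R: "Z \<in> carrier ?R \<longleftrightarrow> Z \<in> carrier ?F \<and> ?v Z \<ge> 0" for Z
    unfolding carrier_local_ring using lring_iff[OF abc br] iK by auto
  have units: "Z \<in> Units ?R \<longleftrightarrow> Z \<in> carrier ?F \<and> iota Z \<noteq> 0 \<and> ?v Z = 0" for Z
  proof
    assume "Z \<in> Units ?R"
    then obtain W where W: "Z \<in> carrier ?R" "W \<in> carrier ?R" "Z \<otimes>\<^bsub>?F\<^esub> W = \<one>\<^bsub>?F\<^esub>"
      by (auto simp: Units_def)
    then have ZW: "Z \<in> carrier ?F" "W \<in> carrier ?F" using R by auto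
    then have 1: "iota Z * iota W = 1" using iota_simps(2)[OF ZW] W(3) iota_one_zero by simp
    then have nz: "iota Z \<noteq> 0" "iota W \<noteq> 0" by auto
    have "?v Z + ?v W = 0"
      using v_mult[OF ZW nz] W(3) iota_one_zero by (simp add: eh)
    then show "Z \<in> carrier ?F \<and> iota Z \<noteq> 0 \<and> ?v Z = 0" using W R nz by auto
  next
    assume Z: "Z \<in> carrier ?F \<and> iota Z \<noteq> 0 \<and> ?v Z = 0"
    define W where "W = kappa (inverse (iota Z))"
    have W: "W \<in> carrier ?F" "iota W = inverse (iota Z)"
      using Z iK by (simp_all add: W_def kappa)
    have "?v W = - ?v Z" using Z iK by (simp add: W eh)
    then have "W \<in> carrier ?R" "Z \<in> carrier ?R" using Z W R by auto
    moreover have "Z \<otimes>\<^bsub>?F\<^esub> W = \<one>\<^bsub>?F\<^esub>"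
      using Z W iota_simps(2)[of Z W] one[of "Z \<otimes>\<^bsub>?F\<^esub> W"] by simp
    moreover have "W \<otimes>\<^bsub>?F\<^esub> Z = \<one>\<^bsub>?F\<^esub>"
      using calculation(3) F.m_comm Z W by simp
    ultimately show "Z \<in> Units ?R" by (auto simp: Units_def)
  qed
  have place: "Z \<in> place_of n (proj_point a b c) \<longleftrightarrow> Z \<in> carrier ?F \<and> (iota Z = 0 \<or> ?v Z > 0)" for Z
    unfolding place_of_def using R units by (auto simp: eh)
  obtain s where s: "s \<in> K" "fls_subdegree (ext u v s) = 1"
    using un by (auto simp: uniformizing_def)
  define S where "S = kappa s"
  have S: "S \<in> carrier ?F" "iota S = s" using s by (simp_all add: S_def kappa)
  then have S0: "iota S \<noteq> 0" using s eh(5) by auto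
  have prime: "prime_element n (proj_point a b c) T \<longleftrightarrow> T \<in> carrier ?F \<and> iota T \<noteq> 0 \<and> ?v T = 1" for T
  proof
    assume "prime_element n (proj_point a b c) T"
    then have T: "T \<in> carrier ?R" and P: "PIdl\<^bsub>?R\<^esub> T = place_of n (proj_point a b c)"
      by (auto simp: prime_element_def)
    have TF: "T \<in> carrier ?F" using T R by auto
    \<comment> \<open>The reference function \<open>S\<close> of order 1 lies in the place, hence is
      a multiple of \<open>T\<close>. So the order of \<open>T\<close> is at most 1, and being
      positive it is 1.\<close>
    have "S \<in> PIdl\<^bsub>?R\<^esub> T" unfolding P place using S s by simp
    then obtain X where X: "X \<in> carrier ?R" "S = X \<otimes>\<^bsub>?F\<^esub> T" by (auto simp: cgenideal_def)
    then have XF: "X \<in> carrier ?F" using R by auto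
    have "iota S = iota X * iota T" using X iota_simps(2)[OF XF TF] by simp
    then have nz: "iota X \<noteq> 0" "iota T \<noteq> 0" using S0 by auto
    have "1 = ?v X + ?v T" using v_mult[OF XF TF nz] X s S by simp
    moreover have "?v X \<ge> 0" using X R by simp
    moreover have "T \<in> PIdl\<^bsub>?R\<^esub> T"
    proof -
      have "\<one>\<^bsub>?F\<^esub> \<in> carrier ?R" using R iota_one_zero by (simp add: eh)
      moreover have "T = \<one>\<^bsub>?F\<^esub> \<otimes>\<^bsub>?F\<^esub> T" using TF by simp
      ultimately show ?thesis unfolding cgenideal_def by auto
    qed
    then have "?v T > 0" unfolding P place using nz by simp
    ultimately show "T \<in> carrier ?F \<and> iota T \<noteq> 0 \<and> ?v T = 1" using TF nz by simp
  next
    assume T: "T \<in> carrier ?F \<and> iota T \<noteq> 0 \<and> ?v T = 1"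
    have "PIdl\<^bsub>?R\<^esub> T = place_of n (proj_point a b c)"
    proof (intro equalityI subsetI)
      fix Z assume "Z \<in> PIdl\<^bsub>?R\<^esub> T"
      then obtain X where X: "X \<in> carrier ?R" "Z = X \<otimes>\<^bsub>?F\<^esub> T" by (auto simp: cgenideal_def)
      then have XF: "X \<in> carrier ?F" using R by auto
      then have "iota Z = iota X * iota T" using X iota_simps(2) T by simp
      moreover have "?v Z = ?v X + 1" if "iota X \<noteq> 0" using v_mult[of X T] that T X XF by simp
      moreover have "?v X \<ge> 0" using X R by simp
      ultimately show "Z \<in> place_of n (proj_point a b c)"
        unfolding place using X XF T by (cases "iota X = 0") auto
    next
      fix Z assume Z: "Z \<in> place_of n (proj_point a b c)"
      then have ZF: "Z \<in> carrier ?F" by (simp add: place)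
      define X where "X = kappa (iota Z / iota T)"
      have X: "X \<in> carrier ?F" "iota X = iota Z / iota T"
        using ZF T iK by (simp_all add: X_def kappa)
      have "iota (X \<otimes>\<^bsub>?F\<^esub> T) = iota Z" using X T iota_simps(2)[of X T] by simp
      then have eq: "X \<otimes>\<^bsub>?F\<^esub> T = Z" using iota_simps(3)[of "X \<otimes>\<^bsub>?F\<^esub> T" Z] ZF X T by simp
      have "?v X \<ge> 0"
      proof (cases "iota Z = 0")
        case False
        then have "?v Z = ?v X + ?v T" using v_mult[of X T] eq X T by simp
        then show ?thesis using Z False T by (simp add: place)
      qed (simp add: X eh)
      then have "X \<in> carrier ?R" using R X by simp
      then show "Z \<in> PIdl\<^bsub>?R\<^esub> T" unfolding cgenideal_def using eq by auto
    qed
    moreover have "T \<in> carrier ?R" using R T by simp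
    ultimately show "prime_element n (proj_point a b c) T" by (simp add: prime_element_def)
  qed
  have nat_pow: "T [^]\<^bsub>?F\<^esub> (k::nat) \<in> carrier ?F \<and> iota (T [^]\<^bsub>?F\<^esub> k) = iota T ^ k"
    if "T \<in> carrier ?F" for T k
    using that by (induction k) (auto simp: iota_simps(2) iota_one_zero)
  have int_pow: "T [^]\<^bsub>?F\<^esub> (k::int) \<in> carrier ?F \<and> iota (T [^]\<^bsub>?F\<^esub> k) \<noteq> 0 \<and>
      ?v (T [^]\<^bsub>?F\<^esub> k) = k * ?v T" if T: "T \<in> carrier ?F" "iota T \<noteq> 0" for T k
  proof -
    have v_pow: "?v (T [^]\<^bsub>?F\<^esub> m) = int m * ?v T" for m :: nat
      using nat_pow[of T m] T iK by (simp add: eh fls_subdegree_pow)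
    show ?thesis
    proof (cases "k \<ge> 0")
      case True
      then have "T [^]\<^bsub>?F\<^esub> k = T [^]\<^bsub>?F\<^esub> nat k"
        unfolding int_pow_def2 by (intro if_not_P) simp
      moreover have "T [^]\<^bsub>?F\<^esub> nat k \<in> carrier ?F \<and> iota (T [^]\<^bsub>?F\<^esub> nat k) \<noteq> 0"
        using nat_pow[OF T(1), of "nat k"] T(2) by simp
      moreover have "int (nat k) = k" using True by simp
      ultimately show ?thesis using v_pow[of "nat k"] by metis
    next
      case False
      let ?A = "T [^]\<^bsub>?F\<^esub> nat (- k)"
      have A: "?A \<in> carrier ?F" "iota ?A \<noteq> 0" using nat_pow T by auto
      \<comment> \<open>A negative power is a monoid inverse; \<open>B\<close> exhibits it by means
        of the field inverse in \<open>K\<close>.\<close>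
      define B where "B = kappa (inverse (iota ?A))"
      have B: "B \<in> carrier ?F" "iota B = inverse (iota ?A)"
        using A iK by (simp_all add: B_def kappa)
      have "?A \<otimes>\<^bsub>?F\<^esub> B = \<one>\<^bsub>?F\<^esub>"
        using A B iota_simps(2)[of ?A B] one[of "?A \<otimes>\<^bsub>?F\<^esub> B"] by simp
      then have "inv\<^bsub>?F\<^esub> ?A = B" using F.comm_inv_char A B by blast
      then have "T [^]\<^bsub>?F\<^esub> k = B" unfolding int_pow_def2 using False by (simp only: if_True not_le)
      moreover have "?v B = - ?v ?A" using A B iK by (simp add: eh)
      ultimately show ?thesis using A B v_pow[of "nat (- k)"] False by simp
    qed
  qed
  define Z where "Z = kappa z"
  have Z: "Z \<in> carrier ?F" "iota Z = z" using z by (simp_all add: Z_def kappa)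
  have "valuation_at n (proj_point a b c) Z = ?v Z"
    unfolding valuation_at_def
  proof (rule the_equality)
    define W where "W = kappa (z / iota (S [^]\<^bsub>?F\<^esub> ?v Z))"
    note Sp = int_pow[OF S(1) S0, of "?v Z"]
    have W: "W \<in> carrier ?F" "iota W = z / iota (S [^]\<^bsub>?F\<^esub> ?v Z)"
      using z Sp iK by (simp_all add: W_def kappa)
    have W0: "iota W \<noteq> 0" using W Sp z by simp
    have "iota (S [^]\<^bsub>?F\<^esub> ?v Z \<otimes>\<^bsub>?F\<^esub> W) = iota Z"
      using W Sp Z iota_simps(2)[of "S [^]\<^bsub>?F\<^esub> ?v Z" W] by simp
    then have eq: "Z = S [^]\<^bsub>?F\<^esub> ?v Z \<otimes>\<^bsub>?F\<^esub> W"
      using iota_simps(3)[of "S [^]\<^bsub>?F\<^esub> ?v Z \<otimes>\<^bsub>?F\<^esub> W" Z] W Z Sp by simp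
    have "?v (S [^]\<^bsub>?F\<^esub> ?v Z \<otimes>\<^bsub>?F\<^esub> W) = ?v Z * ?v S + ?v W"
      using v_mult[of "S [^]\<^bsub>?F\<^esub> ?v Z" W] Sp W W0 by simp
    then have "?v W = 0" using eq s S by simp
    then show "\<exists>t w. prime_element n (proj_point a b c) t \<and> w \<in> Units ?R \<and>
        Z = t [^]\<^bsub>?F\<^esub> ?v Z \<otimes>\<^bsub>?F\<^esub> w"
      unfolding prime units using eq W W0 S S0 s by (intro exI[of _ S] exI[of _ W]) simp
  next
    fix k :: int
    assume "\<exists>t w. prime_element n (proj_point a b c) t \<and> w \<in> Units ?R \<and>
        Z = t [^]\<^bsub>?F\<^esub> k \<otimes>\<^bsub>?F\<^esub> w"
    then obtain t w where tw: "prime_element n (proj_point a b c) t" "w \<in> Units ?R"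
      "Z = t [^]\<^bsub>?F\<^esub> k \<otimes>\<^bsub>?F\<^esub> w" by blast
    then have "?v Z = k * 1 + 0"
      using v_mult[of "t [^]\<^bsub>?F\<^esub> k" w] int_pow[of t k] units prime by auto
    then show "k = ?v Z" by simp
  qed
  then show ?thesis using Z by (simp add: Z_def)
qed

end

section \<open>Branches, automorphisms and constants\<close>

lemma specializes_poly: "specializes u a \<Longrightarrow> specializes (ev_poly u p) (poly p a)"
proof (induction p)
  case 0
  then show ?case using specializes_const[of 0] by simp
next
  case (pCons c p)
  then show ?case by (simp add: specializes_add specializes_mult)
qed

context fermat begin

definition on_curve :: "complex \<Rightarrow> complex \<Rightarrow> complex \<Rightarrow> bool" where
  "on_curve a b c \<longleftrightarrow> (a, b, c) \<noteq> (0, 0, 0) \<and> a ^ n + b ^ n = c ^ n"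

lemma root_of_fls:
  assumes "b ^ n = fps_nth w 0" "b \<noteq> 0"
  obtains v where "v ^ n = fps_to_fls w" "specializes v b"
proof -
  have "fps_nth w 0 \<noteq> 0" using assms by (metis power_not_zero)
  then obtain r where "r ^ n = w" "fps_nth r 0 = b"
    using fps_root_exists[OF n_pos assms(1)] by blast
  then show thesis using that[of "fps_to_fls r"]
    by (auto simp: specializes_def simp flip: fps_to_fls_power)
qed

text \<open>A power series root with prescribed value is extracted where the constant term is
  nonzero. This dictates the parameter in the three constructions of a branch: x minus its value
  when y is nonzero, y when it vanishes, and 1/x at infinity, where \<open>r\<close> stands for
  y/x.\<close>

lemma branch_unramified:
  assumes "on_curve a b c" "c \<noteq> 0" "b \<noteq> 0"
  obtains v where "branch a b c (fls_const (a / c) + fls_X) v" "specializes v (b / c)"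
    "uniformizing (fls_const (a / c) + fls_X) v"
proof -
  define u :: "complex fls" where "u = fls_const (a / c) + fls_X"
  define w where "w = 1 - (fps_const (a / c) + fps_X) ^ n"
  have "(a / c) ^ n + (b / c) ^ n = 1"
    using assms by (simp add: on_curve_def power_divide flip: add_divide_distrib)
  then have "(b / c) ^ n = fps_nth w 0"
    by (simp add: w_def fps_power_zeroth eq_diff_eq add.commute)
  moreover have "b / c \<noteq> 0" using assms by simp
  ultimately obtain v where v: "v ^ n = fps_to_fls w" "specializes v (b / c)" by (rule root_of_fls)
  have "u \<noteq> fls_const k" for k
  proof
    assume "u = fls_const k"
    then have "fls_nth u 1 = fls_nth (fls_const k) 1" by simp
    then show False by (simp add: u_def)
  qed
  moreover have "fps_to_fls w = 1 - u ^ n"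
    by (simp add: w_def u_def fps_to_fls_power)
  ultimately have cu: "curve u v" using v by (simp add: curve_def nonconst_def)
  have "specializes fls_X 0" unfolding specializes_def by (intro exI[of _ fps_X]) simp
  then have "specializes u (a / c)"
    using specializes_add[OF specializes_const] unfolding u_def by fastforce
  then have "specializes (fls_const c * u) a" "specializes (fls_const c * v) b"
    using specializes_mult[OF specializes_const[of c]] v(2) assms by fastforce+
  then have "branch a b c u v" using cu unfolding branch_def by (blast intro: specializes_const)
  moreover have "ext u v (base_x - fls_const (a / c)) = fls_X"
    by (simp add: ext_hom[OF cu]) (simp add: u_def)
  then have "uniformizing u v"
    unfolding uniformizing_def by (intro bexI[of _ "base_x - fls_const (a / c)"]) auto
  ultimately show thesis using that v unfolding u_def by blast
qed

lemma branch_ramified: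
  assumes "on_curve a b c" "c \<noteq> 0" "b = 0"
  obtains u where "branch a b c u fls_X" "u ^ n = 1 - fls_X ^ n" "specializes u (a / c)"
    "uniformizing u fls_X"
proof -
  have "a ^ n = c ^ n" using assms n_pos by (simp add: on_curve_def zero_power)
  then have 1: "(a / c) ^ n = 1" using assms by (simp add: power_divide)
  then have "(a / c) ^ n = fps_nth (1 - fps_X ^ n) 0" "a / c \<noteq> 0"
    using n_pos by (auto simp: zero_power)
  then obtain u where u: "u ^ n = fps_to_fls (1 - fps_X ^ n)" "specializes u (a / c)"
    by (rule root_of_fls)
  have u': "u ^ n = 1 - fls_X ^ n" using u(1) by (simp add: fps_to_fls_power)
  have cu: "curve u fls_X" using nonconst_of_power[OF u' n_pos] u' by (simp add: curve_def)
  have "specializes fls_X 0" unfolding specializes_def by (intro exI[of _ fps_X]) simp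
  then have "specializes (fls_const c * u) a" "specializes (fls_const c * fls_X) b"
    using specializes_mult[OF specializes_const[of c]] u(2) assms by fastforce+
  then have "branch a b c u fls_X" using cu unfolding branch_def by (blast intro: specializes_const)
  moreover have "uniformizing u fls_X"
    unfolding uniformizing_def by (intro bexI[of _ fls_X]) (simp_all add: ext_hom[OF cu])
  ultimately show thesis using that u' u(2) by blast
qed

lemma branch_infinite:
  assumes "on_curve a b c" "c = 0"
  obtains r where "branch a b c (1 / fls_X) (r / fls_X)" "specializes r (b / a)" "b / a \<noteq> 0"
    "uniformizing (1 / fls_X) (r / fls_X)"
proof -
  have a: "a \<noteq> 0" and b: "b \<noteq> 0" using assms n_pos by (auto simp: on_curve_def zero_power)
  have "(b / a) ^ n = - 1"
    using assms a n_pos by (simp add: on_curve_def power_divide zero_power add_eq_0_iff field_simps)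
  then have "(b / a) ^ n = fps_nth (fps_X ^ n - 1) 0" "b / a \<noteq> 0"
    using n_pos a b by auto
  then obtain r where r: "r ^ n = fps_to_fls (fps_X ^ n - 1)" "specializes r (b / a)"
    by (rule root_of_fls)
  then have r': "r ^ n = fls_X ^ n - 1" by (simp add: fps_to_fls_power)
  have "1 / fls_X \<noteq> (fls_const k :: complex fls)" for k
  proof
    assume "1 / fls_X = (fls_const k :: complex fls)"
    then have "fls_subdegree (1 / fls_X :: complex fls) = 0" by simp
    then show False by (simp add: fls_divide_subdegree)
  qed
  moreover have "(1 / fls_X) ^ n + (r / fls_X) ^ n = 1"
    unfolding power_divide r' add_divide_distrib[symmetric] by simp
  ultimately have cu: "curve (1 / fls_X) (r / fls_X)"
    unfolding curve_def nonconst_def by blast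
  have "specializes fls_X 0" unfolding specializes_def by (intro exI[of _ fps_X]) simp
  then have sc: "specializes (fls_const a * fls_X) c"
    using specializes_mult[OF specializes_const[of a]] assms by fastforce
  have cancel: "fls_const a * fls_X * (w / fls_X) = fls_const a * w" for w
    by (metis fls_X_nonzero mult.assoc nonzero_mult_div_cancel_left times_divide_eq_right)
  have "specializes (fls_const a * fls_X * (r / fls_X)) b"
    unfolding cancel using specializes_mult[OF specializes_const[of a] r(2)] a by simp
  moreover have "specializes (fls_const a * fls_X * (1 / fls_X)) a" unfolding cancel by simp
  ultimately have "branch a b c (1 / fls_X) (r / fls_X)"
    using cu sc unfolding branch_def by blast
  moreover have "ext (1 / fls_X) (r / fls_X) (1 / base_x) = fls_X"
    unfolding ext_hom(12)[OF cu K_closed(3) K_closed(5)] ext_hom(6,8)[OF cu]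
    by (simp only: divide_divide_eq_right mult_1 div_by_1)
  then have "uniformizing (1 / fls_X) (r / fls_X)"
    unfolding uniformizing_def by (intro bexI[of _ "1 / base_x"]) auto
  ultimately show thesis using that r(2) a b by auto
qed

lemma branch_exists:
  assumes "on_curve a b c"
  obtains u v where "branch a b c u v" "uniformizing u v"
proof (cases "c = 0")
  case True
  then show ?thesis using branch_infinite[OF assms] that by blast
next
  case False
  then show ?thesis
    using branch_unramified[OF assms] branch_ramified[OF assms] that by (cases "b = 0") blast+
qed

definition val :: "complex \<Rightarrow> complex \<Rightarrow> complex \<Rightarrow> complex fls \<Rightarrow> int" where
  "val a b c z = valuation_at n (proj_point a b c) (kappa z)"

lemma val_branch:
  assumes "on_curve a b c" "branch a b c u v" "uniformizing u v" "z \<in> K" "z \<noteq> 0"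
  shows "val a b c z = fls_subdegree (ext u v z)"
  using valuation_at_eq assms unfolding val_def on_curve_def by blast

lemma val_mult:
  assumes "on_curve a b c" "z \<in> K" "w \<in> K" "z \<noteq> 0" "w \<noteq> 0"
  shows "val a b c (z * w) = val a b c z + val a b c w"
proof -
  obtain u v where uv: "branch a b c u v" "uniformizing u v" using branch_exists assms by blast
  then have "curve u v" by (simp add: branch_def)
  then show ?thesis using assms val_branch[OF assms(1) uv] by (simp add: ext_hom)
qed

lemma val_const: "on_curve a b c \<Longrightarrow> k \<noteq> 0 \<Longrightarrow> val a b c (fls_const k) = 0"
  using branch_exists[of a b c] val_branch[of a b c _ _ "fls_const k"]
  by (metis K_closed(4) branch_def ext_hom(7) fls_const_nonzero fls_const_subdegree)

lemma val_inverse: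
  assumes "on_curve a b c" "z \<in> K" "z \<noteq> 0"
  shows "val a b c (inverse z) = - val a b c z"
  using val_mult[OF assms(1,2) K_closed(11)[OF assms(2)]] val_const[OF assms(1), of 1] assms by simp

lemma val_divide:
  assumes "on_curve a b c" "z \<in> K" "w \<in> K" "z \<noteq> 0" "w \<noteq> 0"
  shows "val a b c (z / w) = val a b c z - val a b c w"
  using assms val_mult[of a b c z "inverse w"] val_inverse[of a b c w]
  by (simp add: divide_inverse)

lemma val_power:
  assumes "on_curve a b c" "z \<in> K" "z \<noteq> 0"
  shows "val a b c (z ^ k) = int k * val a b c z"
  using val_const[OF assms(1), of 1] by (induction k) (simp_all add: assms val_mult algebra_simps)

lemma val_nonneg_iff:
  assumes "on_curve a b c" "z \<in> K" "z \<noteq> 0"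
  shows "val a b c z \<ge> 0 \<longleftrightarrow> z \<in> lring a b c"
proof -
  obtain u v where uv: "branch a b c u v" "uniformizing u v" using branch_exists assms by blast
  then show ?thesis using lring_iff[OF _ _ uv(1)] val_branch[OF assms(1) uv] assms
    by (simp add: on_curve_def)
qed

section \<open>Automorphisms\<close>

lemma ext_in_K:
  assumes cu: "curve u v" and K: "u \<in> K" "v \<in> K" "z \<in> K"
  shows "ext u v z \<in> K"
proof -
  have u: "nonconst u" using cu by (simp add: curve_def)
  have "ev_poly u p \<in> K" for p by (induction p) (auto simp: K)
  then have "ev_fract u r \<in> K" for r by (auto simp: ev_fract_def)
  moreover obtain p where "z = base_ev p" using K by (auto simp: K_def)
  ultimately show ?thesis
    using K by (simp add: ext_base_ev[OF cu] ev_altdef[OF u lessI] del: sum.lessThan_Suc) auto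
qed

text \<open>A substitution followed by a substitution is again one. It gives both the composition of
  automorphisms and their action on branches.\<close>

lemma ext_ext:
  assumes cu: "curve u v" and cu': "curve u' v'" and K: "u' \<in> K" "v' \<in> K" "z \<in> K"
    and cu'': "curve (ext u v u') (ext u v v')"
  shows "ext u v (ext u' v' z) = ext (ext u v u') (ext u v v') z"
proof -
  note eh = ext_hom[OF cu]
  have u: "nonconst u'" "nonconst (ext u v u')" using cu' cu'' by (simp_all add: curve_def)
  have pK: "ev_poly u' p \<in> K" for p by (induction p) (auto simp: K)
  have p: "ext u v (ev_poly u' p) = ev_poly (ext u v u') p" for p
    by (induction p) (simp_all add: eh pK K)
  have fK: "ev_fract u' r \<in> K" for r using pK by (auto simp: ev_fract_def)
  have f: "ext u v (ev_fract u' r) = ev_fract (ext u v u') r" for r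
    by (simp add: ev_fract_def eh pK p)
  obtain p where "z = base_ev p" using K by (auto simp: K_def)
  then show ?thesis
    using K fK by (simp add: ext_base_ev[OF cu'] ext_base_ev[OF cu''] ev_altdef[OF u(1) lessI]
        ev_altdef[OF u(2) lessI] ext_sum[OF cu] eh f del: sum.lessThan_Suc)
qed

lemma curve_scale:
  assumes "curve u v" "\<alpha> ^ n = 1" "\<beta> ^ n = 1"
  shows "curve (fls_const \<alpha> * u) (fls_const \<beta> * v)"
proof -
  have \<alpha>: "\<alpha> \<noteq> 0" using assms n_pos by (auto simp: zero_power)
  have "fls_const \<alpha> * u \<noteq> fls_const k" for k
  proof
    assume "fls_const \<alpha> * u = fls_const k"
    then have "fls_const (inverse \<alpha>) * (fls_const \<alpha> * u) = fls_const (inverse \<alpha>) * fls_const k"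
      by simp
    then have "u = fls_const (inverse \<alpha> * k)" using \<alpha> by (simp flip: mult.assoc)
    then show False using assms(1) unfolding curve_def nonconst_def by blast
  qed
  then show ?thesis
    using assms by (simp add: curve_def nonconst_def power_mult_distrib flip: fls_const_power)
qed

definition aut :: "complex \<Rightarrow> complex \<Rightarrow> complex fls \<Rightarrow> complex fls" where
  "aut \<alpha> \<beta> = ext (fls_const \<alpha> * base_x) (fls_const \<beta> * fls_X)"

context
  fixes \<alpha> \<beta> :: complex
  assumes roots: "\<alpha> ^ n = 1" "\<beta> ^ n = 1"
begin

lemma curve_aut: "curve (fls_const \<alpha> * base_x) (fls_const \<beta> * fls_X)"
  by (rule curve_scale[OF curve_base roots])

lemmas aut_hom = ext_hom[OF curve_aut, folded aut_def]

lemma aut_K: "z \<in> K \<Longrightarrow> aut \<alpha> \<beta> z \<in> K"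
  unfolding aut_def by (rule ext_in_K[OF curve_aut]) auto

text \<open>Applying an automorphism to a function amounts to moving the branch. Orders of the image
  at a point are thus orders of the original at the moved point.\<close>

lemma ext_aut:
  assumes "curve u v" "z \<in> K"
  shows "ext u v (aut \<alpha> \<beta> z) = ext (fls_const \<alpha> * u) (fls_const \<beta> * v) z"
  using ext_ext[OF assms(1) curve_aut _ _ assms(2)] curve_scale[OF assms(1) roots]
  by (simp add: ext_hom[OF assms(1)] aut_def)

lemma on_curve_scale: "on_curve a b c \<Longrightarrow> on_curve (\<alpha> * a) (\<beta> * b) c"
  using roots n_pos by (auto simp: on_curve_def power_mult_distrib zero_power)

lemma branch_scale:
  assumes "branch a b c u v"
  shows "branch (\<alpha> * a) (\<beta> * b) c (fls_const \<alpha> * u) (fls_const \<beta> * v)"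
proof -
  obtain l where l: "specializes (l * u) a" "specializes (l * v) b" "specializes l c"
    using assms by (auto simp: branch_def)
  then have "specializes (l * (fls_const \<alpha> * u)) (\<alpha> * a)" "specializes (l * (fls_const \<beta> * v)) (\<beta> * b)"
    using specializes_mult[OF specializes_const] by (metis mult.left_commute)+
  then show ?thesis using l curve_scale[OF _ roots] assms unfolding branch_def by blast
qed

end

lemma uniformizing_scale:
  assumes cu: "curve u v" and "uniformizing u v" and roots: "\<alpha> ^ n = 1" "\<beta> ^ n = 1"
  shows "uniformizing (fls_const \<alpha> * u) (fls_const \<beta> * v)"
proof -
  obtain z where z: "z \<in> K" "fls_subdegree (ext u v z) = 1"
    using assms by (auto simp: uniformizing_def)
  have nz: "\<alpha> \<noteq> 0" "\<beta> \<noteq> 0" using roots n_pos by (auto simp: zero_power)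
  have roots': "inverse \<alpha> ^ n = 1" "inverse \<beta> ^ n = 1" using roots by (simp_all add: power_inverse)
  have cancel: "fls_const (inverse k) * (fls_const k * w) = w" if "k \<noteq> 0" for k and w :: "complex fls"
    using that by (simp flip: mult.assoc)
  have "ext (fls_const \<alpha> * u) (fls_const \<beta> * v) (aut (inverse \<alpha>) (inverse \<beta>) z) = ext u v z"
    unfolding ext_aut[OF roots' curve_scale[OF cu roots] z(1)] cancel[OF nz(1)] cancel[OF nz(2)] ..
  then show ?thesis unfolding uniformizing_def using z aut_K[OF roots'] by metis
qed

lemma val_aut:
  assumes oc: "on_curve a b c" and roots: "\<alpha> ^ n = 1" "\<beta> ^ n = 1" and z: "z \<in> K" "z \<noteq> 0"
  shows "val a b c (aut \<alpha> \<beta> z) = val (\<alpha> * a) (\<beta> * b) c z"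
proof -
  obtain u v where uv: "branch a b c u v" "uniformizing u v" using branch_exists oc by blast
  then have cu: "curve u v" by (simp add: branch_def)
  have "val (\<alpha> * a) (\<beta> * b) c z = fls_subdegree (ext (fls_const \<alpha> * u) (fls_const \<beta> * v) z)"
    by (rule val_branch) (fact on_curve_scale[OF roots oc] branch_scale[OF roots uv(1)]
      uniformizing_scale[OF cu uv(2) roots] z)+
  moreover have "aut \<alpha> \<beta> z \<noteq> 0" using z aut_hom(10)[OF roots] by simp
  ultimately show ?thesis
    using val_branch[OF oc uv aut_K[OF roots z(1)]] ext_aut[OF roots cu z(1)] by simp
qed

lemma val_cong: "proj_point a b c = proj_point a' b' c' \<Longrightarrow> val a b c = val a' b' c'"
  by (simp add: val_def fun_eq_iff)

section \<open>Functions without poles\<close>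

definition regular :: "complex fls \<Rightarrow> bool" where
  "regular z \<longleftrightarrow> z \<in> K \<and> (\<forall>a b c. on_curve a b c \<longrightarrow> z \<in> lring a b c)"

lemma regular_aut:
  assumes "regular z" and roots: "\<alpha> ^ n = 1" "\<beta> ^ n = 1"
  shows "regular (aut \<alpha> \<beta> z)"
proof (cases "z = 0")
  case True
  then show ?thesis using assms aut_hom(5)[OF roots] by simp
next
  case False
  have z: "z \<in> K" using assms by (simp add: regular_def)
  have "aut \<alpha> \<beta> z \<noteq> 0" using z False aut_hom(10)[OF roots] by simp
  then show ?thesis
    using assms z False aut_K[OF roots z] on_curve_scale[OF roots]
    by (auto simp: regular_def val_aut simp flip: val_nonneg_iff)
qed

text \<open>Orthogonality of the characters of a cyclic group; \<open>n - i\<close> plays the role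
  of the exponent \<open>-i\<close> within the natural numbers.\<close>

lemma sum_roots_of_unity:
  fixes \<zeta> :: complex
  assumes "\<zeta> ^ n = 1" "\<And>k. 0 < k \<Longrightarrow> k < n \<Longrightarrow> \<zeta> ^ k \<noteq> 1" and i: "i < n" "j < n"
  shows "(\<Sum>k<n. \<zeta> ^ ((n - i) * k) * \<zeta> ^ (j * k)) = (if i = j then of_nat n else 0)"
proof -
  define w where "w = \<zeta> ^ (n - i + j)"
  have "(\<Sum>k<n. \<zeta> ^ ((n - i) * k) * \<zeta> ^ (j * k)) = (\<Sum>k<n. w ^ k)"
    by (simp add: w_def algebra_simps flip: power_add power_mult)
  also have "\<dots> = (if i = j then of_nat n else 0)"
  proof (cases "i = j")
    case True
    then have "w = 1" using assms by (simp add: w_def)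
    then show ?thesis using True by simp
  next
    case False
    have "w \<noteq> 1"
    proof (cases "j < i")
      case True
      then show ?thesis using assms unfolding w_def by (intro assms(2)) auto
    next
      case F: False
      then have "w = \<zeta> ^ n * \<zeta> ^ (j - i)"
        using i by (simp add: w_def flip: power_add)
      then show ?thesis using assms False F by simp
    qed
    moreover have "w ^ n = 1"
      unfolding w_def using assms(1) by (metis mult.commute power_mult power_one)
    ultimately show ?thesis using False by (simp add: sum_gp_strict)
  qed
  finally show ?thesis .
qed

text \<open>A root \<alpha> of the reduced denominator produces a pole. Where y is nonzero above
  \<alpha>, the power of y is a unit. Where y vanishes, the denominator has order at least
  \<open>n\<close>, and the power of y compensates only \<open>i < n\<close>. With a constant
  denominator the order at infinity is minus the sum of \<open>degree p\<close> and
  \<open>i\<close>, so both are zero.\<close>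

lemma regular_term:
  assumes reg: "regular (ev_fract base_x r * fls_X ^ i)" and i: "i < n" and r: "r \<noteq> 0"
  shows "i = 0 \<and> (\<exists>k. ev_fract base_x r = fls_const k)"
proof -
  define p q where "p = fst (quot_of_fract r)" and "q = snd (quot_of_fract r)"
  have pq: "q \<noteq> 0" "coprime p q" "r = Fract p q" "p \<noteq> 0"
    using coprime_quot_of_fract[of r] r by (simp_all add: p_def q_def)
  have order: "fls_subdegree (ext u v (ev_fract base_x r * fls_X ^ i)) =
      fls_subdegree (ev_poly u p) - fls_subdegree (ev_poly u q) + int i * fls_subdegree v \<and>
      ev_poly u p \<noteq> 0 \<and> ev_poly u q \<noteq> 0"
    "fls_subdegree (ext u v (ev_fract base_x r * fls_X ^ i)) \<ge> 0"
    if "branch a b c u v" "on_curve a b c" for a b c u v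
  proof -
    have cu: "curve u v" using that by (simp add: branch_def)
    have u: "nonconst u" using cu by (simp add: curve_def)
    have fK: "ev_fract base_x r \<in> K"
      using K_closed(1)[of "[:r:]"] by (simp add: ev_hom nonconst_base)
    have v: "v \<noteq> 0" using ext_hom(10)[OF cu, of fls_X] by (simp add: ext_hom(9)[OF cu])
    have pq0: "ev_poly u p \<noteq> 0" "ev_poly u q \<noteq> 0" using pq u by (simp_all add: ev_poly_eq_0_iff)
    have "ext u v (ev_fract base_x r * fls_X ^ i) = ev_poly u p / ev_poly u q * v ^ i"
      using fK by (simp add: ext_hom[OF cu] pq(3) ev_fract_Fract[OF u pq(1)])
    then show "fls_subdegree (ext u v (ev_fract base_x r * fls_X ^ i)) =
      fls_subdegree (ev_poly u p) - fls_subdegree (ev_poly u q) + int i * fls_subdegree v \<and>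
      ev_poly u p \<noteq> 0 \<and> ev_poly u q \<noteq> 0"
      using pq0 v by (simp add: fls_divide_subdegree fls_subdegree_pow)
    show "fls_subdegree (ext u v (ev_fract base_x r * fls_X ^ i)) \<ge> 0"
      using reg that lring_iff[OF _ _ that(1)] unfolding regular_def on_curve_def by blast
  qed
  have no_root: "poly q \<alpha> \<noteq> 0" for \<alpha>
  proof
    assume "poly q \<alpha> = 0"
    then obtain q' where q': "q = [:-\<alpha>, 1:] * q'" by (metis dvdE poly_eq_0_iff_dvd)
    have "poly p \<alpha> \<noteq> 0"
    proof
      assume "poly p \<alpha> = 0"
      then have "[:-\<alpha>, 1:] dvd p" by (simp add: poly_eq_0_iff_dvd)
      moreover have "[:-\<alpha>, 1:] dvd q" unfolding q' by (rule dvd_triv_left)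
      ultimately have "is_unit [:-\<alpha>, 1:]" using pq(2) by (rule coprime_common_divisor[rotated])
      then show False by (simp add: is_unit_pCons_iff)
    qed
    obtain \<beta> where \<beta>: "\<beta> ^ n = 1 - \<alpha> ^ n" using nth_root_exists[OF n_pos] by blast
    then have oc: "on_curve \<alpha> \<beta> 1" by (simp add: on_curve_def)
    have q_sub: "fls_subdegree (ev_poly u q) \<ge> fls_subdegree (u - fls_const \<alpha>)"
      "fls_subdegree (ev_poly u p) = 0"
      if "specializes u \<alpha>" "ev_poly u q \<noteq> 0" for u
    proof -
      have eq: "ev_poly u q = (u - fls_const \<alpha>) * ev_poly u q'"
        by (simp add: q' del: mult_pCons_left)
      have "fls_subdegree (ev_poly u q') \<ge> 0"
        using specializes_poly[OF that(1)] specializes_iff_subdegree by blast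
      then show "fls_subdegree (ev_poly u q) \<ge> fls_subdegree (u - fls_const \<alpha>)"
        using that(2) unfolding eq by simp
      show "fls_subdegree (ev_poly u p) = 0"
        using specializes_subdegree_0(1)[OF specializes_poly[OF that(1)]] \<open>poly p \<alpha> \<noteq> 0\<close> by blast
    qed
    show False
    proof (cases "\<beta> = 0")
      case False
      then obtain v where v: "branch \<alpha> \<beta> 1 (fls_const \<alpha> + fls_X) v" "specializes v \<beta>"
        using branch_unramified[OF oc] by auto
      note o = order[OF v(1) oc]
      have "specializes fls_X 0" unfolding specializes_def by (intro exI[of _ fps_X]) simp
      then have "specializes (fls_const \<alpha> + fls_X) \<alpha>"
        using specializes_add[OF specializes_const] by fastforce
      then show False using q_sub[of "fls_const \<alpha> + fls_X"] o specializes_subdegree_0(1)[OF v(2) False]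
        by simp
    next
      case True
      then obtain u where u: "branch \<alpha> \<beta> 1 u fls_X" "u ^ n = 1 - fls_X ^ n" "specializes u \<alpha>"
        using branch_ramified[OF oc] by auto
      note o = order[OF u(1) oc]
      have "fls_subdegree (u - fls_const \<alpha>) = int n"
        using subdegree_minus_const(1)[OF u(2,3) n_pos] .
      then show False using q_sub[OF u(3)] o i by simp
    qed
  qed
  then have "degree q = 0" using alg_closed_imp_poly_has_root[of q] by blast
  then obtain k where k: "q = [:k:]" "k \<noteq> 0" using pq(1) by (metis degree_eq_zeroE pCons_0_0)
  obtain \<beta> where \<beta>: "\<beta> ^ n = - (1::complex)" using nth_root_exists[OF n_pos] by blast
  then have oc: "on_curve 1 \<beta> 0" using n_pos by (simp add: on_curve_def zero_power)
  then obtain s where s: "branch 1 \<beta> 0 (1 / fls_X) (s / fls_X)" "specializes s \<beta>" "\<beta> \<noteq> 0"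
    using branch_infinite[OF oc] by auto
  note o = order[OF s(1) oc]
  obtain A where A: "ev_poly (1 / fls_X) p = fls_const (lead_coeff p) * (\<Prod>a\<in>#A. 1 / fls_X - fls_const a)"
    "size A = degree p" using ev_poly_factors[OF pq(4)] by metis
  have inv_X: "fls_subdegree (1 / fls_X - fls_const a :: complex fls) = - 1" for a
    unfolding inverse_eq_divide[symmetric] fls_inverse_X by (rule fls_subdegree_eqI) auto
  have "(\<Prod>a\<in>#A. 1 / fls_X - fls_const a) \<noteq> (0 :: complex fls) \<and>
      fls_subdegree (\<Prod>a\<in>#A. 1 / fls_X - fls_const a :: complex fls) = - int (size A)"
  proof (induction A)
    case (add x A)
    moreover have "1 / fls_X - fls_const x \<noteq> (0 :: complex fls)" using inv_X[of x] by auto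
    ultimately show ?case using inv_X[of x] by simp
  qed simp
  then have "fls_subdegree (ev_poly (1 / fls_X) p) = - int (degree p)"
    using A pq(4) by simp
  moreover have "fls_subdegree (s / fls_X) = - 1"
    using specializes_subdegree_0[OF s(2,3)] by (simp add: fls_divide_subdegree)
  ultimately have "- int (degree p) - int i \<ge> 0" using o k by simp
  then have "degree p = 0" "i = 0" by simp_all
  moreover from this obtain m where "p = [:m:]" by (auto elim: degree_eq_zeroE)
  ultimately have "ev_fract base_x r = fls_const (m / k)"
    using pq k by (simp add: ev_fract_Fract[OF nonconst_base] fls_const_divide_const)
  then show ?thesis using \<open>i = 0\<close> by blast
qed

text \<open>Averaging over the automorphisms \<open>y \<mapsto> \<zeta>\<^sup>k y\<close> isolates the terms \<open>f\<^sub>i(x) y\<^sup>i\<close> of a function;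
  each of them is again regular, hence constant.\<close>

theorem regular_imp_const:
  assumes reg: "regular z" and \<zeta>: "\<zeta> ^ n = 1" "\<And>k. 0 < k \<Longrightarrow> k < n \<Longrightarrow> \<zeta> ^ k \<noteq> (1::complex)"
  obtains k where "z = fls_const k"
proof -
  have "z \<in> K" using reg by (simp add: regular_def)
  then obtain p' where p': "z = base_ev p'" by (auto simp: K_def)
  define p where "p = p' mod M"
  have p: "z = base_ev p" "degree p < n"
    using p' by (simp_all add: p_def base_ev_mod_M degree_mod_M)
  define w where "w i = ev_fract base_x (coeff p i) * fls_X ^ i" for i
  have fK: "ev_fract base_x r \<in> K" for r
    using K_closed(1)[of "[:r:]"] by (simp add: ev_hom nonconst_base)
  have z: "z = (\<Sum>i<n. w i)" by (simp add: p ev_altdef[OF nonconst_base p(2)] w_def)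
  have rk: "(\<zeta> ^ k) ^ n = 1" for k using \<zeta>(1) by (metis mult.commute power_mult power_one)
  have aut_z: "aut 1 (\<zeta> ^ k) z = (\<Sum>j<n. fls_const (\<zeta> ^ (j * k)) * w j)" for k
  proof -
    have cu: "curve base_x (fls_const (\<zeta> ^ k) * fls_X)"
      using curve_aut[of 1 "\<zeta> ^ k"] rk by simp
    have "aut 1 (\<zeta> ^ k) z = ext base_x (fls_const (\<zeta> ^ k) * fls_X) (\<Sum>j<n. w j)"
      by (simp add: aut_def z)
    also have "\<dots> = (\<Sum>j<n. ev_fract base_x (coeff p j) * (fls_const (\<zeta> ^ k) * fls_X) ^ j)"
      unfolding w_def using fK
        by (subst ext_sum[OF cu]) (auto simp: ext_hom[OF cu] intro!: sum.cong)
    also have "\<dots> = (\<Sum>j<n. fls_const (\<zeta> ^ (j * k)) * w j)"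
      by (intro sum.cong refl)
        (simp add: w_def power_mult_distrib mult.commute[of _ k] power_mult flip: fls_const_power)
    finally show ?thesis .
  qed
  have avg: "fls_const (of_nat n) * w i = (\<Sum>k<n. fls_const (\<zeta> ^ ((n - i) * k)) * aut 1 (\<zeta> ^ k) z)"
    if i: "i < n" for i
  proof -
    have "(\<Sum>k<n. fls_const (\<zeta> ^ ((n - i) * k)) * aut 1 (\<zeta> ^ k) z)
      = (\<Sum>k<n. \<Sum>j<n. fls_const (\<zeta> ^ ((n - i) * k) * \<zeta> ^ (j * k)) * w j)"
      unfolding aut_z by (simp add: sum_distrib_left mult.assoc flip: fls_const_mult_const)
    also have "\<dots> = (\<Sum>j<n. \<Sum>k<n. fls_const (\<zeta> ^ ((n - i) * k) * \<zeta> ^ (j * k)) * w j)"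
      by (rule sum.swap)
    also have "\<dots> = (\<Sum>j<n. fls_const (\<Sum>k<n. \<zeta> ^ ((n - i) * k) * \<zeta> ^ (j * k)) * w j)"
    proof (intro sum.cong refl)
      fix j
      have "(\<Sum>k\<in>I. fls_const (f k) :: complex fls) = fls_const (sum f I)" for f and I :: "nat set"
        by (induction I rule: infinite_finite_induct) (simp_all add: fls_plus_const)
      then show "(\<Sum>k<n. fls_const (\<zeta> ^ ((n - i) * k) * \<zeta> ^ (j * k)) * w j)
          = fls_const (\<Sum>k<n. \<zeta> ^ ((n - i) * k) * \<zeta> ^ (j * k)) * w j"
        by (simp flip: sum_distrib_right)
    qed
    also have "\<dots> = (\<Sum>j<n. if j = i then fls_const (of_nat n) * w i else 0)"
      by (intro sum.cong refl) (use i sum_roots_of_unity[OF \<zeta>] in auto)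
    finally show ?thesis using i by simp
  qed
  have reg_w: "regular (w i)" if i: "i < n" for i
  proof -
    have "w i = fls_const (1 / of_nat n) * (fls_const (of_nat n) * w i)"
      using n_pos by (simp flip: mult.assoc)
    then have eq: "w i = (\<Sum>k<n. fls_const (1 / of_nat n * \<zeta> ^ ((n - i) * k)) * aut 1 (\<zeta> ^ k) z)"
      by (simp only: avg[OF i] sum_distrib_left mult.assoc fls_const_mult_const[symmetric])
    have "regular (aut 1 (\<zeta> ^ k) z)" for k
      by (rule regular_aut[OF reg]) (simp_all add: rk)
    then show ?thesis
      unfolding regular_def eq by (blast intro: lring_sum lring_add_mult lring_const K_sum K_closed)
  qed
  have "\<exists>k. w i = fls_const k" if i: "i < n" for i
  proof (cases "coeff p i = 0")
    case True
    then have "w i = fls_const 0" by (simp add: w_def ev_fract_hom[OF nonconst_base])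
    then show ?thesis by blast
  next
    case False
    then show ?thesis
      using regular_term[OF reg_w[OF i, unfolded w_def] i] by (auto simp: w_def)
  qed
  then obtain f where "\<And>i. i < n \<Longrightarrow> w i = fls_const (f i)" by metis
  moreover have "\<exists>k. (\<Sum>i<m. fls_const (f i) :: complex fls) = fls_const k" for m
    by (induction m) (auto intro: exI[of _ 0] simp: fls_plus_const)
  ultimately show thesis using that z by auto
qed

lemma val_nonneg_imp_const:
  assumes z: "z \<in> K" "z \<noteq> 0" "\<And>a b c. on_curve a b c \<Longrightarrow> val a b c z \<ge> 0"
    and \<zeta>: "\<zeta> ^ n = 1" "\<And>k. 0 < k \<Longrightarrow> k < n \<Longrightarrow> \<zeta> ^ k \<noteq> (1::complex)"
  obtains k where "z = fls_const k" "k \<noteq> 0"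
proof -
  have "regular z" unfolding regular_def using z val_nonneg_iff by blast
  then show thesis using regular_imp_const[OF _ \<zeta>] that z by (metis fls_const_0)
qed

text \<open>An automorphism that fixes a point acts on a local unit without changing its value there, so
  its eigenvalue on an eigenfunction depends only on the order of that function at the point.\<close>

lemma eigenvalue_at_fixed_point:
  assumes oc: "on_curve a b c" and roots: "\<alpha> ^ n = 1" "\<beta> ^ n = 1"
    and fixed: "\<alpha> * a = \<gamma> * a" "\<beta> * b = \<gamma> * b" "c = \<gamma> * c" "\<gamma> \<noteq> 0"
    and t: "t \<in> K" "t \<noteq> 0" "val a b c t = 1" "aut \<alpha> \<beta> t = fls_const \<chi> * t"
    and z: "z \<in> K" "z \<noteq> 0" "aut \<alpha> \<beta> z = fls_const \<omega> * z"
  shows "\<omega> = \<chi> powi val a b c z"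
proof -
  note ah = aut_hom[OF roots]
  have "aut \<alpha> \<beta> t \<noteq> 0" using ah(10)[OF t(1)] t(2) by blast
  then have \<chi>: "\<chi> \<noteq> 0" using t by (metis fls_const_0 mult_zero_left)
  define k where "k = val a b c z"
  \<comment> \<open>The power of \<open>t\<close> with the same order as \<open>z\<close>, so that
    \<open>z / s\<close> has a nonzero value at the point.\<close>
  obtain s where s: "s \<in> K" "s \<noteq> 0" "val a b c s = k" "aut \<alpha> \<beta> s = fls_const (\<chi> powi k) * s"
  proof (cases "k \<ge> 0")
    case True
    have "aut \<alpha> \<beta> (t ^ nat k) = fls_const (\<chi> powi k) * t ^ nat k"
      using True t by (simp add: ah power_mult_distrib power_int_def fls_const_power)
    then show ?thesis using that[of "t ^ nat k"] t True val_power[OF oc] by auto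
  next
    case False
    have "aut \<alpha> \<beta> (inverse (t ^ nat (- k))) = fls_const (\<chi> powi k) * inverse (t ^ nat (- k))"
      using False t \<chi>
      by (simp add: ah power_mult_distrib power_int_def power_inverse fls_const_power
          flip: fls_inverse_const)
    then show ?thesis
      using that[of "inverse (t ^ nat (- k))"] t False val_power[OF oc] val_inverse[OF oc] by auto
  qed
  define e where "e = z / s"
  have e: "e \<in> K" "e \<noteq> 0" using z s by (simp_all add: e_def)
  have "val a b c e = 0" using val_divide[OF oc] z s by (simp add: e_def k_def)
  then have lr: "e \<in> lring a b c" using val_nonneg_iff[OF oc e] by simp
  have "aut \<alpha> \<beta> e = fls_const \<omega> * z / (fls_const (\<chi> powi k) * s)"
    using z s by (simp add: e_def ah)
  also have "\<dots> = fls_const \<omega> / fls_const (\<chi> powi k) * e"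
    using \<chi> s by (simp add: e_def)
  finally have aut_e: "aut \<alpha> \<beta> e = fls_const (\<omega> / \<chi> powi k) * e"
    by (simp add: fls_const_divide_const)
  obtain u v where uv: "branch a b c u v" "uniformizing u v" using branch_exists oc by blast
  then have cu: "curve u v" by (simp add: branch_def)
  \<comment> \<open>The moved branch lies over the same projective point; the factor \<gamma>
    between the coordinate triples is then absorbed into the scaling \<open>l\<close>. A value of
    \<open>e\<close> taken along either branch is therefore the same.\<close>
  have "branch (\<gamma> * a) (\<gamma> * b) (\<gamma> * c) (fls_const \<alpha> * u) (fls_const \<beta> * v)"
    using branch_scale[OF roots uv(1)] unfolding fixed(1,2) fixed(3)[symmetric] .
  then obtain l where l: "curve (fls_const \<alpha> * u) (fls_const \<beta> * v)"
    "specializes (l * (fls_const \<alpha> * u)) (\<gamma> * a)" "specializes (l * (fls_const \<beta> * v)) (\<gamma> * b)" "specializes l (\<gamma> * c)"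
    by (auto simp: branch_def)
  have descale: "specializes (fls_const (inverse \<gamma>) * w) d" if "specializes w (\<gamma> * d)" for w d
  proof -
    have "inverse \<gamma> * (\<gamma> * d) = d" using fixed(4) by simp
    then show ?thesis using specializes_mult[OF specializes_const[of "inverse \<gamma>"] that]
      by (simp only:)
  qed
  have "branch a b c (fls_const \<alpha> * u) (fls_const \<beta> * v)"
    unfolding branch_def using l(1) descale[OF l(2)] descale[OF l(3)] descale[OF l(4)]
    by (auto simp: mult.assoc intro!: exI[of _ "fls_const (inverse \<gamma>) * l"])
  moreover obtain e0 where e0: "\<And>u v. branch a b c u v \<Longrightarrow> specializes (ext u v e) e0"
    using lring_spec[OF lr] by blast
  ultimately have "specializes (ext (fls_const \<alpha> * u) (fls_const \<beta> * v) e) e0" by blast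
  then have "specializes (ext u v (fls_const (\<omega> / \<chi> powi k) * e)) e0"
    using ext_aut[OF roots cu e(1)] aut_e by simp
  moreover have "specializes (ext u v (fls_const (\<omega> / \<chi> powi k) * e)) (\<omega> / \<chi> powi k * e0)"
    unfolding ext_hom(2)[OF cu K_closed(4) e(1)] ext_hom(7)[OF cu]
    by (intro specializes_mult specializes_const e0 uv)
  ultimately have "\<omega> / \<chi> powi k * e0 = e0" using specializes_unique by blast
  moreover have "e0 \<noteq> 0"
  proof
    assume "e0 = 0"
    then have "fls_subdegree (ext u v e) > 0"
      using specializes_0_subdegree[of "ext u v e"] e0[OF uv(1)] e ext_hom(10)[OF cu] by simp
    then show False using val_branch[OF oc uv e] \<open>val a b c e = 0\<close> by simp
  qed
  ultimately show ?thesis using \<chi> by (simp add: k_def field_simps)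
qed

end

section \<open>Norms of periodic integer sequences that are quadratic modulo the period\<close>

lemma sum_periodic_shift:
  fixes f :: "nat \<Rightarrow> int"
  assumes "\<And>j. f (j + n) = f j"
  shows "(\<Sum>j<n. f (j + k)) = (\<Sum>j<n. f j)"
proof (induction k)
  case (Suc k)
  have "(\<Sum>j<n. f (j + Suc k)) + f k = (\<Sum>j<Suc n. f (j + k))"
    by (subst sum.lessThan_Suc_shift) simp
  also have "\<dots> = (\<Sum>j<n. f (j + k)) + f k"
    using assms[of k] by (simp add: add.commute)
  finally show ?case using Suc by simp
qed simp

lemma sum_squares_shift:
  fixes f :: "nat \<Rightarrow> int"
  assumes "\<And>j. f (j + n) = f j"
  shows "(\<Sum>j<n. (f (j + k))\<^sup>2) = (\<Sum>j<n. (f j)\<^sup>2)"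
  using sum_periodic_shift[of "\<lambda>j. (f j)\<^sup>2" n k] assms by simp

text \<open>Since \<open>D j\<close> is \<open>c\<close> modulo \<open>n\<close>, it does not lie strictly between \<open>c - n\<close> and \<open>c\<close>.\<close>

lemma sum_squares_residue:
  fixes D :: "nat \<Rightarrow> int"
  assumes "(\<Sum>j<n. D j) = 0" "\<And>j. int n dvd D j - c"
  shows "int n * (c * (int n - c)) \<le> (\<Sum>j<n. (D j)\<^sup>2)"
proof -
  \<comment> \<open>The quadratic inequality is arranged so that \<open>D j\<close> otherwise occurs
    only linearly: the linear terms cancel over a period.\<close>
  have "(2 * c - int n) * D j + c * (int n - c) \<le> (D j)\<^sup>2" for j
  proof -
    obtain q where q: "D j - c = int n * q" using assms(2) by (meson dvdE)
    have "0 \<le> q * (q + 1)" by (cases "q \<ge> 0") (auto simp: mult_nonpos_nonpos)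
    then have "0 \<le> (int n)\<^sup>2 * (q * (q + 1))" by simp
    also have "\<dots> = (D j - c) * (D j - c + int n)"
      unfolding q by (simp add: algebra_simps power2_eq_square)
    finally show ?thesis by (simp add: algebra_simps power2_eq_square)
  qed
  then have "(\<Sum>j<n. (2 * c - int n) * D j + c * (int n - c)) \<le> (\<Sum>j<n. (D j)\<^sup>2)"
    by (intro sum_mono) auto
  then show ?thesis using assms(1) by (simp add: sum.distrib flip: sum_distrib_left)
qed

text \<open>Differences of a periodic sequence sum to zero, so the residue bound applies to them.
  The factor 4 is the cost of \<open>(a - b)\<^sup>2 \<le> 2 * a\<^sup>2 + 2 * b\<^sup>2\<close>
  together with shift invariance.\<close>

lemma first_difference_bound:
  fixes f :: "nat \<Rightarrow> int"
  assumes per: "\<And>j. f (j + n) = f j" and "\<And>j. int n dvd f (j + l) - f j - c"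
  shows "int n * (c * (int n - c)) \<le> 4 * (\<Sum>j<n. (f j)\<^sup>2)"
proof -
  have "int n * (c * (int n - c)) \<le> (\<Sum>j<n. (f (j + l) - f j)\<^sup>2)"
    using sum_periodic_shift[of f n l, OF per] assms(2)
    by (intro sum_squares_residue) (simp_all add: sum_subtractf)
  also have "\<dots> \<le> (\<Sum>j<n. 2 * (f (j + l))\<^sup>2 + 2 * (f j)\<^sup>2)"
  proof (rule sum_mono)
    fix j
    have "0 \<le> (f (j + l) + f j)\<^sup>2" by simp
    then show "(f (j + l) - f j)\<^sup>2 \<le> 2 * (f (j + l))\<^sup>2 + 2 * (f j)\<^sup>2"
      by (simp add: power2_eq_square algebra_simps)
  qed
  also have "\<dots> = 4 * (\<Sum>j<n. (f j)\<^sup>2)"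
    using sum_squares_shift[of f n l, OF per] by (simp add: sum.distrib flip: sum_distrib_left)
  finally show ?thesis .
qed

text \<open>The mixed difference with steps \<open>l\<close> and 1 is a sum of \<open>l\<close>
  consecutive second differences, so it is congruent to \<open>l * m\<close>. The freedom in
  \<open>l\<close> allows moving the residue away from 0, where the bound is weak. Four terms of
  weight 4 give the factor 16.\<close>

lemma second_difference_bound:
  fixes f :: "nat \<Rightarrow> int"
  assumes per: "\<And>j. f (j + n) = f j" and m: "\<And>j. int n dvd f (j + 2) - 2 * f (j + 1) + f j - m"
    and c: "int n dvd int l * m - c"
  shows "int n * (c * (int n - c)) \<le> 16 * (\<Sum>j<n. (f j)\<^sup>2)"
proof -
  define D where "D j = f (j + (l + 1)) - f (j + l) - f (j + 1) + f j" for j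
  have "int n dvd f (j + (k + 1)) - f (j + k) - f (j + 1) + f j - int k * m" for j k
  proof (induction k)
    case (Suc k)
    have "int n dvd (f (j + (k + 1)) - f (j + k) - f (j + 1) + f j - int k * m)
        + (f (j + k + 2) - 2 * f (j + k + 1) + f (j + k) - m)"
      by (rule dvd_add[OF Suc m])
    then show ?case by (simp add: algebra_simps)
  qed simp
  then have D: "int n dvd D j - c" for j
    using dvd_add[OF _ c, of "D j - int l * m"] by (simp add: D_def algebra_simps)
  have "int n * (c * (int n - c)) \<le> (\<Sum>j<n. (D j)\<^sup>2)"
    using sum_periodic_shift[of f n, OF per] D
    by (intro sum_squares_residue) (simp_all only: D_def sum.distrib sum_subtractf)
  also have "\<dots> \<le> (\<Sum>j<n. 4 * (f (j + (l + 1)))\<^sup>2 + 4 * (f (j + l))\<^sup>2 + 4 * (f (j + 1))\<^sup>2 + 4 * (f j)\<^sup>2)"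
  proof (rule sum_mono)
    fix j
    have "(a - b - c + d)\<^sup>2 \<le> 4 * a\<^sup>2 + 4 * b\<^sup>2 + 4 * c\<^sup>2 + 4 * d\<^sup>2" for a b c d :: int
    proof -
      \<comment> \<open>Lagrange's identity for the sign vector (1, -1, -1, 1): these six squares
        add up exactly to the difference of the two sides.\<close>
      have "0 \<le> (a + b)\<^sup>2 + (a + c)\<^sup>2 + (a - d)\<^sup>2 + (b - c)\<^sup>2 + (b + d)\<^sup>2 + (c + d)\<^sup>2" by simp
      then show ?thesis by (simp add: power2_eq_square algebra_simps)
    qed
    then show "(D j)\<^sup>2 \<le> 4 * (f (j + (l + 1)))\<^sup>2 + 4 * (f (j + l))\<^sup>2 + 4 * (f (j + 1))\<^sup>2 + 4 * (f j)\<^sup>2"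
      unfolding D_def .
  qed
  also have "\<dots> = 16 * (\<Sum>j<n. (f j)\<^sup>2)"
    unfolding sum.distrib sum_distrib_left[symmetric] sum_squares_shift[of f n, OF per] by simp
  finally show ?thesis .
qed

text \<open>The constant 11 is the least integer for which three sequences bounded by
  \<open>11 * n / 16\<close> reach \<open>2 * n\<close>. For \<open>n\<close> at least 8 every
  residue other than 0, 1, -1 qualifies, and those two nonzero residues are doubled. For
  \<open>n = 7\<close> only 3 and 4 qualify, which takes multiples up to 3.\<close>

lemma large_multiple:
  assumes n: "n \<ge> 7" and m: "\<not> int n dvd m"
  obtains l c where "int n dvd int l * m - c" "c * (int n - c) \<ge> 11"
proof -
  define c where "c = m mod int n"
  have c: "0 < c" "c < int n" and dvd: "int n dvd m - c"
    using n m by (auto simp: c_def dvd_eq_mod_eq_0 minus_mod_eq_mult_div intro: le_neq_trans)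
  have prod: "k * (int n - k) \<le> d * (int n - d)" if "k \<le> d" "d \<le> int n - k" "0 \<le> k" for k d
  proof -
    have "0 \<le> (d - k) * (int n - k - d)" using that by (intro mult_nonneg_nonneg) auto
    then show ?thesis by (simp add: algebra_simps)
  qed
  have dvd2: "int n dvd int 2 * m - 2 * c" and dvd3: "int n dvd int 3 * m - 3 * c"
    using dvd_mult[OF dvd, of 2] dvd_mult[OF dvd, of 3] by (simp_all add: algebra_simps)
  have dvd2': "int n dvd int 2 * m - (2 * c - int n)"
    using dvd_add[OF dvd2 dvd_refl] by (simp add: algebra_simps)
  have dvd3': "int n dvd int 3 * m - (3 * c - int n)" "int n dvd int 3 * m - (3 * c - 2 * int n)"
    using dvd_add[OF dvd3 dvd_refl] dvd_add[OF dvd3 dvd_triv_right[of "int n" 2]]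
    by (simp_all add: algebra_simps)
  show thesis
  proof (cases "n \<ge> 8")
    case True
    consider "c = 1" | "c = int n - 1" | "2 \<le> c" "c \<le> int n - 2" using c by linarith
    then show thesis
    proof cases
      case 1
      then show thesis using that[OF dvd2] True by simp
    next
      case 2
      then show thesis using that[OF dvd2'] True by simp
    next
      case 3
      then show thesis using that[of 1 c] dvd prod[of 2 c] True by simp
    qed
  next
    case False
    then have "n = 7" using n by simp
    moreover from this have "c \<in> {1, 2, 3, 4, 5, 6}" using c by auto
    ultimately show thesis
      using that[of 1 c] that[OF dvd2] that[OF dvd2'] that[OF dvd3] that[OF dvd3'(2)] dvd by auto
  qed
qed

lemma entry_sq_le: "(i::nat) < n \<Longrightarrow> (f i)\<^sup>2 \<le> (\<Sum>j<n. (f j :: int)\<^sup>2)"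
  by (rule member_le_sum) auto

lemma square_less_4_cases:
  fixes x :: int
  assumes "x\<^sup>2 < 4"
  shows "x = -1 \<or> x = 0 \<or> x = 1"
proof -
  have "\<bar>x\<bar> < 2" using assms abs_le_square_iff[of 2 x] by simp
  then show ?thesis by linarith
qed

text \<open>All entries lie in {-1, 0, 1}, which leaves a finite check. The exception is real: 1, 0,
  1, 0 has second differences 2 and -2, which agree modulo 4.\<close>

lemma quadratic_small_period:
  fixes f :: "nat \<Rightarrow> int"
  assumes per: "\<And>j. f (j + n) = f j" and m: "\<And>j. int n dvd f (j + 2) - 2 * f (j + 1) + f j - m"
    and nz: "\<not> int n dvd m" and n: "n \<in> {4, 5, 6}" and small: "(\<Sum>j<n. (f j)\<^sup>2) < 4"
  shows "n = 4 \<and> (\<Sum>j<n. (f j)\<^sup>2) = 2 \<and> (\<Sum>j<n. f j) \<in> {2, -2}"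
proof -
  have f: "f i = -1 \<or> f i = 0 \<or> f i = 1" if "i < n" for i
    using entry_sq_le[OF that, of f] small by (intro square_less_4_cases) simp
  \<comment> \<open>Subtracting the instance at 0 eliminates \<open>m\<close> and leaves conditions
    on the entries alone.\<close>
  have eq: "int n dvd (f (j + 2) - 2 * f (j + 1) + f j) - (f 2 - 2 * f 1 + f 0)" for j
    using dvd_diff[OF m[of j] m[of 0]] by (simp add: algebra_simps numeral_2_eq_2)
  have nz': "\<not> int n dvd f 2 - 2 * f 1 + f 0"
  proof
    assume "int n dvd f 2 - 2 * f 1 + f 0"
    from dvd_diff[OF this m[of 0]] show False using nz by (simp add: numeral_2_eq_2)
  qed
  consider "n = 4" | "n = 5" | "n = 6" using n by auto
  then show ?thesis
  proof cases
    case 1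
    then show ?thesis
      using f[of 0] f[of 1] f[of 2] f[of 3] eq[of 1] eq[of 2] eq[of 3] nz' small
        per[of 0] per[of 1]
      by (simp add: eval_nat_numeral) (elim disjE; simp)
  next
    case 2
    then show ?thesis
      using f[of 0] f[of 1] f[of 2] f[of 3] f[of 4] eq[of 1] eq[of 2] eq[of 3] eq[of 4] nz' small
        per[of 0] per[of 1]
      by (simp add: eval_nat_numeral) (elim disjE; simp)
  next
    case 3
    then show ?thesis
      using f[of 0] f[of 1] f[of 2] f[of 3] f[of 4] f[of 5] eq[of 1] eq[of 2] eq[of 3] eq[of 4]
        eq[of 5] nz' small per[of 0] per[of 1]
      by (simp add: eval_nat_numeral) (elim disjE; simp)
  qed
qed

lemma sum_squares_ge_period:
  fixes f :: "nat \<Rightarrow> int"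
  assumes "\<And>j. j < n \<Longrightarrow> f j \<noteq> 0"
  shows "int n \<le> (\<Sum>j<n. (f j)\<^sup>2)"
proof -
  have "1 \<le> (f j)\<^sup>2" if "j < n" for j using assms[OF that] by (simp add: int_one_le_iff_zero_less)
  then have "(\<Sum>j<n. 1) \<le> (\<Sum>j<n. (f j)\<^sup>2)" by (intro sum_mono) auto
  then show ?thesis by simp
qed

lemma sum_squares_dvd:
  fixes f :: "nat \<Rightarrow> int"
  assumes "int n dvd f i" "f i \<noteq> 0" "i < n"
  shows "int n * int n \<le> (\<Sum>j<n. (f j)\<^sup>2)"
proof -
  have "int n \<le> \<bar>f i\<bar>" using dvd_imp_le_int[OF assms(2,1)] by simp
  then have "int n * int n \<le> \<bar>f i\<bar> * \<bar>f i\<bar>" by (intro mult_mono) auto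
  then show ?thesis using entry_sq_le[OF assms(3), of f] by (simp add: power2_eq_square)
qed

text \<open>If \<open>d\<close> vanishes modulo \<open>n\<close>, the residues are constant: either
  no entry is zero, or a nonzero entry is a multiple of \<open>n\<close>. Otherwise the first
  difference bound suffices as soon as \<open>c * (n - c)\<close> is at least 4. As this product is
  at least \<open>n - 1\<close>, only \<open>n = 4\<close> with odd \<open>c\<close>
  escapes.\<close>

lemma linear_bound:
  fixes f :: "nat \<Rightarrow> int"
  assumes n: "n \<ge> 4" and per: "\<And>j. f (j + n) = f j" and d: "\<And>j. int n dvd f (j + 1) - f j - d"
    and nz: "i < n" "f i \<noteq> 0"
  shows "int n \<le> (\<Sum>j<n. (f j)\<^sup>2)"
proof (cases "int n dvd d")
  case True
  have "int n dvd f j - f 0" for j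
  proof (induction j)
    case (Suc j)
    have "int n dvd f (j + 1) - f j"
      using dvd_add[OF d True] by simp
    from dvd_add[OF this Suc] show ?case by simp
  qed simp
  note const = this
  show ?thesis
  proof (cases "int n dvd f 0")
    case True
    then have "int n dvd f i" using dvd_add[OF const[of i] True] by simp
    then have "int n * int n \<le> (\<Sum>j<n. (f j)\<^sup>2)" using sum_squares_dvd nz by blast
    moreover have "int n \<le> int n * int n" using n by simp
    ultimately show ?thesis by linarith
  next
    case False
    have "f j \<noteq> 0" for j
    proof
      assume "f j = 0"
      then show False using const[of j] False by simp
    qed
    then show ?thesis by (intro sum_squares_ge_period)
  qed
next
  case False
  define c where "c = d mod int n"
  have c: "0 < c" "c < int n"
    using n False by (auto simp: c_def dvd_eq_mod_eq_0 intro: le_neq_trans)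
  have dc: "int n dvd d - c" by (simp add: c_def minus_mod_eq_mult_div)
  have 1: "int n dvd f (j + 1) - f j - c" for j
    using dvd_add[OF d[of j] dc] by (simp add: algebra_simps)
  have "int n * 4 \<le> 4 * (\<Sum>j<n. (f j)\<^sup>2)"
  proof (cases "4 \<le> c * (int n - c)")
    case True
    then have "int n * 4 \<le> int n * (c * (int n - c))" by (intro mult_left_mono) auto
    then show ?thesis using first_difference_bound[of f n, OF per 1] by linarith
  next
    case False
    have "0 \<le> (c - 1) * (int n - 1 - c)" using c by (intro mult_nonneg_nonneg) auto
    then have "int n - 1 \<le> c * (int n - c)" by (simp add: algebra_simps)
    then have n4: "n = 4" using False n by linarith
    then have "c \<in> {1, 2, 3}" using c by auto
    then have c13: "c = 1 \<or> c = 3" using False n4 by auto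
    \<comment> \<open>Steps of length 2 repair the escaping case: the residue becomes 2, and 2 * (4
      - 2) is the required 4.\<close>
    have "int n dvd f (j + 2) - f j - 2 * c" for j
      using dvd_add[OF 1[of j] 1[of "j + 1"]] by (simp add: algebra_simps)
    moreover have "int n dvd 2 * c - 2" using c13 n4 by auto
    ultimately have "int n dvd (f (j + 2) - f j - 2 * c) + (2 * c - 2)" for j
      by (rule dvd_add)
    then have "int n dvd f (j + 2) - f j - 2" for j by (simp add: algebra_simps)
    from first_difference_bound[of f n, OF per this] show ?thesis using n4 by simp
  qed
  then show ?thesis by simp
qed

text \<open>The vanishing sum doubles the trivial bound. With a residue nonzero modulo
  \<open>n\<close>, either all entries are at least 2 in absolute value, or some entry is 1 or -1.
  In the latter case not all entries are equal, so another one differs from it by at least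
  \<open>n\<close>, and its square alone is at least \<open>(n - 1)\<^sup>2\<close>.\<close>

lemma constant_residue_bound:
  fixes f :: "nat \<Rightarrow> int"
  assumes n: "n \<ge> 4" and const: "\<And>j. int n dvd f j - f 0"
    and nz: "i < n" "f i \<noteq> 0" and sum0: "(\<Sum>j<n. f j) = 0"
  shows "2 * int n \<le> (\<Sum>j<n. (f j)\<^sup>2)"
proof (cases "int n dvd f 0")
  case True
  then have "int n dvd f i" using dvd_add[OF const[of i] True] by simp
  then have "int n * int n \<le> (\<Sum>j<n. (f j)\<^sup>2)" using sum_squares_dvd nz by blast
  moreover have "2 * int n \<le> int n * int n" using n by (intro mult_right_mono) auto
  ultimately show ?thesis by linarith
next
  case False
  have f0: "f j \<noteq> 0" for j
  proof
    assume "f j = 0"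
    then show False using const[of j] False by simp
  qed
  show ?thesis
  proof (cases "\<exists>k<n. \<bar>f k\<bar> = 1")
    case False
    have "4 \<le> (f j)\<^sup>2" if "j < n" for j
    proof -
      have "2 \<le> \<bar>f j\<bar>" using f0[of j] False that by fastforce
      then show ?thesis using abs_le_square_iff[of 2 "f j"] by simp
    qed
    then have "(\<Sum>j<n. 4) \<le> (\<Sum>j<n. (f j)\<^sup>2)" by (intro sum_mono) auto
    then show ?thesis by simp
  next
    case True
    then obtain k where k: "k < n" "\<bar>f k\<bar> = 1" by blast
    have "\<exists>j<n. f j \<noteq> f k"
    proof (rule ccontr)
      assume "\<not> ?thesis"
      then have "(\<Sum>j<n. f j) = (\<Sum>j<n. f k)" by (intro sum.cong) auto
      then show False using sum0 k n by simp
    qed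
    then obtain j where j: "j < n" "f j \<noteq> f k" by blast
    have "int n dvd f j - f k" using dvd_diff[OF const[of j] const[of k]] by simp
    then have "int n \<le> \<bar>f j - f k\<bar>" using dvd_imp_le_int[of "f j - f k" "int n"] j by simp
    then have "int n - 1 \<le> \<bar>f j\<bar>" using k by linarith
    then have "(int n - 1) * (int n - 1) \<le> \<bar>f j\<bar> * \<bar>f j\<bar>" using n by (intro mult_mono) auto
    then have fj: "(int n - 1) * (int n - 1) \<le> (f j)\<^sup>2" by (simp add: power2_eq_square)
    have "(\<Sum>i\<in>{..<n} - {j}. 1) \<le> (\<Sum>i\<in>{..<n} - {j}. (f i)\<^sup>2)"
      using f0 by (intro sum_mono) (simp add: int_one_le_iff_zero_less)
    moreover have "(\<Sum>i\<in>{..<n} - {j}. 1) = int n - 1" using j n by simp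
    moreover have "(\<Sum>i<n. (f i)\<^sup>2) = (f j)\<^sup>2 + (\<Sum>i\<in>{..<n} - {j}. (f i)\<^sup>2)"
      using j by (intro sum.remove) auto
    ultimately have "(int n - 1) * (int n - 1) + (int n - 1) \<le> (\<Sum>i<n. (f i)\<^sup>2)"
      using fj by linarith
    moreover have "2 * int n \<le> (int n - 1) * int n" using n by (intro mult_right_mono) auto
    ultimately show ?thesis by (simp add: algebra_simps)
  qed
qed

text \<open>A nonzero second difference modulo \<open>n\<close> makes all three sequences
  contribute. Otherwise the sequences are linear modulo \<open>n\<close> and each nonzero one
  contributes \<open>n\<close>. The hypothesis \<open>single\<close> serves the case of one nonzero
  sequence: it turns linear residues into constant ones, to which the sum condition can be
  applied.\<close>

theorem three_sequences_bound:
  fixes f :: "nat \<Rightarrow> nat \<Rightarrow> int"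
  assumes n: "n \<ge> 4"
    and per: "\<And>k j. f k (j + n) = f k j"
    and m: "\<And>k j. k < 3 \<Longrightarrow> int n dvd f k (j + 2) - 2 * f k (j + 1) + f k j - m"
    and single: "\<And>k j. k < 3 \<Longrightarrow> (\<And>k' j. k' < 3 \<Longrightarrow> k' \<noteq> k \<Longrightarrow> f k' j = 0) \<Longrightarrow>
      int n dvd f k (j + 1) - f k j"
    and sum0: "(\<Sum>k<3. \<Sum>j<n. f k j) = 0"
    and nz: "k0 < 3" "i0 < n" "f k0 i0 \<noteq> 0"
  shows "2 * int n \<le> (\<Sum>k<3. \<Sum>j<n. (f k j)\<^sup>2)"
proof -
  define S where "S k = (\<Sum>j<n. (f k j)\<^sup>2)" for k
  define T where "T k = (\<Sum>j<n. f k j)" for k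
  have S0: "0 \<le> S k" for k unfolding S_def by (intro sum_nonneg) auto
  have sum3: "(\<Sum>k<3. g k) = g 0 + g 1 + g 2" for g :: "nat \<Rightarrow> int"
    by (simp add: eval_nat_numeral)
  have T: "T 0 + T 1 + T 2 = 0" using sum0 by (simp add: sum3 T_def)
  have lt3: "k < 3 \<longleftrightarrow> k = 0 \<or> k = 1 \<or> k = 2" for k :: nat by auto
  have "2 * int n \<le> S 0 + S 1 + S 2"
  proof (cases "int n dvd m")
    case False
    show ?thesis
    proof (cases "n \<ge> 7")
      case True
      obtain l c where lc: "int n dvd int l * m - c" "c * (int n - c) \<ge> 11"
        using large_multiple[OF True False] by blast
      have "int n * 11 \<le> 16 * S k" if "k < 3" for k
      proof -
        have "int n * 11 \<le> int n * (c * (int n - c))" using lc by (intro mult_left_mono) auto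
        also have "\<dots> \<le> 16 * S k"
          unfolding S_def by (rule second_difference_bound[of "f k" n, OF per m[OF that] lc(1)])
        finally show ?thesis .
      qed
      from this[of 0] this[of 1] this[of 2] show ?thesis by simp
    next
      case n7: False
      then have n': "n \<in> {4, 5, 6}" using n by auto
      have small: "n = 4 \<and> S k = 2 \<and> T k \<in> {2, -2}" if "k < 3" "S k < 4" for k
        using quadratic_small_period[of "f k" n, OF per m[OF that(1)] False n'] that(2)
        unfolding S_def T_def by blast
      show ?thesis
      proof (cases "n = 4")
        case True
        have "S k \<ge> 4 \<or> (S k = 2 \<and> (T k = 2 \<or> T k = -2))" if "k < 3" for k
          using small[OF that] by (cases "S k < 4") auto
        \<comment> \<open>Three sequences of square sum 2 would total 6 instead of 8, but three
          numbers equal to 2 or -2 never add up to zero.\<close>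
        from this[of 0] this[of 1] this[of 2] show ?thesis using T True by auto
      next
        case False
        have "S k \<ge> 4" if "k < 3" for k
          using small[OF that] False by (cases "S k < 4") auto
        from this[of 0] this[of 1] this[of 2] show ?thesis using n' by auto
      qed
    qed
  next
    case True
    have lin: "int n dvd f k (j + 1) - f k j - (f k 1 - f k 0)" if "k < 3" for k j
    proof (induction j)
      case (Suc j)
      have "int n dvd f k (j + 2) - 2 * f k (j + 1) + f k j"
        using dvd_add[OF m[OF that, of j] True] by simp
      from dvd_add[OF this Suc] show ?case by (simp add: algebra_simps)
    qed simp
    have nonzero: "int n \<le> S k" if "k < 3" "\<exists>i<n. f k i \<noteq> 0" for k
      using linear_bound[of n "f k", OF n per lin[OF that(1)]] that(2) unfolding S_def by blast
    have zero: "f k j = 0" if "\<not> (\<exists>i<n. f k i \<noteq> 0)" for k j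
    proof -
      have "f k (i + n * q) = f k i" for i q
      proof (induction q)
        case (Suc q)
        then show ?case using per[of k "i + n * q"] by (simp add: algebra_simps)
      qed simp
      from this[of "j mod n" "j div n"] have "f k j = f k (j mod n)" by simp
      then show ?thesis using that n by simp
    qed
    show ?thesis
    proof (cases "\<exists>k1<3. k1 \<noteq> k0 \<and> (\<exists>i<n. f k1 i \<noteq> 0)")
      case True
      then obtain k1 where k1: "k1 < 3" "k1 \<noteq> k0" "int n \<le> S k1" using nonzero by blast
      moreover have "int n \<le> S k0" using nonzero nz by blast
      ultimately show ?thesis using S0[of 0] S0[of 1] S0[of 2] nz(1) unfolding lt3 by auto
    next
      case False
      then have others: "f k j = 0" if "k < 3" "k \<noteq> k0" for k j using zero that by blast
      then have step: "int n dvd f k0 (j + 1) - f k0 j" for j using single[OF nz(1)] by blast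
      have const: "int n dvd f k0 j - f k0 0" for j
      proof (induction j)
        case (Suc j)
        from dvd_add[OF step[of j] Suc] show ?case by simp
      qed simp
      have "T k = 0" if "k < 3" "k \<noteq> k0" for k using others[OF that] by (simp add: T_def)
      from this[of 0] this[of 1] this[of 2] have "T k0 = 0"
        using T nz(1) unfolding lt3 by (elim disjE) simp_all
      then have "2 * int n \<le> S k0"
        using constant_residue_bound[OF n const nz(2,3)] unfolding S_def T_def by auto
      then show ?thesis using S0[of 0] S0[of 1] S0[of 2] nz(1) unfolding lt3 by auto
    qed
  qed
  then show ?thesis unfolding sum3 S_def .
qed

section \<open>Units with divisor supported on the cusps\<close>

lemma primitive_root_powi_eq:
  fixes \<zeta> :: complex
  assumes n: "n > 0" and \<zeta>: "\<zeta> ^ n = 1" "\<And>k. 0 < k \<Longrightarrow> k < n \<Longrightarrow> \<zeta> ^ k \<noteq> 1"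
    and eq: "\<zeta> powi a = \<zeta> powi b"
  shows "int n dvd a - b"
proof -
  have z: "\<zeta> \<noteq> 0" using n \<zeta>(1) by (auto simp: zero_power)
  define r where "r = (a - b) mod int n"
  have r: "0 \<le> r" "r < int n" using n by (simp_all add: r_def)
  have "a - b = int n * ((a - b) div int n) + r" by (simp add: r_def)
  then have "\<zeta> powi (a - b) = (\<zeta> powi int n) powi ((a - b) div int n) * \<zeta> powi r"
    using z by (metis power_int_add power_int_mult)
  moreover have "\<zeta> powi (a - b) = 1" using z eq by (simp add: power_int_diff)
  ultimately have "\<zeta> powi r = 1" using \<zeta>(1) by simp
  moreover have "\<zeta> powi r = \<zeta> ^ nat r" using r by (simp add: power_int_def)
  ultimately have "\<zeta> ^ nat r = 1" by simp
  then have "r = 0" using \<zeta>(2)[of "nat r"] r by (cases "r = 0") auto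
  then show ?thesis by (simp add: r_def dvd_eq_mod_eq_0)
qed

locale fermat_roots = fermat +
  fixes \<zeta> \<epsilon> :: complex
  assumes n_ge_4: "n \<ge> 4" and zeta: "\<zeta> ^ n = 1" "\<And>k. 0 < k \<Longrightarrow> k < n \<Longrightarrow> \<zeta> ^ k \<noteq> 1"
    and eps: "\<epsilon> ^ n = - 1"
begin

lemma zeta_nonzero: "\<zeta> \<noteq> 0" and eps_nonzero: "\<epsilon> \<noteq> 0"
  using zeta(1) eps n_pos by (auto simp: zero_power)

lemma zeta_power_root: "(\<zeta> ^ j) ^ n = 1"
  using zeta(1) by (metis mult.commute power_mult power_one)

lemma zeta_periodic: "\<zeta> ^ (j + n) = \<zeta> ^ j"
  by (simp add: power_add zeta)

section \<open>Orders at the three families of cusps\<close>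

definition cusp :: "nat \<Rightarrow> nat \<Rightarrow> complex \<times> complex \<times> complex" where
  "cusp k j = (if k = 0 then (0, \<zeta> ^ j, 1) else if k = 1 then (\<zeta> ^ j, 0, 1) else (\<epsilon> * \<zeta> ^ j, 1, 0))"

definition cusp_point :: "nat \<Rightarrow> nat \<Rightarrow> point" where
  "cusp_point k j = (case cusp k j of (a, b, c) \<Rightarrow> proj_point a b c)"

definition cusp_ord :: "nat \<Rightarrow> nat \<Rightarrow> complex fls \<Rightarrow> int" where
  "cusp_ord k j z = (case cusp k j of (a, b, c) \<Rightarrow> val a b c z)"

lemma cusp_ord_simps:
  "cusp_ord 0 j z = val 0 (\<zeta> ^ j) 1 z" "cusp_ord (Suc 0) j z = val (\<zeta> ^ j) 0 1 z"
  "cusp_ord 2 j z = val (\<epsilon> * \<zeta> ^ j) 1 0 z"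
  by (simp_all add: cusp_ord_def cusp_def)

lemma on_curve_cusps:
  "on_curve 0 (\<zeta> ^ j) 1" "on_curve (\<zeta> ^ j) 0 1" "on_curve (\<epsilon> * \<zeta> ^ j) 1 0"
  using n_pos by (simp_all add: on_curve_def zero_power zeta_power_root power_mult_distrib eps)

lemma cusp_ord_periodic: "cusp_ord k (j + n) z = cusp_ord k j z"
  by (simp add: cusp_ord_def cusp_def zeta_periodic)

lemma less_3: "k < 3 \<longleftrightarrow> k = 0 \<or> k = Suc 0 \<or> k = 2"
  by auto

lemma fermat_cusps_eq_image: "fermat_cusps n = (\<lambda>(k, j). cusp_point k j) ` ({..<3} \<times> {..<n})"
proof -
  have "{..<3::nat} \<times> {..<n} = {0} \<times> {..<n} \<union> {1} \<times> {..<n} \<union> {2} \<times> {..<n}" by auto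
  moreover have "(\<lambda>(k, j). cusp_point k j) ` ({k} \<times> {..<n}) = cusp_point k ` {..<n}" for k by force
  moreover have "cusp_point 0 = (\<lambda>j. proj_point 0 (\<zeta> ^ j) 1)"
    "cusp_point 1 = (\<lambda>j. proj_point (\<zeta> ^ j) 0 1)" "cusp_point 2 = (\<lambda>j. proj_point (\<epsilon> * \<zeta> ^ j) 1 0)"
    by (simp_all add: cusp_point_def cusp_def fun_eq_iff)
  ultimately have "(\<lambda>(k, j). cusp_point k j) ` ({..<3} \<times> {..<n}) =
      (\<lambda>j. proj_point 0 (\<zeta> ^ j) 1) ` {..<n} \<union> (\<lambda>j. proj_point (\<zeta> ^ j) 0 1) ` {..<n} \<union>
      (\<lambda>j. proj_point (\<epsilon> * \<zeta> ^ j) 1 0) ` {..<n}"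
    by (simp only: image_Un)
  moreover have "fermat_cusps n =
      (\<lambda>j. proj_point 0 (\<zeta> ^ j) 1) ` {..<n} \<union> (\<lambda>j. proj_point (\<zeta> ^ j) 0 1) ` {..<n} \<union>
      (\<lambda>j. proj_point (\<epsilon> * \<zeta> ^ j) 1 0) ` {..<n}"
    by (rule fermat_cusps_eq) (fact n_pos zeta eps)+
  ultimately show ?thesis by (simp only:)
qed

lemma inj_cusp_point: "inj_on (\<lambda>(k, j). cusp_point k j) ({..<3} \<times> {..<n})"
proof -
  have key: "k = k' \<and> \<zeta> ^ j = \<zeta> ^ j'"
    if kk: "k < 3" "k' < 3" and eq: "cusp_point k j = cusp_point k' j'" for k k' j j'
  proof -
    obtain a b c where 1: "cusp k j = (a, b, c)" by (cases "cusp k j") auto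
    obtain a' b' c' where 2: "cusp k' j' = (a', b', c')" by (cases "cusp k' j'") auto
    have "proj_point a b c = proj_point a' b' c'" using eq 1 2 by (simp add: cusp_point_def)
    then obtain l where "l \<noteq> 0" "a' = l * a" "b' = l * b" "c' = l * c"
      unfolding proj_point_eq_iff by blast
    then show ?thesis
      using 1 2 kk eps_nonzero zeta_nonzero unfolding less_3 by (elim disjE) (auto simp: cusp_def)
  qed
  show ?thesis
  proof (rule inj_onI)
    fix p q
    assume pq: "p \<in> {..<3} \<times> {..<n}" "q \<in> {..<3} \<times> {..<n}"
      "(\<lambda>(k, j). cusp_point k j) p = (\<lambda>(k, j). cusp_point k j) q"
    obtain k j k' j' where kj: "p = (k, j)" "q = (k', j')" by (cases p, cases q)
    have "k = k'" "\<zeta> ^ j = \<zeta> ^ j'" using key[of k k' j j'] pq by (simp_all add: kj)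
    moreover from this have "j = j'"
      using inj_onD[OF roots_unity_powers(1)[OF n_pos zeta], of j j'] pq by (simp add: kj)
    ultimately show "p = q" by (simp add: kj)
  qed
qed

text \<open>Two vanishing coordinates on the curve force the third to vanish. A point with a zero
  coordinate thus has exactly one, and is a cusp.\<close>

lemma on_curve_cases:
  assumes "on_curve a b c"
  obtains "a \<noteq> 0" "b \<noteq> 0" "c \<noteq> 0" "proj_point a b c \<notin> fermat_cusps n"
    | k j where "k < 3" "j < n" "proj_point a b c = cusp_point k j"
proof (cases "proj_point a b c \<in> fermat_cusps n")
  case True
  then show ?thesis using that(2) unfolding fermat_cusps_eq_image by auto
next
  case False
  have "proj_point a b c \<in> fermat_curve n"
    using assms unfolding fermat_curve_def on_curve_def by blast
  moreover have "(a' = 0 \<and> b' \<noteq> 0 \<and> c' \<noteq> 0) \<or> (a' \<noteq> 0 \<and> b' = 0 \<and> c' \<noteq> 0) \<or> (a' \<noteq> 0 \<and> b' \<noteq> 0 \<and> c' = 0)"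
    if "(a', b', c') \<in> proj_point a b c" "a = 0 \<or> b = 0 \<or> c = 0" for a' b' c'
    using that assms n_pos by (auto simp: proj_point_def on_curve_def zero_power)
  ultimately have "a \<noteq> 0 \<and> b \<noteq> 0 \<and> c \<noteq> 0"
    using False unfolding fermat_cusps_def by fast
  then show ?thesis using that(1) False by blast
qed

lemma val_eq_ord:
  assumes "proj_point a b c = cusp_point k j"
  shows "val a b c z = cusp_ord k j z"
  using assms val_cong[of a b c] by (auto simp: cusp_point_def cusp_ord_def split: prod.splits)

definition cuspidal :: "complex fls \<Rightarrow> bool" where
  "cuspidal z \<longleftrightarrow> z \<in> K \<and> z \<noteq> 0 \<and>
    (\<forall>a b c. on_curve a b c \<longrightarrow> a \<noteq> 0 \<longrightarrow> b \<noteq> 0 \<longrightarrow> c \<noteq> 0 \<longrightarrow> val a b c z = 0)"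

lemma cuspidal_nonneg_imp_const:
  assumes z: "cuspidal z" and cusp_ord: "\<And>k j. k < 3 \<Longrightarrow> cusp_ord k j z \<ge> 0"
  obtains d where "z = fls_const d" "d \<noteq> 0"
proof -
  have "val a b c z \<ge> 0" if oc: "on_curve a b c" for a b c
    using on_curve_cases[OF oc]
  proof cases
    case 1
    then show ?thesis using z oc by (auto simp: cuspidal_def)
  next
    case (2 k j)
    then show ?thesis using cusp_ord val_eq_ord by simp
  qed
  then show thesis using val_nonneg_imp_const[of z \<zeta>] that z zeta by (auto simp: cuspidal_def)
qed

lemma cusp_ord_const: "k < 3 \<Longrightarrow> d \<noteq> 0 \<Longrightarrow> cusp_ord k j (fls_const d) = 0"
  unfolding less_3 using on_curve_cusps val_const by (auto simp: cusp_ord_simps)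

lemma cusp_ord_mult:
  "k < 3 \<Longrightarrow> cuspidal z \<Longrightarrow> cuspidal w \<Longrightarrow> cusp_ord k j (z * w) = cusp_ord k j z + cusp_ord k j w"
  unfolding less_3 cuspidal_def using on_curve_cusps val_mult by (auto simp: cusp_ord_simps)

lemma cusp_ord_divide:
  "k < 3 \<Longrightarrow> cuspidal z \<Longrightarrow> cuspidal w \<Longrightarrow> cusp_ord k j (z / w) = cusp_ord k j z - cusp_ord k j w"
  unfolding less_3 cuspidal_def using on_curve_cusps val_divide by (auto simp: cusp_ord_simps)

lemma cusp_ord_inverse: "k < 3 \<Longrightarrow> cuspidal z \<Longrightarrow> cusp_ord k j (inverse z) = - cusp_ord k j z"
  unfolding less_3 cuspidal_def using on_curve_cusps val_inverse by (auto simp: cusp_ord_simps)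

lemma cusp_ord_power: "k < 3 \<Longrightarrow> cuspidal z \<Longrightarrow> cusp_ord k j (z ^ i) = int i * cusp_ord k j z"
  unfolding less_3 cuspidal_def using on_curve_cusps val_power by (auto simp: cusp_ord_simps)

lemma cuspidal_ops:
  "cuspidal z \<Longrightarrow> cuspidal w \<Longrightarrow> cuspidal (z * w)" "cuspidal z \<Longrightarrow> cuspidal w \<Longrightarrow> cuspidal (z / w)"
  "cuspidal z \<Longrightarrow> cuspidal (inverse z)" "cuspidal z \<Longrightarrow> cuspidal (z ^ i)"
  "cuspidal 1"
  unfolding cuspidal_def using val_const[of _ _ _ 1]
  by (auto simp: val_mult val_divide val_inverse val_power)

lemma cuspidal_powi: "cuspidal z \<Longrightarrow> cuspidal (z powi i)"
  by (simp add: power_int_def cuspidal_ops)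

lemma cusp_ord_powi: "k < 3 \<Longrightarrow> cuspidal z \<Longrightarrow> cusp_ord k j (z powi i) = i * cusp_ord k j z"
  by (auto simp: power_int_def cuspidal_ops cusp_ord_inverse cusp_ord_power)

lemma cuspidal_prod: "(\<And>i. i \<in> I \<Longrightarrow> cuspidal (f i)) \<Longrightarrow> cuspidal (prod f I)"
  by (induction I rule: infinite_finite_induct) (simp_all add: cuspidal_ops)

lemma cusp_ord_prod:
  "finite I \<Longrightarrow> (\<And>i. i \<in> I \<Longrightarrow> cuspidal (f i)) \<Longrightarrow> k < 3 \<Longrightarrow>
    cusp_ord k j (prod f I) = (\<Sum>i\<in>I. cusp_ord k j (f i))"
  by (induction I rule: finite_induct)
    (use cusp_ord_const[of k 1 j] in \<open>simp_all add: cusp_ord_mult cuspidal_prod\<close>)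

lemma cuspidal_aut:
  assumes z: "cuspidal z" and roots: "\<alpha> ^ n = 1" "\<beta> ^ n = 1"
  shows "cuspidal (aut \<alpha> \<beta> z)"
proof -
  have nz: "\<alpha> \<noteq> 0" "\<beta> \<noteq> 0" using roots n_pos by (auto simp: zero_power)
  have K: "z \<in> K" "z \<noteq> 0" using z by (auto simp: cuspidal_def)
  have "val a b c (aut \<alpha> \<beta> z) = 0" if "on_curve a b c" "a \<noteq> 0" "b \<noteq> 0" "c \<noteq> 0" for a b c
    using val_aut[OF that(1) roots K] on_curve_scale[OF roots that(1)] z nz that
    by (auto simp: cuspidal_def)
  then show ?thesis
    using K aut_K[OF roots] aut_hom(10)[OF roots] by (simp add: cuspidal_def)
qed

text \<open>At infinity only the ratio of the first two coordinates matters, so the index moves by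
  \<open>r - s\<close>; adding \<open>s\<close> on the left avoids the subtraction of natural
  numbers.\<close>

lemma cusp_ord_aut:
  assumes z: "cuspidal z"
  shows "cusp_ord 0 j (aut (\<zeta> ^ r) (\<zeta> ^ s) z) = cusp_ord 0 (j + s) z"
    "cusp_ord (Suc 0) j (aut (\<zeta> ^ r) (\<zeta> ^ s) z) = cusp_ord (Suc 0) (j + r) z"
    "cusp_ord 2 (j + s) (aut (\<zeta> ^ r) (\<zeta> ^ s) z) = cusp_ord 2 (j + r) z"
proof -
  have K: "z \<in> K" "z \<noteq> 0" using z by (auto simp: cuspidal_def)
  note v = val_aut[OF _ zeta_power_root zeta_power_root K]
  show "cusp_ord 0 j (aut (\<zeta> ^ r) (\<zeta> ^ s) z) = cusp_ord 0 (j + s) z"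
    "cusp_ord (Suc 0) j (aut (\<zeta> ^ r) (\<zeta> ^ s) z) = cusp_ord (Suc 0) (j + r) z"
    using v[OF on_curve_cusps(1)] v[OF on_curve_cusps(2)]
    by (simp_all add: cusp_ord_simps power_add mult.commute)
  have pp: "proj_point (\<epsilon> * \<zeta> ^ (j + r)) 1 0 = proj_point (\<zeta> ^ r * (\<epsilon> * \<zeta> ^ (j + s))) (\<zeta> ^ s * 1) 0"
    unfolding proj_point_eq_iff using zeta_nonzero
    by (intro exI[of _ "\<zeta> ^ s"]) (simp add: power_add)
  have "val (\<epsilon> * \<zeta> ^ (j + s)) 1 0 (aut (\<zeta> ^ r) (\<zeta> ^ s) z)
      = val (\<zeta> ^ r * (\<epsilon> * \<zeta> ^ (j + s))) (\<zeta> ^ s * 1) 0 z"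
    by (rule v[OF on_curve_cusps(3)])
  then show "cusp_ord 2 (j + s) (aut (\<zeta> ^ r) (\<zeta> ^ s) z) = cusp_ord 2 (j + r) z"
    unfolding cusp_ord_simps val_cong[OF pp] .
qed

text \<open>Two uses: the vector of x attains the minimum, and x, y, 1/x are the local parameters at
  the three families, on which the automorphisms act by scalars.\<close>

lemma cusp_ord_coordinates:
  "cusp_ord 0 j base_x = 1" "cusp_ord (Suc 0) j base_x = 0" "cusp_ord 2 j base_x = - 1"
  "cusp_ord 0 j fls_X = 0" "cusp_ord (Suc 0) j fls_X = 1" "cusp_ord 2 j fls_X = - 1"
  "cuspidal base_x" "cuspidal fls_X"
proof -
  note vb = val_branch[OF _ _ _ K_closed(5) base_x_nonzero] val_branch[OF _ _ _ K_closed(6) fls_X_nonzero]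
  have X: "specializes fls_X 0" unfolding specializes_def by (intro exI[of _ fps_X]) simp
  have ext: "ext u v base_x = u" "ext u v fls_X = v" if "branch a b c u v" for a b c u v
    using that by (auto simp: branch_def ext_hom)
  obtain v where v: "branch 0 (\<zeta> ^ j) 1 (fls_const (0 / 1) + fls_X) v" "specializes v (\<zeta> ^ j / 1)"
    "uniformizing (fls_const (0 / 1) + fls_X) v"
    using branch_unramified[OF on_curve_cusps(1)] zeta_nonzero
      by (metis one_neq_zero power_not_zero)
  then show "cusp_ord 0 j base_x = 1" "cusp_ord 0 j fls_X = 0"
    using vb[OF on_curve_cusps(1) v(1,3)] ext[OF v(1)] specializes_subdegree_0(1)[OF v(2)] zeta_nonzero
    by (simp_all add: cusp_ord_simps)
  obtain u where u: "branch (\<zeta> ^ j) 0 1 u fls_X" "specializes u (\<zeta> ^ j / 1)" "uniformizing u fls_X"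
    using branch_ramified[OF on_curve_cusps(2)] by (metis one_neq_zero)
  then show "cusp_ord (Suc 0) j base_x = 0" "cusp_ord (Suc 0) j fls_X = 1"
    using vb[OF on_curve_cusps(2) u(1,3)] ext[OF u(1)] specializes_subdegree_0(1)[OF u(2)] zeta_nonzero
    by (simp_all add: cusp_ord_simps)
  obtain r where r: "branch (\<epsilon> * \<zeta> ^ j) 1 0 (1 / fls_X) (r / fls_X)" "specializes r (1 / (\<epsilon> * \<zeta> ^ j))"
    "1 / (\<epsilon> * \<zeta> ^ j) \<noteq> 0" "uniformizing (1 / fls_X) (r / fls_X)"
    using branch_infinite[OF on_curve_cusps(3)] by metis
  have "fls_subdegree (1 / fls_X :: complex fls) = - 1" "fls_subdegree (r / fls_X) = - 1"
    using specializes_subdegree_0[OF r(2,3)] by (simp_all add: fls_divide_subdegree)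
  then show "cusp_ord 2 j base_x = - 1" "cusp_ord 2 j fls_X = - 1"
    using vb[OF on_curve_cusps(3) r(1,4)] ext[OF r(1)] by (simp_all add: cusp_ord_simps)
  have "val a b c base_x = 0 \<and> val a b c fls_X = 0"
    if oc: "on_curve a b c" and nz: "a \<noteq> 0" "b \<noteq> 0" "c \<noteq> 0" for a b c
  proof -
    obtain v where v: "branch a b c (fls_const (a / c) + fls_X) v" "specializes v (b / c)"
      "uniformizing (fls_const (a / c) + fls_X) v"
      using branch_unramified[OF oc nz(3,2)] by metis
    have "specializes (fls_const (a / c) + fls_X) (a / c + 0)"
      by (intro specializes_add specializes_const X)
    then show ?thesis
      using vb[OF oc v(1,3)] ext[OF v(1)] specializes_subdegree_0(1)[OF v(2)] nz
        specializes_subdegree_0(1)[of "fls_const (a / c) + fls_X"] by simp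
  qed
  then show "cuspidal base_x" "cuspidal fls_X"
    using base_x_nonzero by (auto simp: cuspidal_def)
qed

section \<open>Differences under the automorphisms\<close>

text \<open>In additive notation the automorphism minus the identity. On orders it is a difference
  of values along each family, and it is zero on a family whose points are fixed.\<close>

definition twist :: "nat \<Rightarrow> nat \<Rightarrow> complex fls \<Rightarrow> complex fls" where
  "twist r s z = aut (\<zeta> ^ r) (\<zeta> ^ s) z / z"

lemma twist_cuspidal: "cuspidal z \<Longrightarrow> cuspidal (twist r s z)"
  unfolding twist_def by (intro cuspidal_ops cuspidal_aut zeta_power_root)

lemma cusp_ord_twist:
  assumes z: "cuspidal z"
  shows "cusp_ord 0 j (twist r s z) = cusp_ord 0 (j + s) z - cusp_ord 0 j z"
    "cusp_ord (Suc 0) j (twist r s z) = cusp_ord (Suc 0) (j + r) z - cusp_ord (Suc 0) j z"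
    "cusp_ord 2 (j + s) (twist r s z) = cusp_ord 2 (j + r) z - cusp_ord 2 (j + s) z"
  unfolding twist_def
  using cusp_ord_divide[OF _ cuspidal_aut[OF z zeta_power_root zeta_power_root] z] cusp_ord_aut[OF z]
  by (simp_all add: less_3)

text \<open>The automorphisms commute, so in the triple difference any of the three may be taken as
  the last one applied.\<close>

lemma twist_commute:
  assumes z: "cuspidal z"
  shows "twist r s (twist r' s' z) = twist r' s' (twist r s z)"
proof -
  have K: "z \<in> K" "z \<noteq> 0" using z by (auto simp: cuspidal_def)
  note rt = zeta_power_root
  have aut_aut: "aut (\<zeta> ^ r) (\<zeta> ^ s) (aut (\<zeta> ^ r') (\<zeta> ^ s') z) = aut (\<zeta> ^ (r + r')) (\<zeta> ^ (s + s')) z" for r s r' s'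
    using ext_aut[OF rt[of r'] rt[of s'] curve_aut[OF rt[of r] rt[of s]] K(1)]
    unfolding aut_def by (simp add: power_add mult_ac flip: fls_const_mult_const)
  have "aut (\<zeta> ^ r) (\<zeta> ^ s) (aut (\<zeta> ^ r') (\<zeta> ^ s') z / z)
      = aut (\<zeta> ^ r) (\<zeta> ^ s) (aut (\<zeta> ^ r') (\<zeta> ^ s') z) / aut (\<zeta> ^ r) (\<zeta> ^ s) z" for r s r' s'
    using aut_hom(12)[OF rt rt] aut_K[OF rt rt K(1)] K by blast
  then show ?thesis
    unfolding twist_def by (simp add: aut_aut add.commute mult.commute)
qed

lemma twist_const_eigen:
  assumes "cuspidal z" "twist r s z = fls_const \<omega>"
  shows "aut (\<zeta> ^ r) (\<zeta> ^ s) z = fls_const \<omega> * z"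
  using assms by (auto simp: twist_def cuspidal_def field_simps)

text \<open>The parameters x and y have eigenvalue \<zeta> under the automorphism that fixes their
  family. At infinity the parameter is 1/x with the inverse eigenvalue, hence the minus sign; there
  the coordinate triple is fixed only up to the factor \<zeta>.\<close>

lemma eigenvalue_ord:
  assumes z: "cuspidal z"
  shows "twist 1 0 z = fls_const \<omega> \<Longrightarrow> \<omega> = \<zeta> powi cusp_ord 0 j z"
    "twist 0 1 z = fls_const \<omega> \<Longrightarrow> \<omega> = \<zeta> powi cusp_ord (Suc 0) j z"
    "twist 1 1 z = fls_const \<omega> \<Longrightarrow> \<omega> = \<zeta> powi (- cusp_ord 2 j z)"
proof -
  have K: "z \<in> K" "z \<noteq> 0" using z by (auto simp: cuspidal_def)
  have rt: "\<zeta> ^ n = 1" "1 ^ n = (1 :: complex)" using zeta by simp_all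
  show "\<omega> = \<zeta> powi cusp_ord 0 j z" if "twist 1 0 z = fls_const \<omega>"
    unfolding cusp_ord_simps
    by (rule eigenvalue_at_fixed_point[OF on_curve_cusps(1) rt(1,2), where \<gamma> = 1 and t = base_x])
      (use K base_x_nonzero twist_const_eigen[OF z that] cusp_ord_coordinates(1)[of j]
        aut_hom(8)[OF rt(1,2)] in \<open>simp_all add: cusp_ord_simps\<close>)
  show "\<omega> = \<zeta> powi cusp_ord (Suc 0) j z" if "twist 0 1 z = fls_const \<omega>"
    unfolding cusp_ord_simps
    by (rule eigenvalue_at_fixed_point[OF on_curve_cusps(2) rt(2,1), where \<gamma> = 1 and t = fls_X])
      (use K twist_const_eigen[OF z that] cusp_ord_coordinates(5)[of j]
        aut_hom(9)[OF rt(2,1)] in \<open>simp_all add: cusp_ord_simps\<close>)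
  have "aut \<zeta> \<zeta> (inverse base_x) = fls_const (inverse \<zeta>) * inverse base_x"
    using aut_hom(8,11)[OF rt(1,1)] by (simp add: fls_inverse_const)
  moreover have "val (\<epsilon> * \<zeta> ^ j) 1 0 (inverse base_x) = 1"
    using cusp_ord_inverse[OF _ cusp_ord_coordinates(7), of 2 j] cusp_ord_coordinates(3)[of j]
      by (simp add: cusp_ord_simps)
  ultimately have "\<omega> = inverse \<zeta> powi cusp_ord 2 j z" if "twist 1 1 z = fls_const \<omega>"
    unfolding cusp_ord_simps
    by (intro eigenvalue_at_fixed_point[OF on_curve_cusps(3) rt(1,1), where \<gamma> = \<zeta> and t = "inverse base_x"])
      (use K base_x_nonzero zeta_nonzero twist_const_eigen[OF z that] in simp_all)
  then show "\<omega> = \<zeta> powi (- cusp_ord 2 j z)" if "twist 1 1 z = fls_const \<omega>"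
    using that by (simp add: power_int_minus power_int_inverse)
qed

text \<open>The index \<open>j + 1\<close> is the form in which \<open>cusp_ord_twist\<close>
  supplies the orders at infinity when \<open>s\<close> is 1; by periodicity it covers all
  indices.\<close>

lemma zero_ord_imp_const:
  assumes "cuspidal z" "\<And>j. cusp_ord 0 j z = 0" "\<And>j. cusp_ord (Suc 0) j z = 0" "\<And>j. cusp_ord 2 (j + 1) z = 0"
  obtains \<omega> where "z = fls_const \<omega>"
proof -
  have "cusp_ord 2 j z = 0" for j
    using assms(4)[of "j + n - 1"] cusp_ord_periodic[of 2 j z] n_pos by simp
  then have "0 \<le> cusp_ord k j z" if "k < 3" for k j
    using that assms unfolding less_3 by auto
  then show thesis using cuspidal_nonneg_imp_const[OF assms(1)] that by blast
qed

text \<open>Each of \<open>w1\<close>, \<open>w2\<close>, \<open>w3\<close> omits a different one of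
  the three differences, and supplying it yields the same constant \<omega>. At the family fixed by
  the omitted automorphism the other two shift by one step each, so the order there is a second
  difference up to sign, while \<omega> is an eigenvalue.\<close>

lemma second_differences:
  assumes z: "cuspidal z"
  obtains m where
    "\<And>k j. k < 3 \<Longrightarrow> int n dvd cusp_ord k (j + 2) z - 2 * cusp_ord k (j + 1) z + cusp_ord k j z - m"
proof -
  define w1 where "w1 = twist 0 1 (twist 1 1 z)"
  define w2 where "w2 = twist 1 0 (twist 1 1 z)"
  define w3 where "w3 = twist 1 0 (twist 0 1 z)"
  note tc = twist_cuspidal
  have c: "cuspidal w1" "cuspidal w2" "cuspidal w3"
    unfolding w1_def w2_def w3_def by (intro tc z)+
  have eq: "twist 0 1 w2 = twist 1 0 w1" "twist 1 1 w3 = twist 1 0 w1"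
    unfolding w1_def w2_def w3_def
    using twist_commute[OF z] twist_commute[OF tc[OF z]] by metis+
  have o0: "cusp_ord 0 j w1 = cusp_ord 0 (j + 2) z - 2 * cusp_ord 0 (j + 1) z + cusp_ord 0 j z"
    "cusp_ord (Suc 0) j w1 = 0" "cusp_ord 2 (j + 1) w1 = cusp_ord 2 j (twist 1 1 z) - cusp_ord 2 (j + 1) (twist 1 1 z)"
    "cusp_ord (Suc 0) j w2 = cusp_ord (Suc 0) (j + 2) z - 2 * cusp_ord (Suc 0) (j + 1) z + cusp_ord (Suc 0) j z" for j
    using cusp_ord_twist(1)[OF tc[OF z], of j 0 1 1 1] cusp_ord_twist(1)[OF z, of j 1 1]
      cusp_ord_twist(1)[OF z, of "j + 1" 1 1] cusp_ord_twist(2)[OF tc[OF z], of j 0 1 1 1]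
      cusp_ord_twist(3)[OF tc[OF z], of j 1 0 1 1] cusp_ord_twist(2)[OF tc[OF z], of j 1 0 1 1]
      cusp_ord_twist(2)[OF z, of j 1 1] cusp_ord_twist(2)[OF z, of "j + 1" 1 1]
    by (simp_all add: w1_def w2_def numeral_2_eq_2)
  have p1: "cusp_ord 2 (j + 1) (twist 1 1 z) = 0" for j
    using cusp_ord_twist(3)[OF z, of j 1 1] by simp
  have "cusp_ord 2 j (twist 1 1 z) = 0" for j
    using p1[of "j + n - 1"] cusp_ord_periodic[of 2 j "twist 1 1 z"] n_pos by simp
  then have w1_2: "cusp_ord 2 (j + 1) w1 = 0" for j using o0(3)[of j] by simp
  then have w1_2': "cusp_ord 2 j w1 = 0" for j
    using cusp_ord_periodic[of 2 j w1] n_pos by (metis Suc_eq_plus1 Suc_pred add.commute add_Suc)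
  \<comment> \<open>The automorphisms of x and of y shift the points at infinity in opposite
    directions, which produces the minus sign. It cancels the one in
    \<open>eigenvalue_ord\<close>.\<close>
  have o3: "cusp_ord 2 (j + 1) w3 = - (cusp_ord 2 (j + 2) z - 2 * cusp_ord 2 (j + 1) z + cusp_ord 2 j z)" for j
    using cusp_ord_twist(3)[OF tc[OF z], of "j + 1" 0 1 0 1] cusp_ord_twist(3)[OF z, of j 1 0]
      cusp_ord_twist(3)[OF z, of "j + 1" 1 0] by (simp add: w3_def numeral_2_eq_2)
  have "cusp_ord 0 j (twist 1 0 w1) = 0" "cusp_ord (Suc 0) j (twist 1 0 w1) = 0" "cusp_ord 2 (j + 1) (twist 1 0 w1) = 0" for j
    using cusp_ord_twist(1)[OF c(1), of j 1 0] cusp_ord_twist(2)[OF c(1), of j 1 0]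
      cusp_ord_twist(3)[OF c(1), of "j + 1" 0 1] o0(2) w1_2' by simp_all
  then obtain \<omega> where \<omega>: "twist 1 0 w1 = fls_const \<omega>"
    using zero_ord_imp_const[OF tc[OF c(1)]] by metis
  define m where "m = cusp_ord 0 2 z - 2 * cusp_ord 0 1 z + cusp_ord 0 0 z"
  have "\<zeta> powi (cusp_ord k (j + 2) z - 2 * cusp_ord k (j + 1) z + cusp_ord k j z) = \<omega>" if "k < 3" for k j
  proof -
    consider "k = 0" | "k = Suc 0" | "k = 2" using \<open>k < 3\<close> by linarith
    then show ?thesis
    proof cases
      case 1
      then show ?thesis using eigenvalue_ord(1)[OF c(1) \<omega>, of j] o0(1)[of j] by simp
    next
      case 2
      then show ?thesis using eigenvalue_ord(2)[OF c(2), of \<omega> j] eq \<omega> o0(4)[of j] by simp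
    next
      case 3
      have "\<omega> = \<zeta> powi (- cusp_ord 2 (j + 1) w3)" using eigenvalue_ord(3)[OF c(3)] eq \<omega> by metis
      then show ?thesis using 3 by (simp only: o3 minus_minus)
    qed
  qed
  moreover from this[of 0 0] have "\<zeta> powi m = \<omega>" by (simp add: m_def numeral_2_eq_2)
  ultimately show thesis
    using that[of m] primitive_root_powi_eq[OF n_pos zeta] by metis
qed

text \<open>With all other orders zero, the single difference for the automorphism fixing the
  remaining family already has trivial divisor. The function itself is then an eigenfunction, and
  its eigenvalue is the same at every point of the family.\<close>

lemma single_type:
  assumes z: "cuspidal z" and k: "k < 3" and others: "\<And>k' j. k' < 3 \<Longrightarrow> k' \<noteq> k \<Longrightarrow> cusp_ord k' j z = 0"
  shows "int n dvd cusp_ord k (j + 1) z - cusp_ord k j z"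
proof -
  note tc = twist_cuspidal[OF z]
  note ot = cusp_ord_twist(1)[OF z] cusp_ord_twist(2)[OF z] cusp_ord_twist(3)[OF z, of _ 1] cusp_ord_twist(3)[OF z, of _ 0]
  consider "k = 0" | "k = Suc 0" | "k = 2" using k by linarith
  then show ?thesis
  proof cases
    case 1
    have o: "cusp_ord (Suc 0) j z = 0" "cusp_ord 2 j z = 0" for j using others 1 by auto
    obtain \<omega> where "twist 1 0 z = fls_const \<omega>"
      using zero_ord_imp_const[OF tc[of 1 0]] ot(1)[of _ 1 0] ot(2)[of _ 1 0]
        cusp_ord_twist(3)[OF z, of _ 0 1] o by (metis add_0_right diff_self)
    then show ?thesis
      using eigenvalue_ord(1)[OF z] primitive_root_powi_eq[OF n_pos zeta] 1 by metis
  next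
    case 2
    have o: "cusp_ord 0 j z = 0" "cusp_ord 2 j z = 0" for j using others 2 by auto
    obtain \<omega> where "twist 0 1 z = fls_const \<omega>"
      using zero_ord_imp_const[OF tc[of 0 1]] ot(1)[of _ 0 1] ot(2)[of _ 0 1]
        cusp_ord_twist(3)[OF z, of _ 1 0] o by (metis add_0_right diff_self)
    then show ?thesis
      using eigenvalue_ord(2)[OF z] primitive_root_powi_eq[OF n_pos zeta] 2 by metis
  next
    case 3
    have o: "cusp_ord 0 j z = 0" "cusp_ord (Suc 0) j z = 0" for j using others 3 by auto
    obtain \<omega> where "twist 1 1 z = fls_const \<omega>"
      using zero_ord_imp_const[OF tc[of 1 1]] ot(1)[of _ 1 1] ot(2)[of _ 1 1]
        cusp_ord_twist(3)[OF z, of _ 1 1] o by (metis diff_self)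
    then have "int n dvd - cusp_ord 2 j z - (- cusp_ord 2 (j + 1) z)"
      using eigenvalue_ord(3)[OF z] by (intro primitive_root_powi_eq[OF n_pos zeta]) metis+
    then show ?thesis using 3 by simp
  qed
qed

text \<open>The norm of \<open>z\<close> has constant order along each type of cusps; after division by powers of
  \<open>x\<close> and \<open>y\<close> only the cusps at infinity remain.\<close>

lemma degree_zero:
  assumes z: "cuspidal z"
  shows "(\<Sum>k<3. \<Sum>j<n. cusp_ord k j z) = 0"
proof -
  define T where "T k = (\<Sum>j<n. cusp_ord k j z)" for k
  \<comment> \<open>Over all pairs of exponents each cusp runs through its whole family
    \<open>n\<close> times, so the order of \<open>N\<close> is \<open>int n * T k\<close> at every
    cusp of family \<open>k\<close>.\<close>
  define N where "N = (\<Prod>r<n. \<Prod>s<n. aut (\<zeta> ^ r) (\<zeta> ^ s) z)"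
  define Q where "Q = N / (base_x powi (int n * T 0) * fls_X powi (int n * T 1))"
  have ca: "cuspidal (aut (\<zeta> ^ r) (\<zeta> ^ s) z)" for r s
    by (intro cuspidal_aut z zeta_power_root)
  have cN: "cuspidal N" unfolding N_def by (intro cuspidal_prod ca)
  have ordN: "cusp_ord k j N = (\<Sum>r<n. \<Sum>s<n. cusp_ord k j (aut (\<zeta> ^ r) (\<zeta> ^ s) z))" if "k < 3" for k j
    unfolding N_def using that by (simp add: cusp_ord_prod cuspidal_prod ca)
  have shift: "(\<Sum>j<n. cusp_ord k (j + i) z) = T k" "(\<Sum>j<n. cusp_ord k (i + j) z) = T k" for k i
    using sum_periodic_shift[of "\<lambda>j. cusp_ord k j z" n i] cusp_ord_periodic
    by (simp_all add: T_def add.commute)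
  have N0: "cusp_ord 0 j N = int n * T 0" for j
    by (simp add: ordN cusp_ord_aut[OF z] shift)
  have N1: "cusp_ord (Suc 0) j N = int n * T 1" for j
    by (simp add: ordN cusp_ord_aut[OF z] sum.swap[of _ "{..<n}"] shift flip: sum_distrib_left)
  have N2: "cusp_ord 2 j N = int n * T 2" for j
  proof -
    \<comment> \<open>\<open>j + n - s\<close> is the index \<open>j - s\<close> moved by one
      period, so that it stays a natural number.\<close>
    have "cusp_ord 2 j (aut (\<zeta> ^ r) (\<zeta> ^ s) z) = cusp_ord 2 ((j + n - s) + r) z" if "s < n" for r s
      using cusp_ord_aut(3)[OF z, of "j + n - s" s r] cusp_ord_periodic[of 2 j] that by simp
    then have "cusp_ord 2 j N = (\<Sum>r<n. \<Sum>s<n. cusp_ord 2 ((j + n - s) + r) z)"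
      using ordN[of 2 j] by simp
    also have "\<dots> = (\<Sum>s<n. \<Sum>r<n. cusp_ord 2 ((j + n - s) + r) z)" by (rule sum.swap)
    also have "\<dots> = (\<Sum>s<n. T 2)" by (intro sum.cong refl shift(2))
    finally show ?thesis by simp
  qed
  note cx = cuspidal_powi[OF cusp_ord_coordinates(7)] cuspidal_powi[OF cusp_ord_coordinates(8)]
  have cQ: "cuspidal Q" unfolding Q_def by (intro cuspidal_ops cN cx)
  have ordQ: "cusp_ord k j Q = cusp_ord k j N - (int n * T 0 * cusp_ord k j base_x + int n * T 1 * cusp_ord k j fls_X)"
    if "k < 3" for k j
    unfolding Q_def using that cN cx cusp_ord_coordinates(7,8)
    by (simp add: cusp_ord_divide cusp_ord_mult cusp_ord_powi cuspidal_ops del: fls_X_power_int)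
  define t where "t = int n * (T 0 + T 1 + T 2)"
  have Q: "cusp_ord 0 j Q = 0" "cusp_ord (Suc 0) j Q = 0" "cusp_ord 2 j Q = t" for j
    using cusp_ord_coordinates N0 N1 N2 by (simp_all add: ordQ t_def algebra_simps)
  \<comment> \<open>\<open>Q\<close> has the same order \<open>t\<close> at every point at infinity
    and order zero elsewhere. According to the sign of \<open>t\<close>, either \<open>Q\<close> or
    its inverse has no pole and is constant.\<close>
  have "t = 0"
  proof (cases "t \<ge> 0")
    case True
    then have "\<And>k j. k < 3 \<Longrightarrow> cusp_ord k j Q \<ge> 0" using Q by (auto simp: less_3)
    then obtain d where "Q = fls_const d" "d \<noteq> 0" using cuspidal_nonneg_imp_const[OF cQ] by blast
    then show ?thesis using cusp_ord_const[of 2 d 0] Q(3)[of 0] by simp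
  next
    case False
    have "cusp_ord k j (inverse Q) \<ge> 0" if "k < 3" for k j
      using Q[of j] False cusp_ord_inverse[OF that cQ, of j] that by (auto simp: less_3)
    then obtain d where d: "inverse Q = fls_const d" "d \<noteq> 0"
      using cuspidal_nonneg_imp_const[OF cuspidal_ops(3)[OF cQ]] by blast
    then show ?thesis using cusp_ord_const[of 2 d 0] Q(3)[of 0] cusp_ord_inverse[OF _ cQ, of 2 0]
      by simp
  qed
  then have "T 0 + T 1 + T 2 = 0" using n_pos by (simp add: t_def)
  then show ?thesis by (simp add: T_def eval_nat_numeral)
qed

theorem cuspidal_norm_bound:
  assumes z: "cuspidal z" and nz: "k < 3" "j < n" "cusp_ord k j z \<noteq> 0"
  shows "2 * int n \<le> (\<Sum>k<3. \<Sum>j<n. (cusp_ord k j z)\<^sup>2)"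
proof -
  obtain m where m: "\<And>k j. k < 3 \<Longrightarrow> int n dvd cusp_ord k (j + 2) z - 2 * cusp_ord k (j + 1) z + cusp_ord k j z - m"
    using second_differences[OF z] by blast
  show ?thesis
  proof (rule three_sequences_bound[where f = "\<lambda>k j. cusp_ord k j z",
      OF n_ge_4 cusp_ord_periodic _ _ degree_zero[OF z] nz])
    fix k j :: nat
    assume k: "k < 3"
    show "int n dvd cusp_ord k (j + 2) z - 2 * cusp_ord k (j + 1) z + cusp_ord k j z - m"
      by (rule m[OF k])
    assume "\<And>k' j. k' < 3 \<Longrightarrow> k' \<noteq> k \<Longrightarrow> cusp_ord k' j z = 0"
    then show "int n dvd cusp_ord k (j + 1) z - cusp_ord k j z" by (rule single_type[OF z k])
  qed
qed

section \<open>The lattice and its minimum distance\<close>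

definition divisor_vector :: "complex fls \<Rightarrow> point \<Rightarrow> real" where
  "divisor_vector z P = (if P \<in> fermat_cusps n then real_of_int (valuation_at n P (kappa z)) else 0)"

lemma divisor_vector_cusp:
  "k < 3 \<Longrightarrow> j < n \<Longrightarrow> divisor_vector z (cusp_point k j) = real_of_int (cusp_ord k j z)"
proof -
  assume kj: "k < 3" "j < n"
  then have "cusp_point k j \<in> fermat_cusps n" unfolding fermat_cusps_eq_image by force
  then show ?thesis by (simp add: divisor_vector_def cusp_ord_def val_def cusp_point_def split: prod.splits)
qed

lemma fermat_lattice_eq: "fermat_lattice n = divisor_vector ` {z. cuspidal z}"
proof -
  interpret F: cring "fermat_field n" by (rule cring_fermat_field)
  have zero: "Z = \<zero>\<^bsub>fermat_field n\<^esub> \<longleftrightarrow> iota Z = 0" if "Z \<in> carrier (fermat_field n)" for Z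
    using iota_simps(3)[OF that F.zero_closed] iota_one_zero by simp
  have units: "kappa z \<in> cuspidal_units n \<longleftrightarrow> cuspidal z" if z: "z \<in> K" for z
  proof -
    have "(\<forall>P\<in>fermat_curve n. valuation_at n P (kappa z) \<noteq> 0 \<longrightarrow> P \<in> fermat_cusps n) \<longleftrightarrow>
        (\<forall>a b c. on_curve a b c \<longrightarrow> val a b c z \<noteq> 0 \<longrightarrow> proj_point a b c \<in> fermat_cusps n)"
      unfolding fermat_curve_def on_curve_def val_def by blast
    also have "\<dots> \<longleftrightarrow> (\<forall>a b c. on_curve a b c \<longrightarrow> a \<noteq> 0 \<longrightarrow> b \<noteq> 0 \<longrightarrow> c \<noteq> 0 \<longrightarrow> val a b c z = 0)"
    proof (intro iffI allI impI)
      fix a b c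
      assume H: "\<forall>a b c. on_curve a b c \<longrightarrow> val a b c z \<noteq> 0 \<longrightarrow> proj_point a b c \<in> fermat_cusps n"
        and oc: "on_curve a b c" and nz: "a \<noteq> 0" "b \<noteq> 0" "c \<noteq> 0"
      have "(a, b, c) \<in> proj_point a b c" by (auto simp: proj_point_def intro!: exI[of _ 1])
      then have "proj_point a b c \<notin> fermat_cusps n" using nz by (auto simp: fermat_cusps_def)
      then show "val a b c z = 0" using H oc by blast
    next
      fix a b c
      assume H: "\<forall>a b c. on_curve a b c \<longrightarrow> a \<noteq> 0 \<longrightarrow> b \<noteq> 0 \<longrightarrow> c \<noteq> 0 \<longrightarrow> val a b c z = 0"
        and oc: "on_curve a b c" and nz: "val a b c z \<noteq> 0"
      show "proj_point a b c \<in> fermat_cusps n"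
        using on_curve_cases[OF oc]
      proof cases
        case 1
        then show ?thesis using H oc nz by blast
      next
        case (2 k j)
        then show ?thesis unfolding fermat_cusps_eq_image by force
      qed
    qed
    finally show ?thesis
      unfolding cuspidal_units_def cuspidal_def using z kappa[OF z] zero[OF kappa(1)[OF z]] by auto
  qed
  have "cuspidal_units n = kappa ` {z. cuspidal z}"
  proof (intro equalityI subsetI)
    fix Z assume Z: "Z \<in> cuspidal_units n"
    then have "Z \<in> carrier (fermat_field n)" by (simp add: cuspidal_units_def)
    then have iZ: "iota Z \<in> K" "kappa (iota Z) = Z" using iota_simps(1,4)[of Z Z] by simp_all
    then have "cuspidal (iota Z)" using units[OF iZ(1)] Z by simp
    then show "Z \<in> kappa ` {z. cuspidal z}" by (intro image_eqI[of _ _ "iota Z"]) (simp_all add: iZ)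
  next
    fix Z assume "Z \<in> kappa ` {z. cuspidal z}"
    then show "Z \<in> cuspidal_units n" using units by (auto simp: cuspidal_def)
  qed
  then show ?thesis
    unfolding fermat_lattice_def divisor_vector_def by (simp add: image_image)
qed

lemma L2_set_divisor_vector:
  "L2_set (divisor_vector z) (fermat_cusps n) = sqrt (real_of_int (\<Sum>k<3. \<Sum>j<n. (cusp_ord k j z)\<^sup>2))"
proof -
  have "(\<Sum>P\<in>fermat_cusps n. (divisor_vector z P)\<^sup>2)
      = (\<Sum>(k, j)\<in>{..<3} \<times> {..<n}. (divisor_vector z (cusp_point k j))\<^sup>2)"
    unfolding fermat_cusps_eq_image
    by (subst sum.reindex[OF inj_cusp_point]) (simp add: case_prod_unfold)
  also have "\<dots> = (\<Sum>k<3. \<Sum>j<n. (divisor_vector z (cusp_point k j))\<^sup>2)"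
    by (simp add: sum.cartesian_product)
  also have "\<dots> = (\<Sum>k<3. \<Sum>j<n. (real_of_int (cusp_ord k j z))\<^sup>2)"
    by (intro sum.cong refl) (simp add: divisor_vector_cusp)
  finally show ?thesis by (simp add: L2_set_def)
qed

theorem min_distance_fermat:
  "min_distance (fermat_cusps n) (fermat_lattice n) = sqrt (2 * real n)"
  unfolding min_distance_def
proof (rule Least_equality)
  have "(\<Sum>k<3. \<Sum>j<n. (cusp_ord k j base_x)\<^sup>2) = 2 * int n"
    by (simp add: eval_nat_numeral cusp_ord_coordinates(1-3)[simplified numeral_2_eq_2])
  then have "L2_set (divisor_vector base_x) (fermat_cusps n) = sqrt (2 * real n)"
    by (simp add: L2_set_divisor_vector)
  moreover from this have "divisor_vector base_x \<noteq> (\<lambda>_. 0)"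
    using n_pos by (auto simp: L2_set_def)
  moreover have "divisor_vector base_x \<in> fermat_lattice n"
    unfolding fermat_lattice_eq using cusp_ord_coordinates(7) by blast
  ultimately show "\<exists>v\<in>fermat_lattice n. v \<noteq> (\<lambda>_. 0) \<and> sqrt (2 * real n) = L2_set v (fermat_cusps n)"
    by (intro bexI[of _ "divisor_vector base_x"]) auto
next
  fix d
  assume "\<exists>v\<in>fermat_lattice n. v \<noteq> (\<lambda>_. 0) \<and> d = L2_set v (fermat_cusps n)"
  then obtain z where z: "cuspidal z" "divisor_vector z \<noteq> (\<lambda>_. 0)"
    "d = L2_set (divisor_vector z) (fermat_cusps n)"
    unfolding fermat_lattice_eq by blast
  then obtain P where P: "divisor_vector z P \<noteq> 0" by auto
  then have "P \<in> fermat_cusps n" by (auto simp: divisor_vector_def split: if_splits)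
  then obtain k j where "k < 3" "j < n" "P = cusp_point k j"
    unfolding fermat_cusps_eq_image by auto
  with P have "k < 3" "j < n" "cusp_ord k j z \<noteq> 0" by (auto simp: divisor_vector_cusp)
  from cuspidal_norm_bound[OF z(1) this]
  have "real_of_int (2 * int n) \<le> real_of_int (\<Sum>k<3. \<Sum>j<n. (cusp_ord k j z)\<^sup>2)"
    by (simp only: of_int_le_iff)
  then show "sqrt (2 * real n) \<le> d"
    unfolding z(3) L2_set_divisor_vector by simp
qed

end

lemma primitive_root_exists:
  assumes "n > 0"
  obtains \<zeta> :: complex where "\<zeta> ^ n = 1" "\<And>k. 0 < k \<Longrightarrow> k < n \<Longrightarrow> \<zeta> ^ k \<noteq> 1"
proof
  let ?f = "\<lambda>k. cis (2 * pi * real k / real n)"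
  have pow: "?f 1 ^ k = ?f k" for k
    by (simp add: DeMoivre mult_ac)
  note bij = bij_betw_roots_unity[OF assms]
  show "?f 1 ^ n = 1" using assms unfolding pow by simp
  show "?f 1 ^ k \<noteq> 1" if "0 < k" "k < n" for k
    unfolding pow using inj_onD[OF bij_betw_imp_inj_on[OF bij], of k 0] that by auto
qed

theorem corollary3p4:
  fixes n :: nat
  assumes "n \<ge> 4"
  shows "min_distance (fermat_cusps n) (fermat_lattice n) = sqrt (2 * real n)"
proof -
  have n: "n > 0" using assms by simp
  obtain \<zeta> :: complex where \<zeta>: "\<zeta> ^ n = 1" "\<And>k. 0 < k \<Longrightarrow> k < n \<Longrightarrow> \<zeta> ^ k \<noteq> 1"
    using primitive_root_exists[OF n] by blast
  obtain \<epsilon> :: complex where "\<epsilon> ^ n = - 1" using nth_root_exists[OF n] by blast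
  then interpret fermat_roots n \<zeta> \<epsilon> using assms n \<zeta> by unfold_locales auto
  show ?thesis by (rule min_distance_fermat)
qed

end
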